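(* Let $N,n,k$ be positive integers. The space $\mathcal H_N(n,k)$ is a simple module over the deformed double current algebra $\mathsf A^{(n)}$ (acting as described in the context). Moreover: (1) $\mathcal H_N(n,k)$ is a cyclic $U(\mathfrak{gl}_n[z])$-module generated by an arbitrary nonzero ground state $v\in\mathcal H_N(n,k)_0$, where $\mathfrak{gl}_n[z]$ acts by $E^a_b\otimes z^m\mapsto \mathsf T_{0,m}(E^a_b)=A^aX^mB_b$; (2) $\mathcal H_N(n,k)$ is a semisimple $Y(\mathfrak{gl}_n)$-module, where the RTT generators of the Yangian $Y(\mathfrak{gl}_n)$ act by $T^a_b(u)\mapsto\delta^a_b+A^a\frac{1}{u-XY}B_b$.
   Context: Repeated indices are summed. $\mathbb C[X,A]$ is the polynomial ring in $X^i_j$ ($1\le i,j\le N$), $A^a_i$ ($1\le a\le n$, $1\le i\le N$), entries of an $N\times N$ matrix $X$ and an $n\times N$ matrix $A$. Operators on $\mathbb C[X,A]$: $X^i_j,A^a_i$ act by multiplication, $Y^i_j=\partial/\partial X^j_i$, $B^i_a=\partial/\partial A^a_i$; matrix products of operators are formed keeping the written order, e.g. $(XY)^i_j=X^i_lY^l_j$, $A^aX^mB_b=A^a_i(X^m)^i_jB^j_b$. Define $$\mathcal H_N(n,k)=\{f\in\mathbb C[X,A]: f(gXg^{-1},Ag^{-1})=\det(g)^{-k}f(X,A)\ \forall g\in GL_N(\mathbb C)\}.$$ Energy grading: $\deg X=1,\deg A=0$; $\mathcal H_N(n,k)_0$ is the lowest-degree homogeneous subspace (ground states). DDCA: $\mathsf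 A^{(n)}$ is the $\mathbb C[\epsilon_1,\epsilon_2]$-algebra generated by $\mathsf T_{p,q}(x),\mathsf t_{p,q}$ ($x\in\mathfrak{gl}_n$, $p,q\in\mathbb N$) with the following relations, where $\epsilon_3=-n\epsilon_1-\epsilon_2$, $\Omega=E^a_b\otimes E^b_a$ and $\mathsf T_{u,r,t,s}(x\otimes y)=\mathsf T_{u,r}(x)\mathsf T_{t,s}(y)$: (A0) $\mathsf T_{r,s}(1)=\epsilon_2\mathsf t_{r,s}$ and $\mathsf T_{r,s}$ is linear in $x$; (A1) $[\mathsf T_{0,0}(x),\mathsf T_{0,m}(y)]=\mathsf T_{0,m}([x,y])$, $[\mathsf T_{0,0}(x),\mathsf t_{0,m}]=0$; (A2) for $p+q\le2$: $[\mathsf t_{p,q},\mathsf T_{r,s}(x)]=(sp-rq)\mathsf T_{p+r-1,q+s-1}(x)$, $[\mathsf t_{p,q},\mathsf t_{r,s}]=(sp-rq)\mathsf t_{p+r-1,q+s-1}$; (A3) $[\mathsf T_{1,0}(x),\mathsf T_{0,m}(y)]=\mathsf T_{1,m}([x,y])-\frac{\epsilon_3m}{2}\mathsf T_{0,m-1}(xy+yx)-m\epsilon_1\mathrm{tr}(y)\mathsf T_{0,m-1}(x)+\epsilon_1\sum_{j=0}^{m-1}\frac{j+1}{m+1}\mathsf T_{0,j,0,m-1-j}(([x,y]\otimes1)\Omega)+\epsilon_1\sum_{j=0}^{m-1}\mathsf T_{0,j,0,m-1-j}((x\otimes y-xy\otimes1)\Omega)$, and $[\mathsf T_{1,0}(x),\mathsf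 t_{0,m}]=m\mathsf T_{0,m-1}(x)$; (A4) for $m\ge3$: $[\mathsf t_{3,0},\mathsf t_{0,m}]=3m\,\mathsf t_{2,m-1}+\frac{m(m-1)(m-2)}4(\epsilon_1^2-\epsilon_2\epsilon_3)\mathsf t_{0,m-3}-\frac{3\epsilon_1}2\sum_{j=0}^{m-3}(j+1)(m-2-j)\big(\mathsf T_{0,j,0,m-3-j}(\Omega)+\epsilon_1\epsilon_2\mathsf t_{0,j}\mathsf t_{0,m-3-j}\big)$. It is known that $\mathsf A^{(n)}$ acts on $\mathcal H_N(n,k)$ by $$\epsilon_1\mapsto1,\ \ \epsilon_2\mapsto k,\ \ \mathsf T_{p,q}(E^a_b)\mapsto A^a\,\mathrm{Sym}(Y^pX^q)B_b,\ \ \mathsf t_{p,q}\mapsto\mathrm{Tr}\,\mathrm{Sym}(Y^pX^q),$$ where $\mathrm{Sym}(Y^pX^q)$ is the average over all orderings of the product of $p$ factors $Y$ and $q$ factors $X$. Yangian: $Y(\mathfrak{gl}_n)$ is generated by the coefficients of $T^a_b(u)=\delta^a_b+\sum_{s\ge0}T^a_{b;s}u^{-s-1}$, $1\le a,b\le n$, with relations $(u-v)[T^a_b(u),T^c_d(v)]=T^c_b(u)T^a_d(v)-T^c_b(v)T^a_d(u)$. Here $A^a\frac1{u-XY}B_b=\sum_{s\ge0}u^{-s-1}A^a(XY)^sB_b$; it is known that this defines a $Y(\mathfrak{gl}_n)$-action on $\mathcal H_N(n,k)$. *)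

theory Defs
  imports
    "HOL-Analysis.Analysis"
    "HOL-Library.Poly_Mapping"
    "HOL-Computational_Algebra.Polynomial"
    "HOL-Combinatorics.Multiset_Permutations"
    "HOL-Algebra.QuotRing"
begin

section \<open>Algebras presented by generators and relations\<close>

text \<open>
  Words under concatenation form the free monoid; finitely supported functions on words, with the
  convolution product of \<^theory>\<open>HOL-Library.Poly_Mapping\<close>, form the free associative algebra.
\<close>

datatype 'g word = Word (letters: "'g list")

instantiation word :: (type) monoid_add
begin
definition zero_word :: "'a word" where "0 = Word []"
definition plus_word :: "'a word \<Rightarrow> 'a word \<Rightarrow> 'a word"
  where "u + v = Word (letters u @ letters v)"
instance by standard (auto simp: zero_word_def plus_word_def)
end

type_synonym ('g, 'r) free_alg = "'g word \<Rightarrow>\<^sub>0 'r"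

definition gen :: "'g \<Rightarrow> ('g, 'r::comm_ring_1) free_alg"
  where "gen g = Poly_Mapping.single (Word [g]) 1"

definition const :: "'r \<Rightarrow> ('g, 'r::comm_ring_1) free_alg"
  where "const c = Poly_Mapping.single 0 c"

definition comm :: "'a::ring_1 \<Rightarrow> 'a \<Rightarrow> 'a"
  where "comm x y = x * y - y * x"

definition free_ring :: "('g, 'r::comm_ring_1) free_alg ring"
  where "free_ring = \<lparr>carrier = UNIV, monoid.mult = (*), one = 1, ring.zero = 0, add = (+)\<rparr>"

lemma ring_free_ring: "ring (free_ring :: ('g, 'r::comm_ring_1) free_alg ring)"
proof (rule ringI)
  show "abelian_group (free_ring :: ('g, 'r) free_alg ring)"
    by (rule abelian_groupI)
      (auto simp: free_ring_def algebra_simps intro: exI[of _ "- x" for x])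
  show "monoid (free_ring :: ('g, 'r) free_alg ring)"
    by unfold_locales (auto simp: free_ring_def algebra_simps)
qed (auto simp: free_ring_def algebra_simps)

text \<open>A relation \<open>rel l r\<close> stands for the defining equation \<open>l = r\<close>; \<^const>\<open>genideal\<close> is two-sided.\<close>

definition rel_ideal ::
    "(('g, 'r::comm_ring_1) free_alg \<Rightarrow> ('g, 'r) free_alg \<Rightarrow> bool) \<Rightarrow> ('g, 'r) free_alg set"
  where "rel_ideal rel = genideal free_ring {l - r | l r. rel l r}"

definition presented ::
    "(('g, 'r::comm_ring_1) free_alg \<Rightarrow> ('g, 'r) free_alg \<Rightarrow> bool) \<Rightarrow> ('g, 'r) free_alg set ring"
  where "presented rel = FactRing free_ring (rel_ideal rel)"

definition cls ::
    "(('g, 'r::comm_ring_1) free_alg \<Rightarrow> ('g, 'r) free_alg \<Rightarrow> bool) \<Rightarrow> ('g, 'r) free_alg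
      \<Rightarrow> ('g, 'r) free_alg set"
  where "cls rel x = a_r_coset free_ring (rel_ideal rel) x"

lemma ring_presented: "ring (presented rel)"
  unfolding presented_def rel_ideal_def
  by (rule ideal.quotient_is_ring, rule ring.genideal_ideal[OF ring_free_ring])
    (simp add: free_ring_def)

lemma carrier_presented: "carrier (presented rel) = range (cls rel)"
  by (auto simp: presented_def FactRing_def A_RCOSETS_def' cls_def free_ring_def)

section \<open>Modules over a not necessarily commutative ring\<close>

text \<open>The underlying abelian group is a subgroup \<open>V\<close> of the type \<open>'v\<close>.\<close>

definition left_module ::
    "('a, 'm) ring_scheme \<Rightarrow> 'v::ab_group_add set \<Rightarrow> ('a \<Rightarrow> 'v \<Rightarrow> 'v) \<Rightarrow> bool"
  where "left_module R V act \<longleftrightarrow>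
    0 \<in> V \<and> (\<forall>v\<in>V. \<forall>w\<in>V. v - w \<in> V) \<and>
    (\<forall>r\<in>carrier R. \<forall>v\<in>V. act r v \<in> V) \<and>
    (\<forall>r\<in>carrier R. \<forall>v\<in>V. \<forall>w\<in>V. act r (v + w) = act r v + act r w) \<and>
    (\<forall>r\<in>carrier R. \<forall>s\<in>carrier R. \<forall>v\<in>V. act (r \<oplus>\<^bsub>R\<^esub> s) v = act r v + act s v) \<and>
    (\<forall>r\<in>carrier R. \<forall>s\<in>carrier R. \<forall>v\<in>V. act (r \<otimes>\<^bsub>R\<^esub> s) v = act r (act s v)) \<and>
    (\<forall>v\<in>V. act \<one>\<^bsub>R\<^esub> v = v)"

definition submodule_of ::
    "('a, 'm) ring_scheme \<Rightarrow> 'v::ab_group_add set \<Rightarrow> ('a \<Rightarrow> 'v \<Rightarrow> 'v) \<Rightarrow> 'v set \<Rightarrow> bool"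
  where "submodule_of R V act W \<longleftrightarrow> W \<subseteq> V \<and> left_module R W act"

definition simple_module ::
    "('a, 'm) ring_scheme \<Rightarrow> 'v::ab_group_add set \<Rightarrow> ('a \<Rightarrow> 'v \<Rightarrow> 'v) \<Rightarrow> bool"
  where "simple_module R V act \<longleftrightarrow>
    left_module R V act \<and> V \<noteq> {0} \<and> (\<forall>W. submodule_of R V act W \<longrightarrow> W = {0} \<or> W = V)"

definition generates_module ::
    "('a, 'm) ring_scheme \<Rightarrow> 'v::ab_group_add set \<Rightarrow> ('a \<Rightarrow> 'v \<Rightarrow> 'v) \<Rightarrow> 'v \<Rightarrow> bool"
  where "generates_module R V act v \<longleftrightarrow> v \<in> V \<and> V = {act r v | r. r \<in> carrier R}"

text \<open>\<open>V\<close> is the internal direct sum of the members of \<open>S\<close>.\<close>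

definition direct_sum_of :: "'v::ab_group_add set \<Rightarrow> 'v set set \<Rightarrow> bool"
  where "direct_sum_of V S \<longleftrightarrow>
    (\<forall>W\<in>S. W \<subseteq> V) \<and>
    (\<forall>v\<in>V. \<exists>!c. (\<forall>W\<in>S. c W \<in> W) \<and> (\<forall>W. W \<notin> S \<longrightarrow> c W = 0) \<and>
        finite {W. c W \<noteq> 0} \<and> v = (\<Sum>W\<in>{W. c W \<noteq> 0}. c W))"

definition semisimple_module ::
    "('a, 'm) ring_scheme \<Rightarrow> 'v::ab_group_add set \<Rightarrow> ('a \<Rightarrow> 'v \<Rightarrow> 'v) \<Rightarrow> bool"
  where "semisimple_module R V act \<longleftrightarrow>
    left_module R V act \<and>
    (\<exists>S. (\<forall>W\<in>S. submodule_of R V act W \<and> simple_module R W act) \<and> direct_sum_of V S)"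

section \<open>The polynomial ring and its operators\<close>

text \<open>\<open>XV i j\<close> is \<open>X\<^sup>i\<^sub>j\<close> and \<open>AV a i\<close> is \<open>A\<^sup>a\<^sub>i\<close>: upper (row) index first. \<open>N = CARD('N)\<close>, \<open>n = CARD('n)\<close>.\<close>

datatype ('n, 'N) var = XV 'N 'N | AV 'n 'N

type_synonym ('n, 'N) pol = "(('n, 'N) var \<Rightarrow>\<^sub>0 nat) \<Rightarrow>\<^sub>0 complex"

definition smul :: "complex \<Rightarrow> ('n, 'N) pol \<Rightarrow> ('n, 'N) pol"
  where "smul c f = Poly_Mapping.single 0 c * f"

definition mul_var :: "('n, 'N) var \<Rightarrow> ('n, 'N) pol \<Rightarrow> ('n, 'N) pol"
  where "mul_var v f = Poly_Mapping.single (Poly_Mapping.single v 1) 1 * f"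

definition deriv_var :: "('n, 'N) var \<Rightarrow> ('n, 'N) pol \<Rightarrow> ('n, 'N) pol"
  where "deriv_var v f =
    (\<Sum>m\<in>Poly_Mapping.keys f.
      Poly_Mapping.single (m - Poly_Mapping.single v 1)
        (of_nat (Poly_Mapping.lookup m v) * Poly_Mapping.lookup f m))"

definition eval_pol ::
    "('n::finite, 'N::finite) pol \<Rightarrow> complex^'N^'N \<Rightarrow> complex^'N^'n \<Rightarrow> complex"
  where "eval_pol f X A =
    (\<Sum>m\<in>Poly_Mapping.keys f. Poly_Mapping.lookup f m *
      (\<Prod>i\<in>UNIV. \<Prod>j\<in>UNIV. X $ i $ j ^ Poly_Mapping.lookup m (XV i j)) *
      (\<Prod>a\<in>UNIV. \<Prod>i\<in>UNIV. A $ a $ i ^ Poly_Mapping.lookup m (AV a i)))"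

type_synonym ('n, 'N) oper = "('n, 'N) pol \<Rightarrow> ('n, 'N) pol"

text \<open>Matrices of operators are indexed by row (upper index) and then column (lower index).\<close>

definition opX :: "'N \<Rightarrow> 'N \<Rightarrow> ('n, 'N) oper" where "opX i j = mul_var (XV i j)"
definition opY :: "'N \<Rightarrow> 'N \<Rightarrow> ('n, 'N) oper" where "opY i j = deriv_var (XV j i)"
definition opA :: "'n \<Rightarrow> 'N \<Rightarrow> ('n, 'N) oper" where "opA a i = mul_var (AV a i)"
definition opB :: "'N \<Rightarrow> 'n \<Rightarrow> ('n, 'N) oper" where "opB i a = deriv_var (AV a i)"

fun mat_word :: "('N::finite \<Rightarrow> 'N \<Rightarrow> ('n, 'N) oper) list \<Rightarrow> 'N \<Rightarrow> 'N \<Rightarrow> ('n, 'N) oper"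
  where
    "mat_word [] i j f = (if i = j then f else 0)"
  | "mat_word (P # Ps) i j f = (\<Sum>l\<in>UNIV. P i l (mat_word Ps l j f))"

text \<open>
  Averaging over the distinct words with \<open>p\<close> letters \<open>Y\<close> and \<open>q\<close> letters \<open>X\<close> is the same as averaging
  over all \<open>(p + q)!\<close> orderings, since every word arises from equally many of them.
\<close>

definition Sym :: "nat \<Rightarrow> nat \<Rightarrow> 'N::finite \<Rightarrow> 'N \<Rightarrow> ('n, 'N) oper"
  where "Sym p q i j f =
    (let W = permutations_of_multiset (replicate_mset p opY + replicate_mset q opX)
     in smul (1 / of_nat (card W)) (\<Sum>w\<in>W. mat_word w i j f))"

definition Tr :: "('N::finite \<Rightarrow> 'N \<Rightarrow> ('n, 'N) oper) \<Rightarrow> ('n, 'N) oper"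
  where "Tr P f = (\<Sum>i\<in>UNIV. P i i f)"

text \<open>The operator \<open>A\<^sup>a P B\<^sub>b\<close>.\<close>

definition AB ::
    "'n \<Rightarrow> ('N::finite \<Rightarrow> 'N \<Rightarrow> ('n, 'N) oper) \<Rightarrow> 'n \<Rightarrow> ('n, 'N) oper"
  where "AB a P b f = (\<Sum>i\<in>UNIV. \<Sum>j\<in>UNIV. opA a i (P i j (opB j b f)))"

section \<open>The space of states\<close>

definition HN :: "nat \<Rightarrow> ('n::finite, 'N::finite) pol set"
  where "HN k = {f. \<forall>(g :: complex^'N^'N) (X :: complex^'N^'N) (A :: complex^'N^'n).
    invertible g \<longrightarrow>
      eval_pol f (g ** X ** matrix_inv g) (A ** matrix_inv g)
        = inverse (det g ^ k) * eval_pol f X A}"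

definition X_degree :: "(('n, 'N::finite) var \<Rightarrow>\<^sub>0 nat) \<Rightarrow> nat"
  where "X_degree m = (\<Sum>i\<in>UNIV. \<Sum>j\<in>UNIV. Poly_Mapping.lookup m (XV i j))"

definition HN_degree :: "nat \<Rightarrow> nat \<Rightarrow> ('n::finite, 'N::finite) pol set"
  where "HN_degree k d = {f \<in> HN k. \<forall>m\<in>Poly_Mapping.keys f. X_degree m = d}"

definition ground_states :: "nat \<Rightarrow> ('n::finite, 'N::finite) pol set"
  where "ground_states k =
    HN_degree k (LEAST d. \<exists>f \<in> (HN_degree k d :: ('n, 'N) pol set). f \<noteq> 0)"

section \<open>The deformed double current algebra\<close>

definition unit_mat :: "'n \<Rightarrow> 'n \<Rightarrow> ('c::zero_neq_one)^'n^'n"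
  where "unit_mat a b = (\<chi> i j. if i = a \<and> j = b then 1 else 0)"

definition bracket :: "('c::comm_ring_1)^'n^'n::finite \<Rightarrow> 'c^'n^'n \<Rightarrow> 'c^'n^'n"
  where "bracket x y = x ** y - y ** x"

definition mat_scale :: "'c::comm_ring_1 \<Rightarrow> 'c^'n^'n \<Rightarrow> 'c^'n^'n"
  where "mat_scale c x = (\<chi> i j. c * x $ i $ j)"

text \<open>Coefficients \<open>\<complex>[\<epsilon>\<^sub>1,\<epsilon>\<^sub>2]\<close> are realised as \<open>\<complex>[\<epsilon>\<^sub>1][\<epsilon>\<^sub>2]\<close>.\<close>

type_synonym coeffs = "complex poly poly"

definition num :: "complex \<Rightarrow> coeffs" where "num c = [:[:c:]:]"
definition eps1 :: coeffs where "eps1 = [:[:0, 1:]:]"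
definition eps2 :: coeffs where "eps2 = [:0, 1:]"
definition eps3 :: "'n::finite itself \<Rightarrow> coeffs"
  where "eps3 _ = - (num (of_nat CARD('n)) * eps1) - eps2"

definition eval_coeffs :: "complex \<Rightarrow> complex \<Rightarrow> coeffs \<Rightarrow> complex"
  where "eval_coeffs e1 e2 c = poly (poly c [:e2:]) e1"

datatype 'n ddca_gen = GenT nat nat "complex^'n^'n" | Gent nat nat

type_synonym 'n ddca_free = "('n ddca_gen, coeffs) free_alg"

definition TT :: "nat \<Rightarrow> nat \<Rightarrow> complex^'n^'n::finite \<Rightarrow> 'n ddca_free"
  where "TT p q x = gen (GenT p q x)"

definition tt :: "nat \<Rightarrow> nat \<Rightarrow> 'n::finite ddca_free"
  where "tt p q = gen (Gent p q)"

definition scale :: "coeffs \<Rightarrow> 'n::finite ddca_free \<Rightarrow> 'n ddca_free"  (infixr \<open>\<cdot>\<close> 72)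
  where "c \<cdot> x = const c * x"

text \<open>
  \<open>TTOmega u r t s x y\<close> is \<open>T\<^bsub>u,r,t,s\<^esub>((x \<otimes> y) \<Omega>)\<close>, where \<open>\<Omega> = E\<^sup>a\<^sub>b \<otimes> E\<^sup>b\<^sub>a\<close> (summed) and
  \<open>(x \<otimes> y)(E\<^sup>a\<^sub>b \<otimes> E\<^sup>b\<^sub>a) = x E\<^sup>a\<^sub>b \<otimes> y E\<^sup>b\<^sub>a\<close>.
\<close>

definition TTOmega ::
    "nat \<Rightarrow> nat \<Rightarrow> nat \<Rightarrow> nat \<Rightarrow> complex^'n^'n \<Rightarrow> complex^'n^'n::finite \<Rightarrow> 'n ddca_free"
  where "TTOmega u r t s x y =
    (\<Sum>a\<in>UNIV. \<Sum>b\<in>UNIV. TT u r (x ** unit_mat a b) * TT t s (y ** unit_mat b a))"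

text \<open>
  Truncated subtraction in an index is harmless below: whenever the true index would be negative,
  the coefficient in front (\<open>s p - r q\<close> or \<open>m\<close>) vanishes.
\<close>

inductive ddca_rel :: "'n::finite ddca_free \<Rightarrow> 'n ddca_free \<Rightarrow> bool"
  where
    A0_one: "ddca_rel (TT r s (mat 1)) (eps2 \<cdot> tt r s)"
  | A0_add: "ddca_rel (TT r s (x + y)) (TT r s x + TT r s y)"
  | A0_scale: "ddca_rel (TT r s (mat_scale c x)) (num c \<cdot> TT r s x)"
  | A1_T: "ddca_rel (comm (TT 0 0 x) (TT 0 m y)) (TT 0 m (bracket x y))"
  | A1_t: "ddca_rel (comm (TT 0 0 x) (tt 0 m)) 0"
  | A2_T: "p + q \<le> 2 \<Longrightarrow>
      ddca_rel (comm (tt p q) (TT r s x))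
        (num (of_nat (s * p) - of_nat (r * q)) \<cdot> TT (p + r - 1) (q + s - 1) x)"
  | A2_t: "p + q \<le> 2 \<Longrightarrow>
      ddca_rel (comm (tt p q) (tt r s))
        (num (of_nat (s * p) - of_nat (r * q)) \<cdot> tt (p + r - 1) (q + s - 1))"
  | A3_T: "ddca_rel (comm (TT 1 0 x) (TT 0 m y))
      (TT 1 m (bracket x y)
       - (num (of_nat m / 2) * eps3 TYPE('n)) \<cdot> TT 0 (m - 1) (x ** y + y ** x)
       - (num (of_nat m * trace y) * eps1) \<cdot> TT 0 (m - 1) x
       + eps1 \<cdot> (\<Sum>j<m. num (of_nat (j + 1) / of_nat (m + 1)) \<cdot>
            TTOmega 0 j 0 (m - 1 - j) (bracket x y) (mat 1))
       + eps1 \<cdot> (\<Sum>j<m. TTOmega 0 j 0 (m - 1 - j) x y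
            - TTOmega 0 j 0 (m - 1 - j) (x ** y) (mat 1)))"
  | A3_t: "ddca_rel (comm (TT 1 0 x) (tt 0 m)) (num (of_nat m) \<cdot> TT 0 (m - 1) x)"
  | A4: "m \<ge> 3 \<Longrightarrow>
      ddca_rel (comm (tt 3 0) (tt 0 m))
        (num (of_nat (3 * m)) \<cdot> tt 2 (m - 1)
         + (num (of_nat (m * (m - 1) * (m - 2)) / 4) * (eps1\<^sup>2 - eps2 * eps3 TYPE('n)))
             \<cdot> tt 0 (m - 3)
         - (num (3 / 2) * eps1) \<cdot> (\<Sum>j = 0..m - 3. num (of_nat ((j + 1) * (m - 2 - j))) \<cdot>
             (TTOmega 0 j 0 (m - 3 - j) (mat 1) (mat 1)
              + (eps1 * eps2) \<cdot> (tt 0 j * tt 0 (m - 3 - j)))))"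

definition DDCA :: "'n::finite ddca_free set ring"
  where "DDCA = presented ddca_rel"

text \<open>
  The module structure on the space of states with \<open>\<epsilon>\<^sub>1 \<mapsto> 1\<close>, \<open>\<epsilon>\<^sub>2 \<mapsto> k\<close>. The action is determined on
  \<open>HN k\<close> by the listed values, as these elements generate the algebra.
\<close>

definition ddca_action ::
    "nat \<Rightarrow> ('n::finite ddca_free set \<Rightarrow> ('n, 'N::finite) oper) \<Rightarrow> bool"
  where "ddca_action k act \<longleftrightarrow>
    left_module DDCA (HN k) act \<and>
    (\<forall>f\<in>HN k.
      (\<forall>c. act (cls ddca_rel (const c)) f = smul (eval_coeffs 1 (of_nat k) c) f) \<and>
      (\<forall>p q a b. act (cls ddca_rel (TT p q (unit_mat a b))) f = AB a (Sym p q) b f) \<and>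
      (\<forall>p q. act (cls ddca_rel (tt p q)) f = Tr (Sym p q) f))"

section \<open>The enveloping algebra of the current algebra\<close>

text \<open>\<open>gl\<^sub>n[z] = gl\<^sub>n \<otimes> \<complex>[z]\<close> is the space of \<open>n \<times> n\<close> matrices over \<open>\<complex>[z]\<close> with the commutator bracket.\<close>

type_synonym 'n glz = "(complex poly)^'n^'n"

inductive Uglz_rel ::
    "('n::finite glz, complex) free_alg \<Rightarrow> ('n glz, complex) free_alg \<Rightarrow> bool"
  where
    Uglz_add: "Uglz_rel (gen (x + y)) (gen x + gen y)"
  | Uglz_scale: "Uglz_rel (gen (mat_scale [:c:] x)) (const c * gen x)"
  | Uglz_bracket: "Uglz_rel (comm (gen x) (gen y)) (gen (bracket x y))"

definition Uglz :: "('n::finite glz, complex) free_alg set ring"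
  where "Uglz = presented Uglz_rel"

definition unit_mat_z :: "'n \<Rightarrow> 'n \<Rightarrow> nat \<Rightarrow> 'n::finite glz"
  where "unit_mat_z a b m = mat_scale (monom 1 m) (unit_mat a b)"

definition Uglz_action ::
    "nat \<Rightarrow> (('n::finite glz, complex) free_alg set \<Rightarrow> ('n, 'N::finite) oper) \<Rightarrow> bool"
  where "Uglz_action k act \<longleftrightarrow>
    left_module Uglz (HN k) act \<and>
    (\<forall>f\<in>HN k.
      (\<forall>c. act (cls Uglz_rel (const c)) f = smul c f) \<and>
      (\<forall>a b m. act (cls Uglz_rel (gen (unit_mat_z a b m))) f
        = AB a (mat_word (replicate m opX)) b f))"

section \<open>The Yangian\<close>

text \<open>\<open>GenY a b s\<close> is the generator \<open>T\<^sup>a\<^bsub>b;s\<^esub>\<close>; \<open>YT a b r\<close> is the coefficient of \<open>u\<^bsup>-r\<^esup>\<close> in \<open>T\<^sup>a\<^sub>b(u)\<close>.\<close>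

datatype 'n yangian_gen = GenY 'n 'n nat

type_synonym 'n yangian_free = "('n yangian_gen, complex) free_alg"

fun YT :: "'n \<Rightarrow> 'n \<Rightarrow> nat \<Rightarrow> 'n yangian_free"
  where
    "YT a b 0 = (if a = b then 1 else 0)"
  | "YT a b (Suc s) = gen (GenY a b s)"

text \<open>
  The coefficients of \<open>u\<^bsup>-r\<^esup> v\<^bsup>-s\<^esup>\<close> for \<open>r, s \<ge> 0\<close> in the RTT relation. The only other monomials are
  \<open>u v\<^bsup>-s\<^esup>\<close> and \<open>u\<^bsup>-r\<^esup> v\<close>; there both sides vanish because \<open>YT a b 0\<close> is a scalar.
\<close>

inductive yangian_rel :: "'n yangian_free \<Rightarrow> 'n yangian_free \<Rightarrow> bool"
  where
    RTT: "yangian_rel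
      (comm (YT a b (Suc r)) (YT c d s) - comm (YT a b r) (YT c d (Suc s)))
      (YT c b r * YT a d s - YT c b s * YT a d r)"

definition Yangian :: "'n yangian_free set ring"
  where "Yangian = presented yangian_rel"

definition yangian_action ::
    "nat \<Rightarrow> ('n::finite yangian_free set \<Rightarrow> ('n, 'N::finite) oper) \<Rightarrow> bool"
  where "yangian_action k act \<longleftrightarrow>
    left_module Yangian (HN k) act \<and>
    (\<forall>f\<in>HN k.
      (\<forall>c. act (cls yangian_rel (const c)) f = smul c f) \<and>
      (\<forall>a b s. act (cls yangian_rel (gen (GenY a b s))) f
        = AB a (mat_word (concat (replicate s [opX, opY]))) b f))"

end

theory Submission
  imports Defs
begin

text \<open>
  For the Bargmann form, \<open>Y\<close> is adjoint to \<open>X\<close> and \<open>B\<close> to \<open>A\<close>. Call a subspace of \<open>\<H>\<^sub>N(n,k)\<close> stable if it is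
  invariant under all \<open>A\<^sup>aX\<^sup>mB\<^sub>b\<close>. A stable subspace is also invariant under \<open>f(X,A) \<mapsto> f(X,GA)\<close> for every
  polynomial matrix \<open>G\<close>, and under multiplication by \<open>Tr X\<^sup>m\<close>. If it is nonzero, a substitution produces a
  nonzero element in which only one row of \<open>A\<close> occurs; such an element is the \<open>k\<close>-th power of the determinant of
  \<open>A\<^sup>a, A\<^sup>aX, \<dots>, A\<^sup>aX\<^bsup>N-1\<^esup>\<close> times a polynomial in the \<open>Tr X\<^sup>m\<close>, so any two nonzero stable subspaces meet.
  A submodule over the double current algebra and its orthogonal complement are both stable, hence one of
  them is zero.

  By the same argument, products of \<open>k\<close> determinants with rows of the form \<open>A\<^sup>aX\<^sup>m\<close> span \<open>\<H>\<^sub>N(n,k)\<close>. Let \<open>v\<^sub>0\<close> be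
  the \<open>k\<close>-th power of the determinant with the rows of lowest index \<open>a + nm\<close>. If a homogeneous \<open>f\<close> of degree \<open>d\<close>
  is orthogonal to the stable subspace generated by \<open>v\<^sub>0\<close>, then substitutions \<open>G\<close> in \<open>v\<^sub>0\<close> that agree up
  to degree \<open>d\<close> with reproducing kernels show that \<open>f = 0\<close>; so \<open>v\<^sub>0\<close> generates \<open>\<H>\<^sub>N(n,k)\<close>. The
  projection of \<open>v\<^sub>0\<close> to the ground states of a stable subspace has the weight of \<open>v\<^sub>0\<close>, which occurs only
  once, so it is a multiple of \<open>v\<^sub>0\<close>; it is nonzero because otherwise these ground states would be
  orthogonal to everything generated by \<open>v\<^sub>0\<close>.

  The generators of the Yangian are adjoint to one another and preserve the finite-dimensional energy
  spaces, so orthogonal complements split off submodules.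
\<close>

section \<open>Polynomials, substitution and derivations\<close>

text \<open>The polynomial ring is infinite-dimensional, so orthogonal projections are available
  only one energy at a time. Every state has degree kN in A, which makes the energy spaces
  finite-dimensional; a complement can therefore be formed as soon as a subspace is graded. Over the
  double current algebra the grading operator is Tr Sym(YX) up to a constant, and the complement of
  a submodule is stable because the adjoint A Y^m B of A X^m B also comes from the algebra. For the
  span of Krylov products, closure under A Y^m B has to be derived from Tr Y^2. One row of A
  suffices for the meeting argument: generically A^a, A^a X, ... is a basis in which X becomes a
  companion matrix, so a state in that row is fixed by a function of the characteristic polynomial.
  The condition k > 0 enters through sum_a A^a X^m B_a = k Tr X^m, from which multiplication by
  traces is recovered. The reproducing kernels come from Cauchy-Binet: the k-th power of a single N
  x N determinant expands into a sum over all products of k Krylov determinants.\<close>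

instance var :: (finite, finite) finite
proof
  have "(UNIV :: ('a, 'b) var set) \<subseteq> range (\<lambda>(i, j). XV i j) \<union> range (\<lambda>(a, i). AV a i)"
  proof
    fix v :: "('a, 'b) var"
    show "v \<in> range (\<lambda>(i, j). XV i j) \<union> range (\<lambda>(a, i). AV a i)"
      by (cases v) (auto simp: image_iff)
  qed
  then show "finite (UNIV :: ('a, 'b) var set)"
    by (rule finite_subset) simp
qed

lemma UNIV_var: "(UNIV :: ('n, 'N) var set) = (\<lambda>(i, j). XV i j) ` UNIV \<union> (\<lambda>(a, i). AV a i) ` UNIV"
proof -
  have "v \<in> (\<lambda>(i, j). XV i j) ` UNIV \<union> (\<lambda>(a, i). AV a i) ` UNIV" for v :: "('n, 'N) var"
    by (cases v) (auto simp: image_iff)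
  then show ?thesis by auto
qed

lemma sum_var:
  fixes g :: "('n::finite, 'N::finite) var \<Rightarrow> 'r::comm_monoid_add"
  shows "(\<Sum>v\<in>UNIV. g v) = (\<Sum>i\<in>UNIV. \<Sum>j\<in>UNIV. g (XV i j)) + (\<Sum>a\<in>UNIV. \<Sum>i\<in>UNIV. g (AV a i))"
  unfolding UNIV_var
  by (subst sum.union_disjoint)
    (auto simp: sum.reindex inj_on_def sum.cartesian_product case_prod_unfold)

lemma prod_var:
  fixes g :: "('n::finite, 'N::finite) var \<Rightarrow> 'r::comm_monoid_mult"
  shows "(\<Prod>v\<in>UNIV. g v) = (\<Prod>i\<in>UNIV. \<Prod>j\<in>UNIV. g (XV i j)) * (\<Prod>a\<in>UNIV. \<Prod>i\<in>UNIV. g (AV a i))"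
  unfolding UNIV_var
  by (subst prod.union_disjoint)
    (auto simp: prod.reindex inj_on_def prod.cartesian_product case_prod_unfold)

abbreviation lk :: "('a \<Rightarrow>\<^sub>0 'b::zero) \<Rightarrow> 'a \<Rightarrow> 'b" where "lk \<equiv> Poly_Mapping.lookup"
abbreviation sg :: "'a \<Rightarrow> 'b::zero \<Rightarrow> 'a \<Rightarrow>\<^sub>0 'b" where "sg \<equiv> Poly_Mapping.single"
abbreviation ks :: "('a \<Rightarrow>\<^sub>0 'b::zero) \<Rightarrow> 'a set" where "ks \<equiv> Poly_Mapping.keys"

type_synonym ('n, 'N) mon = "('n, 'N) var \<Rightarrow>\<^sub>0 nat"

definition pc :: "complex \<Rightarrow> ('n, 'N) pol" where "pc c = sg 0 c"
definition pv :: "('n, 'N) var \<Rightarrow> ('n, 'N) pol" where "pv v = sg (sg v 1) 1"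

lemma mul_var_pv: "mul_var v f = pv v * f"
  by (simp add: mul_var_def pv_def)

lemma smul_pc: "smul c f = pc c * f"
  by (simp add: smul_def pc_def)

lemma pc_add: "pc (a + b) = pc a + pc b"
  by (simp add: pc_def single_add)

lemma pc_mult: "pc (a * b) = pc a * pc b"
  by (simp add: pc_def mult_single)

lemma pc_0 [simp]: "pc 0 = 0" and pc_1 [simp]: "pc 1 = 1"
  by (simp_all add: pc_def)

lemma lookup_pc_mult [simp]: "lk (pc c * f) m = c * lk f m"
  by (simp add: pc_def flip: mult_map_scale_conv_mult) (simp add: Poly_Mapping.map.rep_eq when_def)

lemma lookup_smul [simp]: "lk (smul c f) m = c * lk f m"
  by (simp add: smul_pc)

lemma sum_sg: "(\<Sum>m\<in>ks f. sg m (lk f m)) = f"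
  by (rule poly_mapping_eqI)
    (auto simp: lookup_sum lookup_single when_def in_keys_iff sum.delta' cong: if_cong)

lemma sum_sg': "finite S \<Longrightarrow> ks f \<subseteq> S \<Longrightarrow> (\<Sum>m\<in>S. sg m (lk f m)) = f"
  by (subst sum.mono_neutral_right[of S "ks f"]) (auto simp: sum_sg in_keys_iff)

lemma pol_induct_add:
  assumes "\<And>m a. P (sg m a)" and "\<And>f g. P f \<Longrightarrow> P g \<Longrightarrow> P (f + g)"
  shows "P (f :: 'a \<Rightarrow>\<^sub>0 'b::comm_monoid_add)"
proof -
  have "P (\<Sum>m\<in>S. sg m (lk f m))" if "finite S" for S
    using that
  proof (induction S)
    case empty
    show ?case using assms(1)[of undefined 0] by simp
  qed (simp add: assms)
  then show ?thesis using sum_sg[of f] by (metis finite_keys)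
qed

lemma sg_as_prod:
  fixes m :: "('n::finite, 'N::finite) mon"
  shows "sg m a = pc a * (\<Prod>v\<in>UNIV. pv v ^ lk m v)"
proof -
  have pow: "pv v ^ j = sg (sg v j) 1" for v :: "('n, 'N) var" and j
    by (induction j) (auto simp: pv_def mult_single simp flip: single_add)
  have "(\<Prod>v\<in>S. pv v ^ lk m v) = sg (\<Sum>v\<in>S. sg v (lk m v)) 1" if "finite S" for S
    using that by (induction S) (auto simp: pow mult_single)
  then have "(\<Prod>v\<in>UNIV. pv v ^ lk m v) = sg (\<Sum>v\<in>UNIV. sg v (lk m v)) 1" by simp
  also have "(\<Sum>v\<in>UNIV. sg v (lk m v)) = m" by (rule sum_sg') auto
  finally show ?thesis by (simp add: pc_def mult_single)
qed

lemma pol_induct [case_names const var add mult]: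
  fixes f :: "('n::finite, 'N::finite) pol"
  assumes "\<And>c. P (pc c)" and "\<And>v. P (pv v)"
    and "\<And>f g. P f \<Longrightarrow> P g \<Longrightarrow> P (f + g)" and "\<And>f g. P f \<Longrightarrow> P g \<Longrightarrow> P (f * g)"
  shows "P f"
proof (induction f rule: pol_induct_add)
  case (1 m a)
  have 1: "P 1" using assms(1)[of 1] by simp
  have pow: "P (pv v ^ j)" for v j
    by (induction j) (auto simp: 1 assms)
  have "P (\<Prod>v\<in>S. pv v ^ lk m v)" if "finite S" for S
    using that by (induction S) (auto simp: 1 assms pow)
  then show ?case unfolding sg_as_prod by (intro assms) auto
qed (simp add: assms)

subsection \<open>Substitution homomorphisms\<close>

text \<open>The universal homomorphism out of the polynomial ring, with coefficient map
  \<open>h\<close> and any commutative target ring. It yields evaluation at a point, substitution of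
  polynomials, the shift by a formal parameter t and the conjugation of coefficients, which thus
  share one set of rules.\<close>

definition psub :: "(complex \<Rightarrow> 'r::comm_ring_1) \<Rightarrow> (('n::finite, 'N::finite) var \<Rightarrow> 'r) \<Rightarrow> ('n, 'N) pol \<Rightarrow> 'r"
  where "psub h s f = (\<Sum>m\<in>ks f. h (lk f m) * (\<Prod>v\<in>UNIV. s v ^ lk m v))"

locale coeff_hom =
  fixes h :: "complex \<Rightarrow> 'r::comm_ring_1"
  assumes h_add: "h (a + b) = h a + h b" and h_mult: "h (a * b) = h a * h b" and h_1: "h 1 = 1"
begin

lemma h_0: "h 0 = 0"
  using h_add[of 0 0] by simp

lemma psub_superset:
  assumes "finite S" "ks f \<subseteq> S"
  shows "psub h s f = (\<Sum>m\<in>S. h (lk f m) * (\<Prod>v\<in>UNIV. s v ^ lk m v))"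
  unfolding psub_def using assms by (intro sum.mono_neutral_left) (auto simp: in_keys_iff h_0)

lemma psub_add: "psub h s (f + g) = psub h s f + psub h s g"
proof -
  have "ks (f + g) \<subseteq> ks f \<union> ks g" by (rule keys_add)
  then show ?thesis
    by (simp add: psub_superset[of "ks f \<union> ks g"] lookup_add h_add algebra_simps sum.distrib)
qed

lemma psub_sg: "psub h s (sg m a) = h a * (\<Prod>v\<in>UNIV. s v ^ lk m v)"
  by (cases "a = 0") (simp_all add: psub_def h_0)

lemma psub_pc [simp]: "psub h s (pc c) = h c"
  by (simp add: pc_def psub_sg)

lemma psub_pv [simp]: "psub h s (pv v) = s v"
  by (simp add: pv_def psub_sg h_1 lookup_single when_def if_distrib prod.delta cong: if_cong)

lemma psub_0 [simp]: "psub h s 0 = 0" and psub_1 [simp]: "psub h s 1 = 1"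
  using psub_pc[of s 0] psub_pc[of s 1] by (simp_all add: h_0 h_1)

lemma psub_mult: "psub h s (f * g) = psub h s f * psub h s g"
proof (induction f rule: pol_induct_add)
  case (1 m a)
  show ?case
  proof (induction g rule: pol_induct_add)
    case (1 m' b)
    show ?case
      by (simp add: mult_single psub_sg h_mult lookup_add power_add prod.distrib mult_ac)
  next
    case (2 f g)
    then show ?case by (simp only: distrib_left psub_add)
  qed
next
  case (2 f g)
  then show ?case by (simp only: distrib_right psub_add)
qed

lemma psub_uminus: "psub h s (- f) = - psub h s f"
  using psub_add[of s f "- f"] by (simp add: eq_neg_iff_add_eq_0 add.commute)

lemma psub_diff: "psub h s (f - g) = psub h s f - psub h s g"
  using psub_add[of s f "- g"] by (simp add: psub_uminus)

lemma psub_sum: "psub h s (\<Sum>i\<in>I. f i) = (\<Sum>i\<in>I. psub h s (f i))"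
  by (induction I rule: infinite_finite_induct) (simp_all add: psub_add)

lemma psub_prod: "psub h s (\<Prod>i\<in>I. f i) = (\<Prod>i\<in>I. psub h s (f i))"
  by (induction I rule: infinite_finite_induct) (simp_all add: psub_mult)

lemma psub_power: "psub h s (f ^ k) = psub h s f ^ k"
  by (induction k) (simp_all add: psub_mult)

lemma psub_smul: "psub h s (smul c f) = h c * psub h s f"
  by (simp add: smul_pc psub_mult)

lemma psub_of_int: "psub h s (of_int z) = of_int z"
proof -
  have *: "psub h s (of_nat k) = of_nat k" for k
    by (induction k) (simp_all add: psub_add)
  show ?thesis
    by (cases z rule: int_cases2) (simp_all add: * psub_uminus)
qed

lemma psub_det: "psub h s (det M) = det (\<chi> i j. psub h s (M $ i $ j))"
  by (simp add: det_def psub_sum psub_mult psub_prod psub_of_int)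

end

lemma coeff_hom_pc: "coeff_hom pc"
  by (rule coeff_hom.intro) (simp_all only: pc_add pc_mult pc_1)

lemma coeff_hom_id: "coeff_hom (\<lambda>c. c)"
  by (rule coeff_hom.intro) simp_all

lemma coeff_hom_cpoly: "coeff_hom (\<lambda>c. [:c:])"
  by (rule coeff_hom.intro) (simp_all flip: one_pCons)

lemma coeff_hom_ppoly: "coeff_hom (\<lambda>c. [:pc c:])"
  by (rule coeff_hom.intro) (simp_all add: pc_add pc_mult flip: one_pCons)

global_interpretation pc_hom: coeff_hom pc by (rule coeff_hom_pc)
global_interpretation id_hom: coeff_hom "\<lambda>c. c" by (rule coeff_hom_id)
global_interpretation ppoly_hom: coeff_hom "\<lambda>c. [:pc c:]" by (rule coeff_hom_ppoly)

lemma psub_compose: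
  assumes "coeff_hom h" "coeff_hom h'" "\<And>x y. \<phi> (x + y) = \<phi> x + \<phi> y"
    "\<And>x y. \<phi> (x * y) = \<phi> x * \<phi> y" "\<And>c. \<phi> (h c) = h' c"
  shows "\<phi> (psub h s f) = psub h' (\<lambda>v. \<phi> (s v)) f"
proof -
  interpret h: coeff_hom h by fact
  interpret h': coeff_hom h' by fact
  show ?thesis
    by (induction f rule: pol_induct) (simp_all add: h.psub_add h.psub_mult h'.psub_add h'.psub_mult assms)
qed

lemma psub_pv_id: "psub pc pv f = f"
  by (induction f rule: pol_induct) (simp_all add: pc_hom.psub_add pc_hom.psub_mult)

subsection \<open>Partial derivatives\<close>

lemma lookup_deriv_var:
  "lk (deriv_var v f) m = of_nat (lk m v + 1) * lk f (m + sg v 1)"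
proof -
  \<comment> \<open>Subtraction of exponents is truncated, so \<open>m' - sg v 1 = m\<close> alone
    would also admit \<open>m' = m\<close> without the variable \<open>v\<close>; the factor
    \<open>lk m' v\<close> excludes this.\<close>
  have eq: "(m' - sg v 1 = m \<and> lk m' v \<noteq> 0) \<longleftrightarrow> m' = m + sg v 1" for m'
  proof (intro iffI conjI; (elim conjE)?)
    assume a: "m' - sg v 1 = m" "lk m' v \<noteq> 0"
    show "m' = m + sg v 1"
      by (rule poly_mapping_eqI) (use a in \<open>auto simp: lookup_add lookup_minus lookup_single when_def\<close>)
  next
    assume a: "m' = m + sg v 1"
    then show "m' - sg v 1 = m" by simp
    show "lk m' v \<noteq> 0" by (simp add: a lookup_add)
  qed
  have "lk (deriv_var v f) m = (\<Sum>m'\<in>ks f. if m' = m + sg v 1 then of_nat (lk m' v) * lk f m' else 0)"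
    unfolding deriv_var_def lookup_sum lookup_single when_def
  proof (intro sum.cong refl)
    fix m'
    show "(if m' - sg v 1 = m then of_nat (lk m' v) * lk f m' else 0)
        = (if m' = m + sg v 1 then of_nat (lk m' v) * lk f m' else 0)"
      using eq[of m'] by (cases "lk m' v = 0") (simp_all only: of_nat_0 mult_zero_left if_cancel simp_thms)
  qed
  also have "\<dots> = of_nat (lk (m + sg v 1) v) * lk f (m + sg v 1)"
    by (subst sum.delta[OF finite_keys], cases "m + sg v 1 \<in> ks f")
      (simp_all only: if_True if_False if_cancel not_in_keys_iff_lookup_eq_zero mult_zero_right)
  finally show ?thesis by (simp only: lookup_add lookup_single_eq)
qed

lemma deriv_var_add: "deriv_var v (f + g) = deriv_var v f + deriv_var v g"
  by (rule poly_mapping_eqI) (simp add: lookup_deriv_var lookup_add algebra_simps)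

lemma deriv_var_sg: "deriv_var v (sg m a) = sg (m - sg v 1) (of_nat (lk m v) * a)"
  by (cases "a = 0") (simp_all add: deriv_var_def)

lemma deriv_var_pc [simp]: "deriv_var v (pc c) = 0"
  by (simp add: pc_def deriv_var_sg)

lemma deriv_var_pv [simp]: "deriv_var v (pv w) = (if v = w then 1 else 0)"
  by (simp add: pv_def deriv_var_sg lookup_single)

lemma deriv_var_mult: "deriv_var v (f * g) = deriv_var v f * g + f * deriv_var v g"
proof (induction f rule: pol_induct_add)
  case (1 m a)
  have m_eq: "m - sg v 1 + m' = m + m' - sg v 1" if "lk m v \<noteq> 0" for m m' :: "('a, 'b) mon"
    by (rule poly_mapping_eqI) (use that in \<open>auto simp: lookup_add lookup_minus lookup_single when_def\<close>)
  show ?case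
  proof (induction g rule: pol_induct_add)
    case (1 m' b)
    have "sg (m - sg v 1) (of_nat (lk m v) * a) * sg m' b
        = sg (m + m' - sg v 1) (of_nat (lk m v) * (a * b))"
      using m_eq[of m m'] by (cases "lk m v = 0") (simp_all add: mult_single mult.assoc)
    moreover have "sg m a * sg (m' - sg v 1) (of_nat (lk m' v) * b)
        = sg (m + m' - sg v 1) (of_nat (lk m' v) * (a * b))"
      using m_eq[of m' m]
      by (cases "lk m' v = 0") (simp_all add: mult_single mult.left_commute add.commute[of m])
    ultimately show ?case
      by (simp add: deriv_var_sg mult_single lookup_add distrib_right single_add)
  qed (simp add: deriv_var_add algebra_simps)
qed (simp add: deriv_var_add algebra_simps)

lemma deriv_var_0 [simp]: "deriv_var v 0 = 0" and deriv_var_1 [simp]: "deriv_var v 1 = 0"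
  using deriv_var_pc[of v 0] deriv_var_pc[of v 1] by simp_all

lemma deriv_var_smul: "deriv_var v (smul c f) = smul c (deriv_var v f)"
  by (simp add: smul_pc deriv_var_mult)

lemma deriv_var_commute: "deriv_var v (deriv_var w f) = deriv_var w (deriv_var v f)"
  by (rule poly_mapping_eqI) (auto simp: lookup_deriv_var lookup_add lookup_single when_def add_ac)

lemma deriv_var_sum: "deriv_var v (\<Sum>i\<in>I. f i) = (\<Sum>i\<in>I. deriv_var v (f i))"
  by (induction I rule: infinite_finite_induct) (simp_all add: deriv_var_add)

locale derivation =
  fixes D :: "'r::comm_ring_1 \<Rightarrow> 'r"
  assumes D_add: "D (x + y) = D x + D y" and D_mult: "D (x * y) = D x * y + x * D y"
begin

lemma D_0 [simp]: "D 0 = 0"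
  using D_add[of 0 0] by simp

lemma D_1 [simp]: "D 1 = 0"
  using D_mult[of 1 1] by simp

lemma D_uminus: "D (- x) = - D x"
  using D_add[of x "- x"] by (simp add: eq_neg_iff_add_eq_0 add.commute)

lemma D_diff: "D (x - y) = D x - D y"
  using D_add[of x "- y"] by (simp add: D_uminus)

lemma D_sum: "D (\<Sum>i\<in>I. f i) = (\<Sum>i\<in>I. D (f i))"
  by (induction I rule: infinite_finite_induct) (simp_all add: D_add)

lemma D_of_int [simp]: "D (of_int z) = 0"
proof -
  have *: "D (of_nat k) = 0" for k by (induction k) (simp_all add: D_add)
  show ?thesis by (cases z rule: int_cases2) (simp_all add: * D_uminus)
qed

lemma D_prod:
  assumes "finite I"
  shows "D (\<Prod>i\<in>I. f i) = (\<Sum>i\<in>I. D (f i) * (\<Prod>j\<in>I - {i}. f j))"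
  using assms
proof (induction I)
  case (insert a I)
  have "(\<Prod>j\<in>insert a I - {i}. f j) = f a * (\<Prod>j\<in>I - {i}. f j)" if "i \<in> I" for i
  proof -
    have "insert a I - {i} = insert a (I - {i})" using insert that by auto
    then show ?thesis using insert by simp
  qed
  then show ?case
    using insert by (simp add: D_mult sum_distrib_left mult_ac)
qed simp

lemma D_prod_upd:
  assumes "finite I"
  shows "D (\<Prod>i\<in>I. f i) = (\<Sum>i\<in>I. \<Prod>j\<in>I. if j = i then D (f i) else f j)"
  unfolding D_prod[OF assms]
proof (intro sum.cong refl)
  fix i assume i: "i \<in> I"
  have "(\<Prod>j\<in>I - {i}. f j) = (\<Prod>j\<in>I - {i}. if j = i then D (f i) else f j)"
    by (rule prod.cong) auto
  then show "D (f i) * (\<Prod>j\<in>I - {i}. f j) = (\<Prod>j\<in>I. if j = i then D (f i) else f j)"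
    using i assms by (simp add: prod.remove[of I i])
qed

lemma D_det: "D (det M) = (\<Sum>x\<in>UNIV. det (\<chi> i. if i = x then (\<chi> j. D (M $ i $ j)) else M $ i))"
proof -
  have "(\<Prod>i\<in>UNIV. if i = x then D (M $ x $ p x) else M $ i $ p i)
      = (\<Prod>i\<in>UNIV. (if i = x then (\<chi> j. D (M $ i $ j)) else M $ i) $ p i)" for p x
    by (rule prod.cong) auto
  then show ?thesis
    unfolding det_def by (subst sum.swap) (simp add: D_sum D_mult D_prod_upd sum_distrib_left)
qed

lemma chain_rule:
  assumes "coeff_hom h" "\<And>c. D (h c) = 0"
  shows "D (psub h s f) = (\<Sum>v\<in>UNIV. D (s v) * psub h s (deriv_var v f))"
proof -
  interpret h: coeff_hom h by fact
  show ?thesis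
  proof (induction f rule: pol_induct)
    case (var w)
    then show ?case by (simp add: if_distrib[of "psub h s"] if_distrib[of "(*) x" for x] cong: if_cong)
  qed (simp_all add: assms h.psub_add h.psub_mult deriv_var_add deriv_var_mult D_add D_mult
      sum.distrib distrib_left sum_distrib_left sum_distrib_right mult_ac)
qed

end

global_interpretation deriv_var: derivation "deriv_var v"
  by unfold_locales (simp_all add: deriv_var_add deriv_var_mult)

global_interpretation pderiv: derivation pderiv
  by unfold_locales (simp_all add: pderiv_add pderiv_mult algebra_simps)

section \<open>Polynomials as functions\<close>

definition pt :: "complex^'N^'N \<Rightarrow> complex^'N^'n \<Rightarrow> ('n, 'N) var \<Rightarrow> complex"
  where "pt X A v = (case v of XV i j \<Rightarrow> X $ i $ j | AV a i \<Rightarrow> A $ a $ i)"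

lemma pt_simps [simp]: "pt X A (XV i j) = X $ i $ j" "pt X A (AV a i) = A $ a $ i"
  by (simp_all add: pt_def)

lemma pt_surj: "\<exists>X A. s = pt X A"
proof
  show "\<exists>A. s = pt (\<chi> i j. s (XV i j)) A"
    by (rule exI[of _ "\<chi> a i. s (AV a i)"]) (rule ext, simp add: pt_def split: var.split)
qed

lemma eval_pol_psub: "eval_pol f X A = psub (\<lambda>c. c) (pt X A) f"
  by (simp add: eval_pol_def psub_def prod_var mult.assoc)

lemmas eval_pol_simps = id_hom.psub_add id_hom.psub_mult id_hom.psub_uminus id_hom.psub_diff
  id_hom.psub_sum id_hom.psub_prod id_hom.psub_power id_hom.psub_smul id_hom.psub_det

lemma eval_add: "eval_pol (f + g) X A = eval_pol f X A + eval_pol g X A"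
  and eval_mult: "eval_pol (f * g) X A = eval_pol f X A * eval_pol g X A"
  and eval_diff: "eval_pol (f - g) X A = eval_pol f X A - eval_pol g X A"
  and eval_sum: "eval_pol (\<Sum>i\<in>I. F i) X A = (\<Sum>i\<in>I. eval_pol (F i) X A)"
  and eval_prod: "eval_pol (\<Prod>i\<in>I. F i) X A = (\<Prod>i\<in>I. eval_pol (F i) X A)"
  and eval_power: "eval_pol (f ^ j) X A = eval_pol f X A ^ j"
  and eval_smul: "eval_pol (smul c f) X A = c * eval_pol f X A"
  and eval_det: "eval_pol (det M) X A = det (\<chi> i j. eval_pol (M $ i $ j) X A)"
  and eval_pc: "eval_pol (pc c) X A = c"
  and eval_pv: "eval_pol (pv v) X A = pt X A v"
  and eval_0 [simp]: "eval_pol 0 X A = 0"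
  and eval_1 [simp]: "eval_pol 1 X A = 1"
  by (simp_all add: eval_pol_psub eval_pol_simps)

text \<open>Substituting linear polynomials in t and evaluating t afterwards is evaluation along a
  line, and the chain rule gives the derivative at 0. Questions in many variables become questions
  about the single polynomial \<open>F\<close>.\<close>

lemma psub_line:
  fixes s u :: "('n::finite, 'N::finite) var \<Rightarrow> complex"
  obtains F where "\<And>t. poly F t = psub (\<lambda>c. c) (\<lambda>v. s v + t * u v) f"
    and "poly (pderiv F) 0 = (\<Sum>v\<in>UNIV. u v * psub (\<lambda>c. c) s (deriv_var v f))"
proof
  let ?F = "psub (\<lambda>c. [:c:]) (\<lambda>v. [:s v, u v:]) f"
  have *: "poly (psub (\<lambda>c. [:c:]) (\<lambda>v. [:s v, u v:]) g) t = psub (\<lambda>c. c) (\<lambda>v. s v + t * u v) g" for g t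
    by (subst psub_compose[where \<phi> = "\<lambda>p. poly p t", OF coeff_hom_cpoly coeff_hom_id]) simp_all
  show "poly ?F t = psub (\<lambda>c. c) (\<lambda>v. s v + t * u v) f" for t by (rule *)
  show "poly (pderiv ?F) 0 = (\<Sum>v\<in>UNIV. u v * psub (\<lambda>c. c) s (deriv_var v f))"
    by (subst pderiv.chain_rule[OF coeff_hom_cpoly]) (simp_all add: poly_sum * pderiv_pCons)
qed

text \<open>If f vanishes everywhere, it vanishes along every coordinate line, hence so do all its
  partial derivatives. Differentiating once for each factor of \<open>m\<close> reduces the
  coefficient at \<open>m\<close> to a constant coefficient, up to nonzero integers.\<close>

lemma psub_eq_0_imp_0:
  fixes f :: "('n::finite, 'N::finite) pol"
  assumes "\<And>s. psub (\<lambda>c. c) s f = 0"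
  shows "f = 0"
proof (rule poly_mapping_eqI)
  fix m
  show "lk f m = lk 0 m"
    using assms
  proof (induction "\<Sum>v\<in>UNIV. lk m v" arbitrary: m f)
    case 0
    then have m: "m = 0"
      by (intro poly_mapping_eqI) simp
    have *: "(\<Prod>v\<in>UNIV. (0::complex) ^ lk m' v) = (if m' = 0 then 1 else 0)" for m' :: "('n, 'N) mon"
    proof (cases "m' = 0")
      case False
      then obtain v where "lk m' v \<noteq> 0" by (metis lookup_zero poly_mapping_eqI)
      then show ?thesis using False by (auto intro!: prod_zero bexI[of _ v])
    qed simp
    have "psub (\<lambda>c. c) (\<lambda>v. 0) f = lk f 0"
      unfolding psub_def * by (cases "0 \<in> ks f") (auto simp: if_distrib not_in_keys_iff_lookup_eq_zero[THEN iffD1] sum.delta cong: if_cong)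
    then show ?case using 0 m by simp
  next
    case (Suc n)
    then obtain v where v: "lk m v \<noteq> 0"
      by (metis sum.neutral nat.simps(3))
    let ?m = "m - sg v 1"
    have m: "m = ?m + sg v 1"
      by (rule poly_mapping_eqI) (use v in \<open>auto simp: lookup_add lookup_minus lookup_single when_def\<close>)
    have "(\<Sum>v\<in>UNIV. lk m v) = (\<Sum>v\<in>UNIV. lk ?m v) + 1"
      by (subst m) (simp add: lookup_add sum.distrib lookup_single when_def)
    then have n: "n = (\<Sum>v\<in>UNIV. lk ?m v)" using Suc.hyps(2) by simp
    have "psub (\<lambda>c. c) s (deriv_var v f) = 0" for s
    proof -
      obtain F where F: "\<And>t. poly F t = psub (\<lambda>c. c) (\<lambda>w. s w + t * (if w = v then 1 else 0)) f"
        "poly (pderiv F) 0 = (\<Sum>w\<in>UNIV. (if w = v then 1 else 0) * psub (\<lambda>c. c) s (deriv_var w f))"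
        using psub_line[of s "\<lambda>w. if w = v then 1 else 0" f] by blast
      have "F = 0" using F(1) Suc.prems by (simp flip: poly_all_0_iff_0)
      then show ?thesis using F(2) by (simp add: if_distrib[of "\<lambda>c. c * _"] cong: if_cong)
    qed
    from Suc.hyps(1)[OF n this] have "lk (deriv_var v f) ?m = 0" by simp
    then show ?case
      by (subst m) (simp add: lookup_deriv_var flip: of_nat_Suc del: of_nat_Suc)
  qed
qed

lemma pol_eqI:
  assumes "\<And>X A. eval_pol f X A = eval_pol g X A"
  shows "f = g"
proof -
  have "psub (\<lambda>c. c) s (f - g) = 0" for s
    using assms pt_surj[of s] by (auto simp: id_hom.psub_diff eval_pol_psub)
  then show ?thesis using psub_eq_0_imp_0 by fastforce
qed

lemma pol_nonzeroE:
  assumes "f \<noteq> 0"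
  obtains X A where "eval_pol f X A \<noteq> 0"
  using pol_eqI[of f 0] assms by auto

text \<open>Join a point where f is nonzero to a point where g is nonzero: on this line both
  restrict to nonzero polynomials in one variable, and so does their product.\<close>

lemma pol_mult_nonzero:
  fixes f g :: "('n::finite, 'N::finite) pol"
  assumes "f \<noteq> 0" "g \<noteq> 0"
  shows "f * g \<noteq> 0"
proof -
  obtain s where s: "psub (\<lambda>c. c) s f \<noteq> 0" using assms psub_eq_0_imp_0 by blast
  obtain s' where s': "psub (\<lambda>c. c) s' g \<noteq> 0" using assms psub_eq_0_imp_0 by blast
  obtain F where F: "\<And>t. poly F t = psub (\<lambda>c. c) (\<lambda>w. s w + t * (s' w - s w)) f"
    using psub_line[of s "\<lambda>w. s' w - s w" f] by blast
  obtain G where G: "\<And>t. poly G t = psub (\<lambda>c. c) (\<lambda>w. s w + t * (s' w - s w)) g"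
    using psub_line[of s "\<lambda>w. s' w - s w" g] by blast
  have "F \<noteq> 0" using F[of 0] s by auto
  moreover have "G \<noteq> 0" using G[of 1] s' by auto
  ultimately have "F * G \<noteq> 0" by simp
  then obtain t where "poly (F * G) t \<noteq> 0" using poly_all_0_iff_0 by blast
  then have "psub (\<lambda>c. c) (\<lambda>w. s w + t * (s' w - s w)) (f * g) \<noteq> 0"
    by (simp add: F G id_hom.psub_mult)
  then show ?thesis by auto
qed

lemma pol_mult_cancel:
  assumes "h \<noteq> 0" "h * f = h * (g :: ('n::finite, 'N::finite) pol)"
  shows "f = g"
  using pol_mult_nonzero[of h "f - g"] assms by (auto simp: right_diff_distrib)

text \<open>The factor \<open>h\<close> can be cancelled. Thus an identity has to be checked only
  where the determinant that its proof inverts is nonzero.\<close>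

lemma pol_eqI_generic:
  assumes "h \<noteq> 0" "\<And>X A. eval_pol h X A \<noteq> 0 \<Longrightarrow> eval_pol f X A = eval_pol g X A"
  shows "f = g"
  by (rule pol_mult_cancel[OF assms(1)], rule pol_eqI) (use assms(2) in \<open>auto simp: eval_mult\<close>)

lemma eval_line:
  fixes X U :: "complex^'N^'N::finite" and A V :: "complex^'N^'n::finite"
  obtains F where "\<And>t. poly F t = eval_pol f (\<chi> i j. X $ i $ j + t * U $ i $ j) (\<chi> a i. A $ a $ i + t * V $ a $ i)"
    and "poly (pderiv F) 0 = (\<Sum>v\<in>UNIV. pt U V v * eval_pol (deriv_var v f) X A)"
proof -
  obtain F where F: "\<And>t. poly F t = psub (\<lambda>c. c) (\<lambda>v. pt X A v + t * pt U V v) f"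
    "poly (pderiv F) 0 = (\<Sum>v\<in>UNIV. pt U V v * psub (\<lambda>c. c) (pt X A) (deriv_var v f))"
    using psub_line[of "pt X A" "pt U V" f] by blast
  have "(\<lambda>v. pt X A v + t * pt U V v)
      = pt (\<chi> i j. X $ i $ j + t * U $ i $ j) (\<chi> a i. A $ a $ i + t * V $ a $ i)" for t
    by (rule ext) (simp add: pt_def split: var.split)
  then show ?thesis using that[of F] F by (simp add: eval_pol_psub)
qed

section \<open>The space of states\<close>

lemma matrix_inv_works:
  assumes "invertible (g :: 'a::semiring_1^'n^'n)"
  shows "g ** matrix_inv g = mat 1" "matrix_inv g ** g = mat 1"
  using assms someI_ex[of "\<lambda>h. g ** h = mat 1 \<and> h ** g = mat 1"]
  by (auto simp: invertible_def matrix_inv_def)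

lemma matrix_inv_unique:
  assumes "(g :: 'a::semiring_1^'n^'n) ** h = mat 1" "h ** g = mat 1"
  shows "matrix_inv g = h"
proof -
  have "invertible g" using assms by (auto simp: invertible_def)
  then have "matrix_inv g = matrix_inv g ** (g ** h)" by (simp add: assms)
  also have "\<dots> = h"
    by (simp add: matrix_mul_assoc matrix_inv_works[OF \<open>invertible g\<close>])
  finally show ?thesis .
qed

text \<open>Naming the inverse \<open>h\<close> turns the negative power of det g into a positive
  power of det h, since the two determinants have product 1.\<close>

lemma HN_iff:
  fixes f :: "('n::finite, 'N::finite) pol"
  shows "f \<in> HN k \<longleftrightarrow> (\<forall>g h X A. g ** h = mat 1 \<longrightarrow> h ** g = mat 1 \<longrightarrow>
     eval_pol f (g ** X ** h) (A ** h) = det h ^ k * eval_pol f X A)" (is "_ \<longleftrightarrow> ?R")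
proof -
  have *: "inverse (det g ^ k) = det h ^ k" if "g ** h = mat 1" for g h :: "complex^'N^'N"
  proof -
    have "det g * det h = 1" using that by (metis det_mul det_I)
    then have "det g ^ k * det h ^ k = 1" by (simp flip: power_mult_distrib)
    then show ?thesis by (rule inverse_unique)
  qed
  show ?thesis
  proof
    assume f: "f \<in> HN k"
    show ?R
    proof (intro allI impI)
      fix g h X :: "complex^'N^'N" and A :: "complex^'N^'n"
      assume gh: "g ** h = mat 1" "h ** g = mat 1"
      then have "invertible g" by (auto simp: invertible_def)
      then show "eval_pol f (g ** X ** h) (A ** h) = det h ^ k * eval_pol f X A"
        using f *[OF gh(1)] matrix_inv_unique[OF gh] by (auto simp: HN_def)
    qed
  next
    assume a: ?R
    show "f \<in> HN k"
      unfolding HN_def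
    proof (intro CollectI allI impI)
      fix g X :: "complex^'N^'N" and A :: "complex^'N^'n"
      assume "invertible g"
      note inv = matrix_inv_works[OF this]
      then show "eval_pol f (g ** X ** matrix_inv g) (A ** matrix_inv g) = inverse (det g ^ k) * eval_pol f X A"
        using a *[OF inv(1)] by simp
    qed
  qed
qed

lemma HN_D: "f \<in> HN k \<Longrightarrow> g ** h = mat 1 \<Longrightarrow> h ** g = mat 1 \<Longrightarrow>
     eval_pol f (g ** X ** h) (A ** h) = det h ^ k * eval_pol f X A"
  by (simp add: HN_iff)

lemma HN_0 [simp]: "0 \<in> HN k"
  by (simp add: HN_iff)

lemma HN_add: "f \<in> HN k \<Longrightarrow> g \<in> HN k \<Longrightarrow> f + g \<in> HN k"
  by (simp add: HN_iff eval_add distrib_left)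

lemma HN_smul: "f \<in> HN k \<Longrightarrow> smul c f \<in> HN k"
  by (simp add: HN_iff eval_smul)

text \<open>The group element carries the line through (X, A) in the direction of the field to the
  line through the transformed point in the direction of the field there. Along these lines f gives
  polynomials in t that differ by the factor det h^k, hence so do their derivatives at t =
  0.\<close>

lemma HN_vector_field:
  fixes \<xi> :: "('n::finite, 'N::finite) var \<Rightarrow> ('n, 'N) pol"
  assumes f: "f \<in> HN k"
    and equivariant: "\<And>g h X A. g ** h = mat 1 \<Longrightarrow> h ** g = mat 1 \<Longrightarrow>
      UX (g ** X ** h) (A ** h) = g ** UX X A ** h \<and> UA (g ** X ** h) (A ** h) = UA X A ** h"
    and \<xi>: "\<And>v X A. eval_pol (\<xi> v) X A = pt (UX X A) (UA X A) v"
  shows "(\<Sum>v\<in>UNIV. \<xi> v * deriv_var v f) \<in> HN k"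
  unfolding HN_iff
proof (intro allI impI)
  fix g h :: "complex^'N^'N" and X and A :: "complex^'N^'n"
  assume gh: "g ** h = mat 1" "h ** g = mat 1"
  let ?U = "UX X A" and ?V = "UA X A"
  obtain F where F: "\<And>t. poly F t = eval_pol f (\<chi> i j. X $ i $ j + t * ?U $ i $ j) (\<chi> a i. A $ a $ i + t * ?V $ a $ i)"
    "poly (pderiv F) 0 = (\<Sum>v\<in>UNIV. pt ?U ?V v * eval_pol (deriv_var v f) X A)"
    using eval_line[of f X ?U A ?V] by blast
  let ?X = "g ** X ** h" and ?A = "A ** h"
  let ?U' = "UX ?X ?A" and ?V' = "UA ?X ?A"
  obtain G where G: "\<And>t. poly G t = eval_pol f (\<chi> i j. ?X $ i $ j + t * ?U' $ i $ j) (\<chi> a i. ?A $ a $ i + t * ?V' $ a $ i)"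
    "poly (pderiv G) 0 = (\<Sum>v\<in>UNIV. pt ?U' ?V' v * eval_pol (deriv_var v f) ?X ?A)"
    using eval_line[of f ?X ?U' ?A ?V'] by blast
  have "poly G t = poly (smult (det h ^ k) F) t" for t
  proof -
    have "(\<chi> i j. ?X $ i $ j + t * ?U' $ i $ j) = g ** (\<chi> i j. X $ i $ j + t * ?U $ i $ j) ** h"
      using equivariant[OF gh]
      by (simp add: vec_eq_iff matrix_matrix_mult_def sum_distrib_left sum_distrib_right
          algebra_simps sum.distrib)
    moreover have "(\<chi> a i. ?A $ a $ i + t * ?V' $ a $ i) = (\<chi> a i. A $ a $ i + t * ?V $ a $ i) ** h"
      using equivariant[OF gh]
      by (simp add: vec_eq_iff matrix_matrix_mult_def sum_distrib_left sum_distrib_right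
          algebra_simps sum.distrib)
    ultimately show ?thesis
      by (simp add: F(1) G(1) HN_D[OF f gh])
  qed
  then have "G = smult (det h ^ k) F" by (intro poly_eq_poly_eq_iff[THEN iffD1] ext)
  then have "poly (pderiv G) 0 = det h ^ k * poly (pderiv F) 0"
    by (simp add: pderiv_smult)
  then show "eval_pol (\<Sum>v\<in>UNIV. \<xi> v * deriv_var v f) ?X ?A
      = det h ^ k * eval_pol (\<Sum>v\<in>UNIV. \<xi> v * deriv_var v f) X A"
    by (simp add: eval_sum eval_mult \<xi> F(2) G(2))
qed

section \<open>Krylov rows and the current algebra\<close>

primrec mpow :: "'r::semiring_1^'n^'n \<Rightarrow> nat \<Rightarrow> 'r^'n^'n" where
  "mpow M 0 = mat 1"
| "mpow M (Suc m) = M ** mpow M m"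

lemma mpow_add: "mpow M (a + b) = mpow M a ** mpow M b"
  by (induction a) (simp_all add: matrix_mul_assoc)

lemma mpow_1 [simp]: "mpow M (Suc 0) = M"
  by simp

lemma mpow_conj:
  assumes "g ** h = mat 1" "h ** g = mat 1"
  shows "mpow (g ** X ** h) m = g ** mpow X m ** (h :: 'r::semiring_1^'n^'n)"
proof (induction m)
  case (Suc m)
  have "mpow (g ** X ** h) (Suc m) = g ** X ** (h ** g) ** mpow X m ** h"
    using Suc by (simp add: matrix_mul_assoc)
  then show ?case by (simp add: assms matrix_mul_assoc)
qed (simp add: assms)

lemma matrix_mul_component: "(P ** Q) $ i $ j = (\<Sum>l\<in>UNIV. P $ i $ l * Q $ l $ j)"
  by (simp add: matrix_matrix_mult_def)

definition XM :: "('n, 'N) pol^'N^'N" where "XM = (\<chi> i j. pv (XV i j))"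
definition AM :: "('n, 'N) pol^'N^'n" where "AM = (\<chi> a i. pv (AV a i))"

definition rho :: "'n::finite \<Rightarrow> nat \<Rightarrow> ('n, 'N::finite) pol^'N"
  where "rho a m = (AM ** mpow XM m) $ a"

lemma rho_add: "rho a (m + l) $ j = (\<Sum>i\<in>UNIV. rho a m $ i * mpow XM l $ i $ j)"
  by (simp add: rho_def mpow_add matrix_mul_assoc) (simp add: matrix_mul_component)

lemma eval_mpow [simp]: "eval_pol (mpow XM m $ i $ j) X A = mpow X m $ i $ j"
  by (induction m arbitrary: i)
    (simp_all add: mat_def XM_def matrix_mul_component eval_sum eval_mult eval_pv)

lemma eval_rho [simp]: "eval_pol (rho a m $ i) X A = (A ** mpow X m) $ a $ i"
  by (simp add: rho_def AM_def matrix_mul_component eval_sum eval_mult eval_pv)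

lemma deriv_X_mpow:
  fixes i :: "'N::finite" and XM' :: "('n::finite, 'N) pol^'N^'N"
  defines "XM' \<equiv> XM"
  shows "deriv_var (XV i j) (mpow XM' m $ p $ q) = (\<Sum>c<m. mpow XM' c $ p $ i * mpow XM' (m - 1 - c) $ j $ q)"
proof (induction m arbitrary: p)
  case 0
  then show ?case by (simp add: mat_def)
next
  case (Suc m)
  have "deriv_var (XV i j) (mpow XM' (Suc m) $ p $ q) =
     (\<Sum>l\<in>UNIV. (if i = p \<and> j = l then mpow XM' m $ l $ q else 0)) +
     (\<Sum>l\<in>UNIV. XM' $ p $ l * deriv_var (XV i j) (mpow XM' m $ l $ q))"
    by (simp add: matrix_mul_component XM'_def XM_def deriv_var_sum deriv_var_mult sum.distrib
        if_distrib[of "\<lambda>x. x * _"] conj_commute cong: if_cong)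
  also have "(\<Sum>l\<in>UNIV. (if i = p \<and> j = l then mpow XM' m $ l $ q else 0))
      = mpow XM' 0 $ p $ i * mpow XM' m $ j $ q"
    by (cases "i = p") (simp_all add: mat_def)
  also have "(\<Sum>l\<in>UNIV. XM' $ p $ l * deriv_var (XV i j) (mpow XM' m $ l $ q))
      = (\<Sum>c<m. mpow XM' (Suc c) $ p $ i * mpow XM' (m - 1 - c) $ j $ q)"
    by (simp add: Suc.IH sum_distrib_left matrix_mul_component sum_distrib_right mult.assoc)
      (rule sum.swap)
  finally show ?case
    by (simp add: sum.lessThan_Suc_shift del: mpow.simps sum.lessThan_Suc)
qed

lemma deriv_X_rho:
  "deriv_var (XV i j) (rho a m $ q) = (\<Sum>c<m. rho a c $ i * mpow XM (m - 1 - c) $ j $ q)"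
  by (simp add: rho_def AM_def matrix_mul_component deriv_var_sum deriv_var_mult deriv_X_mpow
      sum_distrib_left sum_distrib_right mult.assoc) (rule sum.swap)

lemma deriv_A_mpow [simp]: "deriv_var (AV b j) (mpow XM m $ p $ q) = 0"
  by (induction m arbitrary: p)
    (simp_all add: mat_def matrix_mul_component XM_def deriv_var_sum deriv_var_mult)

lemma deriv_A_rho: "deriv_var (AV b j) (rho a m $ q) = (if a = b then mpow XM m $ j $ q else 0)"
  by (simp add: rho_def AM_def matrix_mul_component deriv_var_sum deriv_var_mult
      if_distrib[of "\<lambda>x. x * _"] cong: if_cong)

text \<open>\<open>T a m b\<close> is \<open>A\<^sup>aX\<^sup>mB\<^sub>b\<close>, by which \<open>E\<^sup>a\<^sub>b \<otimes> z\<^sup>m\<close> acts.\<close>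

definition T :: "'n::finite \<Rightarrow> nat \<Rightarrow> 'n \<Rightarrow> ('n, 'N::finite) oper"
  where "T a m b f = (\<Sum>j\<in>UNIV. rho a m $ j * deriv_var (AV b j) f)"

global_interpretation T: derivation "T a m b"
  by unfold_locales (simp_all add: T_def deriv_var_add deriv_var_mult algebra_simps sum.distrib
      sum_distrib_left)

lemma T_pc [simp]: "T a m b (pc c) = 0"
  by (simp add: T_def)

lemma T_smul: "T a m b (smul c f) = smul c (T a m b f)"
  by (simp add: smul_pc T.D_mult)

lemma T_rho: "T a m b (rho c l $ q) = (if b = c then rho a (m + l) $ q else 0)"
  by (simp add: T_def deriv_A_rho rho_add)

lemma mat_word_X: "mat_word (replicate m opX) i j f = mpow XM m $ i $ j * f"
  by (induction m arbitrary: i)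
    (simp_all add: mat_def opX_def mul_var_pv XM_def matrix_mul_component sum_distrib_right mult.assoc)

lemma AB_mat_word_X: "AB a (mat_word (replicate m opX)) b f = T a m b f"
  unfolding AB_def T_def opA_def opB_def mat_word_X mul_var_pv rho_def AM_def matrix_mul_component
  by (subst sum.swap) (simp add: sum_distrib_right mult.assoc)

text \<open>The field moves row b of A in the direction A^a X^m and leaves X fixed. It is
  equivariant because A X^m is multiplied by h on the right exactly as A is.\<close>

lemma HN_T:
  fixes f :: "('n::finite, 'N::finite) pol"
  assumes "f \<in> HN k"
  shows "T a m b f \<in> HN k"
proof -
  define UX :: "complex^'N^'N \<Rightarrow> complex^'N^'n \<Rightarrow> complex^'N^'N" where "UX X A = 0" for X A
  define UA :: "complex^'N^'N \<Rightarrow> complex^'N^'n \<Rightarrow> complex^'N^'n"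
    where "UA X A = (\<chi> c i. if c = b then (A ** mpow X m) $ a $ i else 0)" for X A
  let ?\<xi> = "\<lambda>v. case v of XV i j \<Rightarrow> 0 | AV c j \<Rightarrow> if c = b then rho a m $ j else 0"
  have "(\<Sum>v\<in>UNIV. ?\<xi> v * deriv_var v f) \<in> HN k"
  proof (rule HN_vector_field[OF assms])
    fix g h X :: "complex^'N^'N" and A :: "complex^'N^'n"
    assume gh: "g ** h = mat 1" "h ** g = mat 1"
    have "A ** h ** mpow (g ** X ** h) m = A ** (h ** g) ** mpow X m ** h"
      by (simp add: mpow_conj[OF gh] matrix_mul_assoc)
    then have *: "A ** h ** mpow (g ** X ** h) m = A ** mpow X m ** h"
      by (simp add: gh)
    show "UX (g ** X ** h) (A ** h) = g ** UX X A ** h \<and> UA (g ** X ** h) (A ** h) = UA X A ** h"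
      unfolding UA_def UX_def * by (simp add: vec_eq_iff matrix_mul_component)
  next
    fix v :: "('n, 'N) var" and X A
    show "eval_pol (?\<xi> v) X A = pt (UX X A) (UA X A) v"
      by (simp add: pt_def UX_def UA_def split: var.split)
  qed
  also have "(\<Sum>v\<in>UNIV. ?\<xi> v * deriv_var v f) = T a m b f"
    by (simp add: sum_var T_def if_distrib[of "\<lambda>x. x * _"] cong: if_cong)
      (subst sum.swap, simp)
  finally show ?thesis .
qed

definition Euler :: "('n::finite, 'N::finite) oper"
  where "Euler f = (\<Sum>i\<in>UNIV. \<Sum>j\<in>UNIV. pv (XV i j) * deriv_var (XV i j) f)"

lemma HN_Euler:
  assumes "f \<in> HN k"
  shows "Euler f \<in> HN k"
proof -
  let ?\<xi> = "\<lambda>v. case v of XV i j \<Rightarrow> pv (XV i j) | AV c j \<Rightarrow> 0"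
  have "(\<Sum>v\<in>UNIV. ?\<xi> v * deriv_var v f) \<in> HN k"
    by (rule HN_vector_field[OF assms, where UX = "\<lambda>X A. X" and UA = "\<lambda>X A. 0"])
      (auto simp: pt_def eval_pv split: var.split)
  also have "(\<Sum>v\<in>UNIV. ?\<xi> v * deriv_var v f) = Euler f"
    by (simp add: sum_var Euler_def)
  finally show ?thesis .
qed

lemma det_replace_row: "det (\<chi> i. if i = x then w else (mat 1 :: 'a::field^'n^'n) $ i) = w $ x"
proof -
  have *: "(\<chi> i. if i = x then w else (mat 1 :: 'a::field^'n^'n) $ i)
      = (\<chi> i. if i = x then (\<Sum>j\<in>UNIV. w $ j *s row j (mat 1)) else row i (mat 1))"
    by (simp add: vec_eq_iff row_def mat_def if_distrib[of "(*) _"] cong: if_cong)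
  show ?thesis unfolding * cramer_lemma_transpose by simp
qed

lemma pderiv_det_1_plus:
  fixes M :: "complex^'n^'n"
  defines "P \<equiv> \<chi> i j. [:(mat 1 :: complex^'n^'n) $ i $ j, M $ i $ j:]"
  shows "poly (det P) t = det (\<chi> i j. (mat 1 :: complex^'n^'n) $ i $ j + t * M $ i $ j)"
    and "poly (pderiv (det P)) 0 = trace M"
proof -
  have poly_det: "poly (det Q) t = det (\<chi> i j. poly (Q $ i $ j) t)" for Q :: "complex poly^'n^'n" and t
    by (simp add: det_def poly_sum poly_prod)
  show "poly (det P) t = det (\<chi> i j. (mat 1 :: complex^'n^'n) $ i $ j + t * M $ i $ j)"
    by (simp add: poly_det P_def)
  have "poly (pderiv (det P)) 0 = (\<Sum>x\<in>UNIV. det (\<chi> i. if i = x then M $ i else (mat 1 :: complex^'n^'n) $ i))"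
    unfolding pderiv.D_det poly_sum poly_det
    by (intro sum.cong refl arg_cong[where f = det]) (simp add: vec_eq_iff P_def pderiv_pCons)
  also have "\<dots> = trace M"
  proof -
    have "det (\<chi> i. if i = x then M $ i else (mat 1 :: complex^'n^'n) $ i) = M $ x $ x" for x
      using det_replace_row[of x "M $ x"] by (simp cong: if_cong)
    then show ?thesis by (simp add: trace_def)
  qed
  finally show "poly (pderiv (det P)) 0 = trace M" .
qed

definition trX :: "nat \<Rightarrow> ('n::finite, 'N::finite) pol"
  where "trX m = trace (mpow XM m)"

lemma eval_trX [simp]: "eval_pol (trX m) X A = trace (mpow X m)"
  by (simp add: trX_def trace_def eval_sum)

text \<open>\<open>T\<^bsub>0,m\<^esub>(1) = \<epsilon>\<^sub>2 t\<^bsub>0,m\<^esub>\<close>: differentiate \<open>f(X, A(1 + tX\<^sup>m)) = det(1 + tX\<^sup>m)\<^sup>k f(X, A)\<close> at \<open>t = 0\<close>.\<close>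

lemma HN_trX:
  fixes f :: "('n::finite, 'N::finite) pol"
  assumes f: "f \<in> HN k"
  shows "(\<Sum>a\<in>UNIV. T a m a f) = smul (of_nat k) (trX m * f)"
proof (rule pol_eqI)
  fix X :: "complex^'N^'N" and A :: "complex^'N^'n"
  let ?M = "mpow X m"
  define P where "P = (\<chi> i j. [:(mat 1 :: complex^'N^'N) $ i $ j, ?M $ i $ j:])"
  obtain F where F: "\<And>t. poly F t = eval_pol f (\<chi> i j. X $ i $ j + t * 0 $ i $ j)
        (\<chi> a i. A $ a $ i + t * (A ** ?M) $ a $ i)"
    "poly (pderiv F) 0 = (\<Sum>v\<in>UNIV. pt 0 (A ** ?M) v * eval_pol (deriv_var v f) X A)"
    using eval_line[of f X 0 A "A ** ?M"] by blast
  let ?c = "eval_pol f X A"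
  \<comment> \<open>Invariance applies only where 1 + tX^m is invertible. The factor
    \<open>det P\<close> makes the identity hold for all t and can be cancelled, its value at t = 0
    being 1.\<close>
  have "poly (det P * (F - smult ?c (det P ^ k))) t = 0" for t
  proof (cases "poly (det P) t = 0")
    case False
    define g where "g = (\<chi> i j. (mat 1 :: complex^'N^'N) $ i $ j + t * ?M $ i $ j)"
    have det: "poly (det P) t = det g"
      unfolding P_def g_def by (rule pderiv_det_1_plus)
    then have "invertible g" using False by (simp add: invertible_det_nz)
    note inv = matrix_inv_works[OF this]
    have "X ** ?M = ?M ** X"
      using mpow_add[of X 1 m] mpow_add[of X m 1] by simp
    then have "X ** g = g ** X"
      by (simp add: g_def vec_eq_iff matrix_mul_component algebra_simps sum.distrib mat_def
          if_distrib[of "(*) _"] if_distrib[of "\<lambda>x. x * _"] cong: if_cong)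
        (simp add: mult.commute flip: sum_distrib_left)
    then have "matrix_inv g ** X ** g = X"
      by (metis inv(2) matrix_mul_assoc matrix_mul_lid)
    moreover have "(\<chi> a i. A $ a $ i + t * (A ** ?M) $ a $ i) = A ** g"
      by (simp add: g_def vec_eq_iff matrix_mul_component algebra_simps sum.distrib mat_def
          if_distrib[of "(*) _"] sum_distrib_left cong: if_cong)
    ultimately show ?thesis
      using HN_D[OF f inv(2,1), of X A] by (simp add: F(1) det)
  qed simp
  then have "det P * (F - smult ?c (det P ^ k)) = 0"
    using poly_all_0_iff_0 by blast
  moreover have P0: "poly (det P) 0 = 1"
    unfolding P_def pderiv_det_1_plus(1) by (simp flip: mat_def)
  ultimately have "F = smult ?c (det P ^ k)" by (metis poly_0 mult_eq_0_iff zero_neq_one eq_iff_diff_eq_0)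
  then have "poly (pderiv F) 0 = of_nat k * trace ?M * ?c"
    using pderiv_det_1_plus(2)[of ?M] P0
    by (cases k) (simp_all add: pderiv_smult pderiv_power_Suc del: power_Suc flip: P_def)
  also have "poly (pderiv F) 0 = eval_pol (\<Sum>a\<in>UNIV. T a m a f) X A"
    by (simp add: F(2) sum_var T_def eval_sum eval_mult)
  finally show "eval_pol (\<Sum>a\<in>UNIV. T a m a f) X A = eval_pol (smul (of_nat k) (trX m * f)) X A"
    by (simp add: eval_smul eval_mult)
qed

section \<open>Gradings\<close>

global_interpretation polv: vector_space smul
proof
  fix a b :: complex and x y :: "('a, 'b) pol"
  show "smul a (x + y) = smul a x + smul a y" by (simp add: smul_pc distrib_left)
  show "smul (a + b) x = smul a x + smul b x" by (simp add: smul_pc pc_add distrib_right)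
  show "smul a (smul b x) = smul (a * b) x" by (simp add: smul_pc pc_mult mult.assoc)
  show "smul 1 x = x" by (simp add: smul_pc)
qed

text \<open>The weights are kept arbitrary because several gradings are needed: by energy
  (\<open>xw\<close>), by degree in A (\<open>aw\<close>), by degree in one row of A
  (\<open>wt\<close>), and by the index of Krylov rows (\<open>tw\<close>).\<close>

definition wdeg :: "(('n::finite, 'N::finite) var \<Rightarrow> nat) \<Rightarrow> ('n, 'N) mon \<Rightarrow> nat"
  where "wdeg w m = (\<Sum>v\<in>UNIV. w v * lk m v)"

lemma wdeg_add: "wdeg w (m + m') = wdeg w m + wdeg w m'"
  by (simp add: wdeg_def lookup_add distrib_left sum.distrib)

lemma wdeg_0 [simp]: "wdeg w 0 = 0"
  by (simp add: wdeg_def)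

lemma wdeg_sg [simp]: "wdeg w (sg v j) = w v * j"
  by (simp add: wdeg_def lookup_single when_def if_distrib cong: if_cong)

text \<open>The weighted Euler operator: its eigenspaces are the homogeneous parts, so gradedness of
  a subspace follows from invariance under one operator.\<close>

definition weightop :: "(('n::finite, 'N::finite) var \<Rightarrow> nat) \<Rightarrow> ('n, 'N) oper"
  where "weightop w f = (\<Sum>v\<in>UNIV. smul (of_nat (w v)) (pv v * deriv_var v f))"

lemma lookup_pv_deriv: "lk (pv v * deriv_var v f) m = of_nat (lk m v) * lk f m"
proof (induction f rule: pol_induct_add)
  case (1 m' a)
  have "sg v 1 + (m' - sg v 1) = m'" if "lk m' v \<noteq> 0"
    by (rule poly_mapping_eqI) (use that in \<open>auto simp: lookup_add lookup_minus lookup_single when_def\<close>)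
  then show ?case
    by (cases "lk m' v = 0")
      (auto simp: pv_def deriv_var_sg mult_single lookup_single when_def)
qed (simp add: deriv_var_add lookup_add distrib_left)

lemma lookup_weightop [simp]: "lk (weightop w f) m = of_nat (wdeg w m) * lk f m"
  by (simp add: weightop_def lookup_sum lookup_pv_deriv wdeg_def sum_distrib_right mult.assoc)

definition homog :: "(('n::finite, 'N::finite) var \<Rightarrow> nat) \<Rightarrow> nat \<Rightarrow> ('n, 'N) pol \<Rightarrow> bool"
  where "homog w d f \<longleftrightarrow> (\<forall>m. lk f m \<noteq> 0 \<longrightarrow> wdeg w m = d)"

lemma homog_0 [simp]: "homog w d 0"
  by (simp add: homog_def)

lemma homog_add: "homog w d f \<Longrightarrow> homog w d g \<Longrightarrow> homog w d (f + g)"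
  unfolding homog_def lookup_add by (metis add.right_neutral)

lemma homog_smul: "homog w d f \<Longrightarrow> homog w d (smul c f)"
  by (auto simp: homog_def)

lemma homog_sum: "(\<And>i. i \<in> I \<Longrightarrow> homog w d (f i)) \<Longrightarrow> homog w d (\<Sum>i\<in>I. f i)"
  by (induction I rule: infinite_finite_induct) (auto intro: homog_add)

lemma homog_mult: 
  assumes "homog w d f" "homog w e g"
  shows "homog w (d + e) (f * g)"
proof -
  have "\<exists>p q. m = p + q \<and> p \<in> ks f \<and> q \<in> ks g" if "lk (f * g) m \<noteq> 0" for m
    using keys_mult[of f g] that by (auto simp: in_keys_iff)
  then show ?thesis
    using assms unfolding homog_def by (metis in_keys_iff wdeg_add)
qed

lemma homog_pc [simp]: "homog w 0 (pc c)"
  by (simp add: homog_def pc_def lookup_single when_def)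

lemma homog_1 [simp]: "homog w 0 1"
  using homog_pc[of w 1] by simp

lemma homog_pv: "homog w (w v) (pv v)"
  by (simp add: homog_def pv_def lookup_single when_def)

lemma homog_prod: "finite I \<Longrightarrow> (\<And>i. i \<in> I \<Longrightarrow> homog w (d i) (f i)) \<Longrightarrow> homog w (\<Sum>i\<in>I. d i) (\<Prod>i\<in>I. f i)"
  by (induction I rule: finite_induct) (auto intro: homog_mult)

lemma homog_det:
  fixes M :: "('n::finite, 'N::finite) pol^'N^'N"
  assumes "\<And>i j. homog w (d i) (M $ i $ j)"
  shows "homog w (\<Sum>i\<in>UNIV. d i) (det M)"
  unfolding det_def
proof (rule homog_sum)
  fix p :: "'N \<Rightarrow> 'N"
  have "homog w (\<Sum>i\<in>UNIV. d i) (\<Prod>i\<in>UNIV. M $ i $ p i)"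
    by (rule homog_prod) (simp_all add: assms)
  moreover have "of_int (sign p) * f = smul (of_int (sign p)) f" for f :: "('n, 'N) pol"
    by (simp add: smul_pc pc_def)
  ultimately show "homog w (\<Sum>i\<in>UNIV. d i) (of_int (sign p) * (\<Prod>i\<in>UNIV. M $ i $ p i))"
    by (simp add: homog_smul)
qed

lemma homog_weightop: "homog w d f \<longleftrightarrow> weightop w f = smul (of_nat d) f"
  by (auto simp: poly_mapping_eq_iff fun_eq_iff homog_def)

definition hcomp :: "(('n::finite, 'N::finite) var \<Rightarrow> nat) \<Rightarrow> nat \<Rightarrow> ('n, 'N) pol \<Rightarrow> ('n, 'N) pol"
  where "hcomp w d f = (\<Sum>m\<in>ks f. if wdeg w m = d then sg m (lk f m) else 0)"

lemma lookup_hcomp [simp]: "lk (hcomp w d f) m = (if wdeg w m = d then lk f m else 0)"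
proof -
  have "lk (hcomp w d f) m = (\<Sum>m'\<in>ks f. if m' = m then (if wdeg w m = d then lk f m else 0) else 0)"
    unfolding hcomp_def lookup_sum by (intro sum.cong) (auto simp: lookup_single)
  then show ?thesis
    by (auto simp: in_keys_iff)
qed

lemma homog_hcomp [simp]: "homog w d (hcomp w d f)"
  by (simp add: homog_def)

lemma hcomp_homog: "homog w e f \<Longrightarrow> hcomp w d f = (if d = e then f else 0)"
  by (rule poly_mapping_eqI) (auto simp: homog_def)

lemma hcomp_add: "hcomp w d (f + g) = hcomp w d f + hcomp w d g"
  by (rule poly_mapping_eqI) (simp add: lookup_add)

lemma hcomp_smul: "hcomp w d (smul c f) = smul c (hcomp w d f)"
  by (rule poly_mapping_eqI) simp

lemma sum_hcomp: "finite D \<Longrightarrow> wdeg w ` ks f \<subseteq> D \<Longrightarrow> (\<Sum>d\<in>D. hcomp w d f) = f"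
  by (rule poly_mapping_eqI) (auto simp: lookup_sum in_keys_iff image_subset_iff)

text \<open>Lagrange interpolation: the product of \<open>weightop w - e\<close> over the other
  degrees e occurring in f kills the other components and multiplies the component of degree d by
  the nonzero constant \<open>?c\<close>.\<close>

lemma hcomp_in_subspace:
  assumes W: "polv.subspace W" "\<And>f. f \<in> W \<Longrightarrow> weightop w f \<in> W" and f: "f \<in> W"
  shows "hcomp w d f \<in> W"
proof -
  have *: "\<exists>g\<in>W. \<forall>m. lk g m = (\<Prod>e\<in>S. of_nat (wdeg w m) - of_nat e) * lk f m" if "finite S" for S
    using that
  proof (induction S)
    case empty
    show ?case using f by auto
  next
    case (insert e S)
    then obtain g where g: "g \<in> W" "\<forall>m. lk g m = (\<Prod>e\<in>S. of_nat (wdeg w m) - of_nat e) * lk f m"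
      by auto
    show ?case
    proof (intro bexI allI)
      show "weightop w g - smul (of_nat e) g \<in> W"
        by (intro polv.subspace_diff polv.subspace_scale W g)
      show "lk (weightop w g - smul (of_nat e) g) m
          = (\<Prod>e\<in>insert e S. of_nat (wdeg w m) - of_nat e) * lk f m" for m
        using insert(1,2) by (simp add: lookup_minus g(2) algebra_simps)
    qed
  qed
  let ?S = "wdeg w ` ks f - {d}"
  let ?c = "\<Prod>e\<in>?S. of_nat d - of_nat e :: complex"
  have c: "?c \<noteq> 0" by simp
  obtain g where g: "g \<in> W" "\<And>m. lk g m = (\<Prod>e\<in>?S. of_nat (wdeg w m) - of_nat e) * lk f m"
    using *[of ?S] by auto
  have "hcomp w d f = smul (1 / ?c) g"
  proof (rule poly_mapping_eqI)
    fix m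
    show "lk (hcomp w d f) m = lk (smul (1 / ?c) g) m"
    proof (cases "wdeg w m = d \<or> lk f m = 0")
      case False
      then have "(\<Prod>e\<in>?S. of_nat (wdeg w m) - of_nat e :: complex) = 0"
        by (intro prod_zero) (auto simp: in_keys_iff)
      with False show ?thesis by (simp add: g)
    qed (use c in \<open>auto simp: g\<close>)
  qed
  then show ?thesis using W g by (simp add: polv.subspace_scale)
qed

section \<open>The Bargmann form\<close>

text \<open>With the squared norm m! on monomials, multiplication by a variable becomes adjoint to
  differentiation by it.\<close>

definition mfact :: "('n::finite, 'N::finite) mon \<Rightarrow> real"
  where "mfact m = (\<Prod>v\<in>UNIV. fact (lk m v))"

definition ip :: "('n::finite, 'N::finite) pol \<Rightarrow> ('n, 'N) pol \<Rightarrow> complex"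
  where "ip f g = (\<Sum>m\<in>ks f. lk f m * cnj (lk g m) * of_real (mfact m))"

lemma mfact_pos: "mfact m > 0"
  by (simp add: mfact_def prod_pos)

lemma ip_superset:
  "finite S \<Longrightarrow> ks f \<subseteq> S \<Longrightarrow> ip f g = (\<Sum>m\<in>S. lk f m * cnj (lk g m) * of_real (mfact m))"
  unfolding ip_def by (intro sum.mono_neutral_left) (auto simp: in_keys_iff)

lemma ip_commute: "ip g f = cnj (ip f g)"
proof -
  have "finite (ks f \<union> ks g)" by simp
  then show ?thesis
    by (subst (1 2) ip_superset[of "ks f \<union> ks g"]) (simp_all add: mult_ac)
qed

lemma ip_add_left: "ip (f + g) h = ip f h + ip g h"
proof -
  have "ks (f + g) \<subseteq> ks f \<union> ks g" by (rule keys_add)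
  then show ?thesis
    by (simp add: ip_superset[of "ks f \<union> ks g"] lookup_add algebra_simps sum.distrib)
qed

lemma ip_smul_left: "ip (smul c f) h = c * ip f h"
proof -
  have "ks (smul c f) \<subseteq> ks f" by (auto simp: in_keys_iff)
  then show ?thesis
    by (simp add: ip_superset[of "ks f"] sum_distrib_left mult.assoc)
qed

lemma ip_add_right: "ip h (f + g) = ip h f + ip h g"
  by (subst (1 2 3) ip_commute) (simp add: ip_add_left)

lemma ip_smul_right: "ip h (smul c f) = cnj c * ip h f"
  by (subst (1 2) ip_commute) (simp add: ip_smul_left)

lemma ip_0 [simp]: "ip 0 f = 0" "ip f 0 = 0"
  by (simp_all add: ip_def)

lemma ip_diff_left: "ip (f - g) h = ip f h - ip g h"
  using ip_add_left[of "f - g" g h] by simp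

lemma ip_diff_right: "ip h (f - g) = ip h f - ip h g"
  using ip_add_right[of h "f - g" g] by simp

lemma ip_sum_left: "ip (\<Sum>i\<in>I. f i) h = (\<Sum>i\<in>I. ip (f i) h)"
  by (induction I rule: infinite_finite_induct) (simp_all add: ip_add_left)

lemma ip_sum_right: "ip h (\<Sum>i\<in>I. f i) = (\<Sum>i\<in>I. ip h (f i))"
  by (induction I rule: infinite_finite_induct) (simp_all add: ip_add_right)

lemma ip_self_eq_0: "ip f f = 0 \<longleftrightarrow> f = 0"
proof
  assume "ip f f = 0"
  moreover have "ip f f = of_real (\<Sum>m\<in>ks f. (cmod (lk f m))\<^sup>2 * mfact m)"
    unfolding ip_def of_real_sum by (simp flip: complex_norm_square)
  ultimately have "(\<Sum>m\<in>ks f. (cmod (lk f m))\<^sup>2 * mfact m) = 0" by (metis of_real_eq_0_iff)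
  then have "\<forall>m\<in>ks f. (cmod (lk f m))\<^sup>2 * mfact m = 0"
    by (subst (asm) sum_nonneg_eq_0_iff) (auto intro!: mult_nonneg_nonneg less_imp_le[OF mfact_pos])
  then have "\<forall>m\<in>ks f. lk f m = 0" using mfact_pos by (auto simp: less_le)
  then show "f = 0" by (metis in_keys_iff lookup_zero poly_mapping_eqI)
qed simp

lemma ip_homog: "homog w d f \<Longrightarrow> homog w e g \<Longrightarrow> d \<noteq> e \<Longrightarrow> ip f g = 0"
  unfolding ip_def homog_def by (intro sum.neutral) (metis complex_cnj_zero mult_zero_left mult_zero_right)

lemma ip_pv: "ip (pv v * f) g = ip f (deriv_var v g)"
proof (induction f rule: pol_induct_add)
  case (1 m a)
  have "mfact (m + sg v 1) = of_nat (lk m v + 1) * mfact m"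
  proof -
    have "mfact (m + sg v 1) = (\<Prod>w\<in>UNIV. (if w = v then of_nat (lk m v + 1) else 1) * fact (lk m w))"
      unfolding mfact_def by (intro prod.cong) (auto simp: lookup_add lookup_single algebra_simps)
    then show ?thesis by (simp add: prod.distrib mfact_def)
  qed
  moreover have "ip (sg m a) h = a * cnj (lk h m) * of_real (mfact m)" for m a and h :: "('a, 'b) pol"
    by (simp add: ip_superset[of "{m}"])
  ultimately show ?case
    by (simp add: pv_def mult_single lookup_deriv_var add.commute[of _ m] mult_ac del: of_nat_Suc)
qed (simp add: distrib_left ip_add_left)

lemma ip_deriv_var: "ip (deriv_var v f) g = ip f (pv v * g)"
  by (subst (1 2) ip_commute) (simp add: ip_pv)

lemma ip_weightop: "ip (weightop w f) g = ip f (weightop w g)"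
  by (simp add: weightop_def ip_sum_left ip_sum_right ip_smul_left ip_smul_right ip_pv ip_deriv_var)

lemma ip_span_right:
  assumes "\<And>b. b \<in> B \<Longrightarrow> ip f b = 0" "x \<in> polv.span B"
  shows "ip f x = 0"
proof -
  have "polv.subspace {x. ip f x = 0}"
    by (rule polv.subspaceI) (auto simp: ip_add_right ip_smul_right)
  then have "polv.span B \<subseteq> {x. ip f x = 0}"
    by (intro polv.span_minimal) (use assms in auto)
  then show ?thesis using assms by auto
qed

lemma orthogonal_projection_span:
  assumes "finite B"
  shows "\<exists>u\<in>polv.span B. \<forall>b\<in>polv.span B. ip (f - u) b = 0"
  using assms
proof (induction B arbitrary: f)
  case empty
  then show ?case by simp
next
  case (insert b B)
  obtain b0 where b0: "b0 \<in> polv.span B" "\<And>x. x \<in> polv.span B \<Longrightarrow> ip (b - b0) x = 0"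
    using insert.IH[of b] by auto
  obtain u0 where u0: "u0 \<in> polv.span B" "\<And>x. x \<in> polv.span B \<Longrightarrow> ip (f - u0) x = 0"
    using insert.IH[of f] by auto
  have mono: "polv.span B \<subseteq> polv.span (insert b B)" by (rule polv.span_mono) auto
  have b: "b \<in> polv.span (insert b B)" by (rule polv.span_base) simp
  define b' where "b' = b - b0"
  \<comment> \<open>If \<open>b' = 0\<close>, the quotient is 0 by convention; this is harmless
    because \<open>b'\<close> then contributes nothing.\<close>
  define u where "u = u0 + smul (ip (f - u0) b' / ip b' b') b'"
  have *: "ip (f - u) x = 0" if "x \<in> polv.span B" for x
    using b0(2)[OF that] u0(2)[OF that]
    by (simp add: u_def b'_def ip_diff_left ip_add_left ip_smul_left)
  have "ip (f - u) b' = 0"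
    by (cases "b' = 0") (simp_all add: u_def ip_diff_left ip_add_left ip_smul_left ip_self_eq_0)
  then have "ip (f - u) b = 0"
    using *[OF b0(1)] by (simp add: b'_def ip_diff_right)
  then have "\<forall>x\<in>polv.span (insert b B). ip (f - u) x = 0"
    using ip_span_right[of "insert b B" "f - u"] * polv.span_base by blast
  moreover have "u \<in> polv.span (insert b B)"
    unfolding u_def b'_def using b0 u0 mono b
    by (intro polv.span_add polv.span_scale polv.span_diff) auto
  ultimately show ?case by blast
qed

lemma finite_dim_basis:
  assumes "polv.subspace U" "finite M" "\<And>f. f \<in> U \<Longrightarrow> ks f \<subseteq> M"
  obtains B where "finite B" "B \<subseteq> U" "\<not> polv.dependent B" "polv.span B = U"
proof -
  obtain B where B: "B \<subseteq> U" "\<not> polv.dependent B" "U \<subseteq> polv.span B"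
    using polv.basis_exists[of U] by metis
  have "U \<subseteq> polv.span ((\<lambda>m. sg m 1) ` M)"
  proof
    fix f assume "f \<in> U"
    then have "f = (\<Sum>m\<in>M. smul (lk f m) (sg m 1))"
      using sum_sg'[OF assms(2) assms(3)[of f]] by (simp add: smul_def mult_single)
    also have "\<dots> \<in> polv.span ((\<lambda>m. sg m 1) ` M)"
      by (intro polv.span_sum polv.span_scale polv.span_base) auto
    finally show "f \<in> polv.span ((\<lambda>m. sg m 1) ` M)" .
  qed
  then have "finite B"
    using polv.independent_span_bound[of "(\<lambda>m. sg m 1) ` M" B] B assms(2) by auto
  moreover have "polv.span B = U"
    using B polv.span_minimal[OF B(1) assms(1)] by auto
  ultimately show ?thesis using that B by blast
qed

lemma orthogonal_projection:
  assumes "polv.subspace U" "finite M" "\<And>f. f \<in> U \<Longrightarrow> ks f \<subseteq> M"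
  obtains u where "u \<in> U" "\<And>b. b \<in> U \<Longrightarrow> ip (f - u) b = 0"
  using finite_dim_basis[OF assms] orthogonal_projection_span by metis

definition xw :: "('n, 'N) var \<Rightarrow> nat" where "xw v = (case v of XV i j \<Rightarrow> 1 | AV a i \<Rightarrow> 0)"
definition aw :: "('n, 'N) var \<Rightarrow> nat" where "aw v = (case v of XV i j \<Rightarrow> 0 | AV a i \<Rightarrow> 1)"

lemma xw_simps [simp]: "xw (XV i j) = 1" "xw (AV a i) = 0"
  and aw_simps [simp]: "aw (XV i j) = 0" "aw (AV a i) = 1"
  by (simp_all add: xw_def aw_def)

lemma X_degree_wdeg: "X_degree m = wdeg xw m"
  by (simp add: X_degree_def wdeg_def sum_var)

lemma HN_degree_iff: "f \<in> HN_degree k d \<longleftrightarrow> f \<in> HN k \<and> homog xw d f"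
  by (auto simp: HN_degree_def homog_def X_degree_wdeg in_keys_iff)

lemma subspace_HN: "polv.subspace (HN k)"
  by (intro polv.subspaceI HN_add HN_smul HN_0)

lemma subspace_HN_degree: "polv.subspace (HN_degree k d)"
  by (rule polv.subspaceI) (auto simp: HN_degree_iff HN_add HN_smul homog_add homog_smul)

lemma Euler_weightop: "Euler f = weightop xw f"
  by (simp add: Euler_def weightop_def sum_var)

lemma hcomp_HN: "f \<in> HN k \<Longrightarrow> hcomp xw d f \<in> HN_degree k d"
  using hcomp_in_subspace[OF subspace_HN, of k xw f d] HN_Euler
  by (auto simp: HN_degree_iff Euler_weightop)

lemma sum_T0: "(\<Sum>a\<in>UNIV. T a 0 a f) = weightop aw f"
  by (simp add: T_def weightop_def sum_var rho_def AM_def)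

text \<open>The case m = 0 of \<open>HN_trX\<close>, where the trace is N and the left side is the
  Euler operator in A. With the energy also fixed, only finitely many monomials remain.\<close>

lemma HN_homog_aw:
  fixes f :: "('n::finite, 'N::finite) pol"
  assumes "f \<in> HN k"
  shows "homog aw (k * CARD('N)) f"
proof -
  have "(trX 0 :: ('n, 'N) pol) = pc (of_nat CARD('N))"
    by (rule pol_eqI) (simp add: trace_I eval_pc)
  then show ?thesis
    using HN_trX[OF assms, of 0] unfolding sum_T0 homog_weightop
    by (simp add: smul_pc pc_mult mult.assoc)
qed

lemma finite_mons: "finite {m :: ('n::finite, 'N::finite) mon. wdeg xw m = d \<and> wdeg aw m = e}"
proof -
  let ?M = "{m :: ('n, 'N) mon. wdeg xw m = d \<and> wdeg aw m = e}"
  have "lk m v \<le> d + e" if "m \<in> ?M" for m v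
  proof -
    have "lk m v \<le> (\<Sum>v\<in>UNIV. lk m v)" by (rule member_le_sum) auto
    also have "\<dots> = (\<Sum>v\<in>UNIV. (xw v + aw v) * lk m v)"
      by (intro sum.cong) (auto simp: xw_def aw_def split: var.split)
    also have "\<dots> = d + e" using that by (simp add: wdeg_def distrib_right sum.distrib)
    finally show ?thesis .
  qed
  then have "lk ` ?M \<subseteq> Pi\<^sub>E UNIV (\<lambda>_. {..d + e})"
    by auto
  then have "finite (lk ` ?M)" by (rule finite_subset) (simp add: finite_PiE)
  then show ?thesis
    by (rule finite_imageD) (simp add: inj_on_def lookup_inject)
qed

lemma keys_HN_degree:
  fixes f :: "('n::finite, 'N::finite) pol"
  assumes "f \<in> HN_degree k d"
  shows "ks f \<subseteq> {m. wdeg xw m = d \<and> wdeg aw m = k * CARD('N)}"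
  using assms HN_homog_aw[of f k] by (auto simp: HN_degree_iff homog_def in_keys_iff)

lemma projection_HN_degree:
  fixes U :: "('n::finite, 'N::finite) pol set"
  assumes "polv.subspace U" "U \<subseteq> HN_degree k d"
  obtains u where "u \<in> U" "\<And>b. b \<in> U \<Longrightarrow> ip (f - u) b = 0"
proof -
  have "ks f \<subseteq> {m. wdeg xw m = d \<and> wdeg aw m = k * CARD('N)}" if "f \<in> U" for f
    using keys_HN_degree that assms(2) by blast
  from orthogonal_projection[OF assms(1) finite_mons this, of f] show ?thesis
    using that by blast
qed

lemma graded_sum_mem:
  assumes "polv.subspace W" "\<And>d. hcomp xw d f \<in> W"
  shows "f \<in> W"
proof -
  have "(\<Sum>d\<in>wdeg xw ` ks f. hcomp xw d f) \<in> W"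
    by (intro polv.subspace_sum assms)
  then show ?thesis by (simp add: sum_hcomp)
qed

text \<open>Some component of an element outside \<open>W\<close> lies outside \<open>W\<close>.
  Subtracting its projection to the finite-dimensional part of \<open>W\<close> of the same energy
  gives \<open>f\<close>; the parts of other energies are orthogonal to it anyway.\<close>

lemma graded_complement:
  fixes W :: "('n::finite, 'N::finite) pol set"
  assumes W: "polv.subspace W" "W \<subseteq> HN k" "\<And>f d. f \<in> W \<Longrightarrow> hcomp xw d f \<in> W" and "W \<noteq> HN k"
  obtains d f where "f \<in> HN_degree k d" "f \<noteq> 0" "\<And>w. w \<in> W \<Longrightarrow> ip f w = 0"
proof -
  obtain g where g: "g \<in> HN k" "g \<notin> W" using assms by auto
  then obtain d where d: "hcomp xw d g \<notin> W" using graded_sum_mem[OF W(1)] by blast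
  let ?U = "W \<inter> HN_degree k d"
  have U: "polv.subspace ?U" by (intro polv.subspace_inter W subspace_HN_degree)
  obtain u where u: "u \<in> ?U" "\<And>b. b \<in> ?U \<Longrightarrow> ip (hcomp xw d g - u) b = 0"
    using projection_HN_degree[OF U, of k d] by auto
  let ?f = "hcomp xw d g - u"
  have f: "?f \<in> HN_degree k d"
    using hcomp_HN[OF g(1)] u(1) by (intro polv.subspace_diff subspace_HN_degree) auto
  show ?thesis
  proof (rule that[OF f])
    show "?f \<noteq> 0" using u d by auto
    fix w assume w: "w \<in> W"
    have "ip ?f (hcomp xw e w) = 0" for e
    proof (cases "e = d")
      case True
      then show ?thesis using u(2)[of "hcomp xw d w"] w W hcomp_HN[of w k d] by auto
    next
      case False
      then show ?thesis
        using ip_homog[of xw d ?f e "hcomp xw e w"] f by (simp add: HN_degree_iff)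
    qed
    then have "ip ?f (\<Sum>e\<in>wdeg xw ` ks w. hcomp xw e w) = 0"
      by (simp add: ip_sum_right)
    then show "ip ?f w = 0" by (simp add: sum_hcomp)
  qed
qed

section \<open>Subspaces stable under the current algebra\<close>

definition stable :: "nat \<Rightarrow> ('n::finite, 'N::finite) pol set \<Rightarrow> bool"
  where "stable k W \<longleftrightarrow> polv.subspace W \<and> W \<subseteq> HN k \<and> (\<forall>f\<in>W. \<forall>a m b. T a m b f \<in> W)"

lemma stable_HN: "stable k (HN k)"
  by (simp add: stable_def subspace_HN HN_T)

section \<open>Rows A^a p(X) and shifts of A by matrix polynomials\<close>

definition rowp :: "complex poly \<Rightarrow> 'n::finite \<Rightarrow> 'N::finite \<Rightarrow> ('n, 'N) pol"
  where "rowp p a j = (\<Sum>m\<le>degree p. pc (coeff p m) * rho a m $ j)"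

lemma rowp_bound: "degree p \<le> M \<Longrightarrow> rowp p a j = (\<Sum>m\<le>M. pc (coeff p m) * rho a m $ j)"
  unfolding rowp_def by (intro sum.mono_neutral_left) (auto simp: coeff_eq_0)

lemma rowp_add: "rowp (p + q) a j = rowp p a j + rowp q a j"
proof -
  have "degree (p + q) \<le> max (degree p) (degree q)" by (rule degree_add_le_max)
  then show ?thesis
    by (simp add: rowp_bound[of _ "max (degree p) (degree q)"] pc_add distrib_right sum.distrib)
qed

lemma rowp_monom: "rowp (monom c m) a j = pc c * rho a m $ j"
  by (subst rowp_bound[of _ m])
    (simp_all add: degree_monom_le if_distrib[of pc] if_distrib[of "\<lambda>x. x * _"] cong: if_cong)

lemma rowp_0 [simp]: "rowp 0 a j = 0"
  by (simp add: rowp_def)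

lemma rowp_1 [simp]: "rowp 1 a j = pv (AV a j)"
  by (simp add: rowp_def rho_def AM_def)

lemma rowp_sum: "rowp (\<Sum>i\<in>I. p i) a j = (\<Sum>i\<in>I. rowp (p i) a j)"
  by (induction I rule: infinite_finite_induct) (simp_all add: rowp_add)

lemma rowp_minus: "rowp (- p) a j = - rowp p a j"
  using rowp_add[of p "- p" a j] by (simp add: eq_neg_iff_add_eq_0 add.commute)

lemma rowp_smult: "rowp (smult c p) a j = pc c * rowp p a j"
  by (cases "c = 0") (simp_all add: rowp_def pc_mult sum_distrib_left mult.assoc)

lemma poly_monom_induct:
  assumes "\<And>c m. P (monom c m)" "\<And>p q. P p \<Longrightarrow> P q \<Longrightarrow> P (p + q)"
  shows "P (p :: 'a::comm_monoid_add poly)"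
proof -
  have "P (\<Sum>m\<in>S. monom (coeff p m) m)" if "finite S" for S
    using that
  proof (induction S)
    case empty
    show ?case using assms(1)[of 0 0] by simp
  qed (simp add: assms)
  then show ?thesis by (metis poly_as_sum_of_monoms finite_atMost)
qed

text \<open>\<^const>\<open>pderiv\<close> is only available over rings whose type class excludes zero divisors.\<close>

definition pd :: "'r::comm_ring_1 poly \<Rightarrow> 'r poly"
  where "pd p = (\<Sum>m\<le>degree p. monom (of_nat m * coeff p m) (m - 1))"

lemma coeff_pd: "coeff (pd p) r = of_nat (Suc r) * coeff p (Suc r)"
proof -
  have "coeff (pd p) r = (\<Sum>m\<le>degree p. if m = Suc r then of_nat (Suc r) * coeff p (Suc r) else 0)"
    unfolding pd_def coeff_sum
  proof (intro sum.cong refl)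
    fix m show "coeff (monom (of_nat m * coeff p m) (m - 1)) r
        = (if m = Suc r then of_nat (Suc r) * coeff p (Suc r) else 0)"
      by (cases m) simp_all
  qed
  then show ?thesis
    by (cases "Suc r \<le> degree p") (simp_all add: coeff_eq_0 del: of_nat_Suc)
qed

lemma pd_add: "pd (p + q) = pd p + pd q"
  by (rule poly_eqI) (simp add: coeff_pd distrib_left del: of_nat_Suc)

lemma pd_monom: "pd (monom c m) = monom (of_nat m * c) (m - 1)"
  by (rule poly_eqI, cases m) (auto simp: coeff_pd)

lemma pd_pCons [simp]: "pd [:c, d:] = [:d:]" "pd [:c:] = 0"
  by (auto intro!: poly_eqI simp: coeff_pd coeff_pCons split: nat.split)

global_interpretation pd: derivation "pd :: 'r::comm_ring_1 poly \<Rightarrow> 'r poly"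
proof
  fix p q :: "'r poly"
  show "pd (p + q) = pd p + pd q" by (rule pd_add)
  show "pd (p * q) = pd p * q + p * pd q"
  proof (induction p rule: poly_monom_induct)
    case (1 c m)
    show ?case
    proof (induction q rule: poly_monom_induct)
      case (1 d l)
      show ?case
        by (cases m; cases l) (simp_all add: pd_monom mult_monom add_monom algebra_simps)
    qed (simp add: pd_add distrib_left)
  qed (simp add: pd_add distrib_right)
qed

text \<open>Row b of the new matrix is the sum of A^a x_ab(X) over a, so the rows are combined by
  the transpose of x. With this convention, shifting \<open>GA y\<close> along x produces
  \<open>GA (x ** y)\<close>, and \<open>TG\<close> respects brackets without a sign.\<close>

definition GA :: "'n glz \<Rightarrow> 'n::finite \<Rightarrow> 'N::finite \<Rightarrow> ('n, 'N) pol"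
  where "GA x b j = (\<Sum>a\<in>UNIV. rowp (x $ a $ b) a j)"

definition TG :: "'n glz \<Rightarrow> ('n::finite, 'N::finite) oper"
  where "TG x f = (\<Sum>b\<in>UNIV. \<Sum>j\<in>UNIV. GA x b j * deriv_var (AV b j) f)"

lemma TG_T: "TG x f = (\<Sum>a\<in>UNIV. \<Sum>b\<in>UNIV. \<Sum>m\<le>degree (x $ a $ b). smul (coeff (x $ a $ b) m) (T a m b f))"
proof -
  have "TG x f = (\<Sum>b\<in>UNIV. \<Sum>a\<in>UNIV. \<Sum>j\<in>UNIV. rowp (x $ a $ b) a j * deriv_var (AV b j) f)"
    unfolding TG_def GA_def by (subst (2) sum.swap) (simp add: sum_distrib_right)
  also have "\<dots> = (\<Sum>a\<in>UNIV. \<Sum>b\<in>UNIV. \<Sum>j\<in>UNIV. rowp (x $ a $ b) a j * deriv_var (AV b j) f)"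
    by (rule sum.swap)
  also have "\<dots> = (\<Sum>a\<in>UNIV. \<Sum>b\<in>UNIV. \<Sum>m\<le>degree (x $ a $ b). smul (coeff (x $ a $ b) m) (T a m b f))"
    unfolding rowp_def T_def smul_pc sum_distrib_left sum_distrib_right
    by (subst (3) sum.swap) (simp add: mult.assoc)
  finally show ?thesis .
qed

lemma stable_TG: "stable k W \<Longrightarrow> f \<in> W \<Longrightarrow> TG x f \<in> W"
  unfolding TG_T stable_def by (auto intro!: polv.subspace_sum polv.subspace_scale)

definition shiftA :: "'n glz \<Rightarrow> ('n::finite, 'N::finite) var \<Rightarrow> ('n, 'N) pol poly"
  where "shiftA x v = (case v of XV i j \<Rightarrow> [:pv (XV i j):] | AV b j \<Rightarrow> [:pv (AV b j), GA x b j:])"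

abbreviation shiftsub :: "'n glz \<Rightarrow> ('n::finite, 'N::finite) pol \<Rightarrow> ('n, 'N) pol poly"
  where "shiftsub x \<equiv> psub (\<lambda>c. [:pc c:]) (shiftA x)"

lemma sum_pCons_1: "(\<Sum>i\<in>I. [:f i:]) = [:\<Sum>i\<in>I. f i:]"
  by (induction I rule: infinite_finite_induct) simp_all

lemma sum_pCons_2: "(\<Sum>i\<in>I. [:f i, g i:]) = [:\<Sum>i\<in>I. f i, \<Sum>i\<in>I. g i:]"
  by (induction I rule: infinite_finite_induct) simp_all

lemma shiftsub_mpow: "shiftsub x (mpow XM m $ i $ j) = [:mpow XM m $ i $ j:]"
proof (induction m arbitrary: i)
  case (Suc m)
  then show ?case
    by (simp add: matrix_mul_component ppoly_hom.psub_sum ppoly_hom.psub_mult XM_def shiftA_def sum_pCons_1 mult.commute)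
qed (simp add: mat_def one_pCons)

lemma rowp_mult_monom: "rowp (p * monom 1 m) a j = (\<Sum>i\<in>UNIV. rowp p a i * mpow XM m $ i $ j)"
  by (induction p rule: poly_monom_induct)
    (simp_all add: mult_monom rowp_monom rho_add sum_distrib_left mult.assoc rowp_add distrib_right sum.distrib)

lemma shiftsub_rho:
  "shiftsub x (rho a m $ j) = [:rho a m $ j, \<Sum>c\<in>UNIV. rowp (x $ c $ a * monom 1 m) c j:]"
proof -
  have "shiftsub x (rho a m $ j) = (\<Sum>i\<in>UNIV. [:AM $ a $ i, GA x a i:] * [:mpow XM m $ i $ j:])"
    unfolding rho_def matrix_mul_component ppoly_hom.psub_sum ppoly_hom.psub_mult shiftsub_mpow
    by (simp add: AM_def shiftA_def)
  also have "\<dots> = (\<Sum>i\<in>UNIV. [:AM $ a $ i * mpow XM m $ i $ j, GA x a i * mpow XM m $ i $ j:])"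
    by (intro sum.cong) (simp_all add: mult.commute)
  also have "\<dots> = [:rho a m $ j, \<Sum>i\<in>UNIV. GA x a i * mpow XM m $ i $ j:]"
    unfolding sum_pCons_2 by (simp add: rho_def matrix_mul_component)
  also have "(\<Sum>i\<in>UNIV. GA x a i * mpow XM m $ i $ j) = (\<Sum>c\<in>UNIV. rowp (x $ c $ a * monom 1 m) c j)"
    unfolding GA_def rowp_mult_monom sum_distrib_right by (rule sum.swap)
  finally show ?thesis .
qed

lemma shiftsub_rowp: "shiftsub x (rowp p a j) = [:rowp p a j, \<Sum>c\<in>UNIV. rowp (x $ c $ a * p) c j:]"
proof (induction p rule: poly_monom_induct)
  case (1 c m)
  have "rowp (x $ d $ a * monom c m) d j = pc c * rowp (x $ d $ a * monom 1 m) d j" for d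
    by (simp add: rowp_smult[symmetric] smult_monom flip: mult_smult_right)
  then show ?case
    by (simp add: rowp_monom ppoly_hom.psub_mult shiftsub_rho sum_distrib_left mult.commute)
qed (simp add: rowp_add ppoly_hom.psub_add distrib_left sum.distrib)

lemma shiftsub_GA: "shiftsub x (GA y b j) = [:GA y b j, GA (x ** y) b j:]"
  unfolding GA_def[of y] ppoly_hom.psub_sum shiftsub_rowp sum_pCons_2
  by (simp add: GA_def matrix_mul_component rowp_sum) (rule sum.swap)

text \<open>
  \<open>W\<close> is stable under all substitutions \<open>A \<mapsto> A + tGA\<close>: with \<open>E\<^sub>i\<close> the derivative of \<open>f\<close> at \<open>(1 + tG)A\<close> in the
  direction \<open>G\<^sup>iA\<close>, the \<open>t\<close>-derivative of the substituted polynomial is \<open>E\<^sub>1\<close>, and substituting into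
  \<open>TG (G\<^sup>i) f\<close> gives \<open>E\<^sub>i + t E\<^bsub>i+1\<^esub>\<close>; so the coefficients are obtained recursively.
\<close>

lemma stable_coeff_shiftsub:
  assumes W: "stable k W"
  shows "f \<in> W \<Longrightarrow> coeff (shiftsub x f) r \<in> W"
proof -
  define E where "E i f = (\<Sum>b\<in>UNIV. \<Sum>j\<in>UNIV. [:GA (mpow x i) b j:] * shiftsub x (deriv_var (AV b j) f))" for i and f :: "('a, 'b) pol"
  have sub: "polv.subspace W" using W by (simp add: stable_def)
  have 1: "pd (shiftsub x f) = E 1 f" for f :: "('a, 'b) pol"
    by (subst pd.chain_rule[OF coeff_hom_ppoly])
      (simp_all add: sum_var E_def shiftA_def)
  have 2: "shiftsub x (TG (mpow x i) f) = E i f + pCons 0 (E (Suc i) f)" for i and f :: "('a, 'b) pol"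
  proof -
    have *: "[:c, d:] * p = [:c:] * p + pCons 0 ([:d:] * p)" for c d :: "('a, 'b) pol" and p
      by simp
    have **: "pCons 0 (\<Sum>i\<in>I. p i) = (\<Sum>i\<in>I. pCons 0 (p i))" for I and p :: "'c \<Rightarrow> ('a, 'b) pol poly"
      by (induction I rule: infinite_finite_induct) (simp_all, metis add_pCons add.right_neutral)
    show ?thesis
      unfolding TG_def ppoly_hom.psub_sum ppoly_hom.psub_mult shiftsub_GA E_def ** 
      by (subst *) (simp only: sum.distrib mpow.simps)
  qed
  have "(\<forall>f\<in>W. coeff (shiftsub x f) r \<in> W) \<and> (\<forall>i. \<forall>f\<in>W. coeff (E i f) r \<in> W)"
  proof (induction r)
    case 0
    have A: "coeff (shiftsub x f) 0 = f" for f :: "('a, 'b) pol"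
    proof -
      have "poly (shiftsub x f) 0 = psub pc pv f"
        by (subst psub_compose[where \<phi> = "\<lambda>p. poly p 0", OF coeff_hom_ppoly coeff_hom_pc])
          (auto simp: shiftA_def intro!: arg_cong[where f = "\<lambda>s. psub pc s f"] split: var.split)
      then show ?thesis by (simp add: psub_pv_id poly_0_coeff_0)
    qed
    have "coeff (E i f) 0 \<in> W" if "f \<in> W" for i f
      using arg_cong[OF 2[of i f], of "\<lambda>p. coeff p 0"] stable_TG[OF W that, of "mpow x i"]
      by (simp add: A)
    then show ?case by (simp add: A)
  next
    case (Suc r)
    have A: "coeff (shiftsub x f) (Suc r) \<in> W" if "f \<in> W" for f
    proof -
      have "coeff (E 1 f) r = of_nat (Suc r) * coeff (shiftsub x f) (Suc r)"
        using arg_cong[OF 1[of f], of "\<lambda>p. coeff p r"] by (simp add: coeff_pd)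
      also have "\<dots> = smul (of_nat (Suc r)) (coeff (shiftsub x f) (Suc r))"
        by (simp add: smul_pc pc_def del: of_nat_Suc)
      finally have "coeff (shiftsub x f) (Suc r) = smul (1 / of_nat (Suc r)) (coeff (E 1 f) r)"
        by (simp del: of_nat_Suc)
      then show ?thesis using Suc that sub by (auto intro: polv.subspace_scale)
    qed
    have "coeff (E i f) (Suc r) \<in> W" if "f \<in> W" for i f
    proof -
      have "coeff (E i f) (Suc r) = coeff (shiftsub x (TG (mpow x i) f)) (Suc r) - coeff (E (Suc i) f) r"
        by (simp add: 2)
      then show ?thesis
        using A[OF stable_TG[OF W that]] Suc that sub by (auto intro: polv.subspace_diff)
    qed
    with A show ?case by auto
  qed
  then show "f \<in> W \<Longrightarrow> coeff (shiftsub x f) r \<in> W" by auto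
qed

text \<open>The polynomial \<open>f(X, GA)\<close> for a matrix polynomial \<open>G\<close>, not necessarily invertible.\<close>

definition subG :: "'n glz \<Rightarrow> ('n::finite, 'N::finite) pol \<Rightarrow> ('n, 'N) pol"
  where "subG y = psub pc (\<lambda>v. case v of XV i j \<Rightarrow> pv (XV i j) | AV b j \<Rightarrow> GA y b j)"

text \<open>For x = y - 1 the substitution is the value at t = 1 of the polynomial
  \<open>shiftsub x f\<close>, that is the sum of its coefficients, each of which lies in
  \<open>W\<close>.\<close>

lemma stable_subG:
  assumes W: "stable k W" and f: "f \<in> W"
  shows "subG y f \<in> W"
proof -
  have sub: "polv.subspace W" using W by (simp add: stable_def)
  let ?x = "y - mat 1"
  have GA: "GA ?x b j = GA y b j - pv (AV b j)" for b j
  proof -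
    have "rowp (?x $ a $ b) a j = rowp (y $ a $ b) a j - (if a = b then pv (AV b j) else 0)" for a
      using rowp_add[of "y $ a $ b" "- (mat 1 $ a $ b)" a j] by (simp add: rowp_minus mat_def)
    then show ?thesis by (simp add: GA_def sum_subtractf)
  qed
  have "subG y f = poly (shiftsub ?x f) 1"
    unfolding subG_def
    by (subst psub_compose[where \<phi> = "\<lambda>p. poly p 1", OF coeff_hom_ppoly coeff_hom_pc])
      (auto simp: shiftA_def GA intro!: arg_cong[where f = "\<lambda>s. psub pc s f"] split: var.split)
  also have "\<dots> = (\<Sum>r\<le>degree (shiftsub ?x f). coeff (shiftsub ?x f) r)"
    by (simp add: poly_altdef)
  also have "\<dots> \<in> W"
    by (intro polv.subspace_sum sub stable_coeff_shiftsub[OF W f])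
  finally show ?thesis .
qed

lemma eval_subG: "eval_pol (subG y f) X A = eval_pol f X (\<chi> b j. eval_pol (GA y b j) X A)"
proof -
  have "(\<lambda>v. psub (\<lambda>c. c) (pt X A) (case v of XV i j \<Rightarrow> pv (XV i j) | AV b j \<Rightarrow> GA y b j))
      = pt X (\<chi> b j. eval_pol (GA y b j) X A)"
    by (rule ext) (simp add: pt_def eval_pol_psub split: var.split)
  then show ?thesis
    unfolding subG_def eval_pol_psub
    by (subst psub_compose[where \<phi> = "psub (\<lambda>c. c) (pt X A)", OF coeff_hom_pc coeff_hom_id])
      (simp_all add: id_hom.psub_add id_hom.psub_mult eval_pol_psub)
qed

lemma stable_trX:
  assumes "stable k W" "k > 0" "f \<in> W"
  shows "trX m * f \<in> W"
proof -
  have sub: "polv.subspace W" and "W \<subseteq> HN k" using assms by (auto simp: stable_def)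
  then have "smul (of_nat k) (trX m * f) \<in> W"
    using assms by (subst HN_trX[symmetric]) (auto simp: stable_def intro!: polv.subspace_sum)
  then have "smul (1 / of_nat k) (smul (of_nat k) (trX m * f)) \<in> W"
    using sub by (rule polv.subspace_scale[rotated])
  then show ?thesis using \<open>k > 0\<close> by simp
qed

section \<open>Newton's identities and the Cayley--Hamilton theorem\<close>

lemma det_row_expand:
  fixes M :: "'r::comm_ring_1^'n^'n"
  shows "det (\<chi> r. if r = j then w else M $ r)
    = (\<Sum>i\<in>UNIV. w $ i * det (\<chi> r. if r = j then axis i 1 else M $ r))"
proof -
  have "w = (\<Sum>i\<in>UNIV. w $ i *s axis i 1)"
    by (simp add: vec_eq_iff axis_def if_distrib cong: if_cong)
  then have "det (\<chi> r. if r = j then w else M $ r)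
      = det (\<chi> r. if r = j then (\<Sum>i\<in>UNIV. w $ i *s axis i 1) else M $ r)"
    by (rule arg_cong[where f = "\<lambda>w. det (\<chi> r. if r = j then w else M $ r)"])
  also have "\<dots> = (\<Sum>i\<in>UNIV. det (\<chi> r. if r = j then w $ i *s axis i 1 else M $ r))"
    by (rule det_linear_row_sum) simp
  also have "\<dots> = (\<Sum>i\<in>UNIV. w $ i * det (\<chi> r. if r = j then axis i 1 else M $ r))"
    by (intro sum.cong refl det_row_mul)
  finally show ?thesis .
qed

lemma degree_det_le:
  fixes M :: "'r::comm_ring_1 poly^'n^'n"
  assumes "\<And>i j. degree (M $ i $ j) \<le> e i"
  shows "degree (det M) \<le> (\<Sum>i\<in>UNIV. e i)"
  unfolding det_def
proof (rule degree_sum_le)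
  fix p :: "'n \<Rightarrow> 'n"
  have "degree (\<Prod>i\<in>S. M $ i $ p i) \<le> (\<Sum>i\<in>S. e i)" if "finite S" for S
    using that
  proof (induction S)
    case (insert i S)
    then show ?case using assms[of i "p i"] degree_mult_le[of "M $ i $ p i" "\<Prod>i\<in>S. M $ i $ p i"] by simp
  qed simp
  then have "degree (\<Prod>i\<in>UNIV. M $ i $ p i) \<le> (\<Sum>i\<in>UNIV. e i)" by simp
  moreover have "degree (of_int (sign p) * q) \<le> degree q" for q :: "'r poly"
    by (metis degree_of_int add.left_neutral degree_mult_le)
  ultimately show "degree (of_int (sign p) * (\<Prod>i\<in>UNIV. M $ i $ p i)) \<le> (\<Sum>i\<in>UNIV. e i)"
    using le_trans by blast
qed (simp add: finite_permutations)

text \<open>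
  For \<open>M = 1 - tX\<close> and its adjugate \<open>B\<close>, comparing coefficients in \<open>MB = det M\<close> gives
  \<open>B\<^sub>m = \<Sum>\<^bsub>l\<le>m\<^esub> d\<^sub>l X\<^bsup>m-l\<^esup>\<close>; the degree bound for \<open>B\<close> yields Cayley--Hamilton and
  \<open>(det M)' = - tr (XB)\<close> yields Newton's identities.
\<close>

lemma newton_cayley_hamilton:
  fixes X :: "'r::comm_ring_1^'n^'n"
  obtains d :: "nat \<Rightarrow> 'r" where "d 0 = 1"
    and "\<And>i j. (\<Sum>l\<le>CARD('n). d l * mpow X (CARD('n) - l) $ i $ j) = 0"
    and "\<And>m. of_nat (Suc m) * d (Suc m) = - (\<Sum>l\<le>m. d l * trace (mpow X (Suc m - l)))"
proof
  define M :: "'r poly^'n^'n" where "M = (\<chi> i j. [:mat 1 $ i $ j, - X $ i $ j:])"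
  define B :: "'r poly^'n^'n" where "B = (\<chi> i j. det (\<chi> r. if r = j then axis i 1 else M $ r))"
  define d where "d m = coeff (det M) m" for m
  have MB: "(\<Sum>i\<in>UNIV. M $ p $ i * B $ i $ j) = (if p = j then det M else 0)" for p j
  proof -
    have "(\<Sum>i\<in>UNIV. M $ p $ i * B $ i $ j) = det (\<chi> r. if r = j then M $ p else M $ r)"
      unfolding B_def by (subst det_row_expand) simp
    also have "\<dots> = (if p = j then det M else 0)"
    proof (cases "p = j")
      case True
      then show ?thesis by (auto intro!: arg_cong[where f = det] simp: vec_eq_iff)
    next
      case False
      have "det (\<chi> r. if r = j then M $ p else M $ r) = 0"
        by (rule det_identical_rows[OF False]) (use False in \<open>auto simp: row_def vec_eq_iff\<close>)
      with False show ?thesis by simp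
    qed
    finally show ?thesis .
  qed
  have Bm: "coeff (B $ i $ j) m = (\<Sum>l\<le>m. d l * mpow X (m - l) $ i $ j)" for i j m
  proof (induction m arbitrary: i j)
    case 0
    have "coeff (\<Sum>l\<in>UNIV. M $ i $ l * B $ l $ j) 0 = coeff (B $ i $ j) 0"
      by (simp add: coeff_sum M_def mat_def if_distrib[of "\<lambda>x. x * _"] coeff_mult cong: if_cong)
    then show ?case unfolding MB by (cases "i = j") (simp_all add: d_def mat_def)
  next
    case (Suc m)
    have "coeff ([:a, b:] * p) (Suc m) = a * coeff p (Suc m) + b * coeff p m" for a b :: 'r and p
      by simp
    then have "coeff (\<Sum>l\<in>UNIV. M $ i $ l * B $ l $ j) (Suc m)
        = coeff (B $ i $ j) (Suc m) - (\<Sum>l\<in>UNIV. X $ i $ l * coeff (B $ l $ j) m)"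
      by (simp add: coeff_sum M_def mat_def if_distrib[of "\<lambda>x. x * _"] sum_subtractf sum_negf cong: if_cong)
    then have "coeff (B $ i $ j) (Suc m) = (if i = j then d (Suc m) else 0) + (\<Sum>l\<in>UNIV. X $ i $ l * coeff (B $ l $ j) m)"
      unfolding MB by (cases "i = j") (simp_all add: d_def)
    also have "(\<Sum>l\<in>UNIV. X $ i $ l * coeff (B $ l $ j) m) = (\<Sum>l\<le>m. d l * mpow X (Suc m - l) $ i $ j)"
    proof -
      have "mpow X (Suc m - l) $ i $ j = (\<Sum>l'\<in>UNIV. X $ i $ l' * mpow X (m - l) $ l' $ j)" if "l \<le> m" for l
        using that by (simp add: Suc_diff_le matrix_mul_component)
      then have "(\<Sum>l\<le>m. d l * mpow X (Suc m - l) $ i $ j)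
          = (\<Sum>l\<le>m. \<Sum>l'\<in>UNIV. X $ i $ l' * (d l * mpow X (m - l) $ l' $ j))"
        by (intro sum.cong) (simp_all add: sum_distrib_left mult_ac)
      then show ?thesis
        unfolding Suc.IH sum_distrib_left by (subst sum.swap) simp
    qed
    finally show ?case by (simp add: mat_def)
  qed
  show "d 0 = 1"
  proof -
    have "poly (det M) 0 = det (\<chi> i j. poly (M $ i $ j) 0)"
      by (simp add: det_def poly_sum poly_prod)
    also have "(\<chi> i j. poly (M $ i $ j) 0) = mat 1"
      by (simp add: M_def vec_eq_iff)
    finally show ?thesis by (simp add: d_def poly_0_coeff_0)
  qed
  show "(\<Sum>l\<le>CARD('n). d l * mpow X (CARD('n) - l) $ i $ j) = 0" for i j
  proof -
    \<comment> \<open>Row j of the matrix defining \<open>B $ i $ j\<close> is a constant unit row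
      and the other rows have degree at most 1, so the degree stays below the size of the
      matrix.\<close>
    have "degree (B $ i $ j) \<le> (\<Sum>r\<in>UNIV. if r = j then 0 else 1)"
      unfolding B_def by (simp, rule degree_det_le) (auto simp: M_def axis_def)
    also have "(\<Sum>r\<in>UNIV. if r = j then 0 else 1) = (\<Sum>r\<in>UNIV - {j}. 1)"
      by (rule sum.mono_neutral_cong_right) auto
    also have "\<dots> = card (UNIV - {j})" by simp
    also have "\<dots> < CARD('n)" by (rule psubset_card_mono) auto
    finally have "coeff (B $ i $ j) CARD('n) = 0" by (rule coeff_eq_0)
    then show ?thesis by (simp add: Bm)
  qed
  show "of_nat (Suc m) * d (Suc m) = - (\<Sum>l\<le>m. d l * trace (mpow X (Suc m - l)))" for m
  proof -
    have "pd (det M) = (\<Sum>x\<in>UNIV. det (\<chi> r. if r = x then (\<chi> j. [:- X $ x $ j:]) else M $ r))"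
      unfolding pd.D_det
      by (intro sum.cong refl arg_cong[where f = det]) (auto simp: vec_eq_iff M_def)
    also have "\<dots> = (\<Sum>x\<in>UNIV. \<Sum>i\<in>UNIV. [:- X $ x $ i:] * B $ i $ x)"
      unfolding B_def by (subst det_row_expand) simp
    finally have "coeff (pd (det M)) m = - (\<Sum>x\<in>UNIV. \<Sum>i\<in>UNIV. X $ x $ i * coeff (B $ i $ x) m)"
      by (simp add: coeff_sum sum_negf)
    also have "(\<Sum>x\<in>UNIV. \<Sum>i\<in>UNIV. X $ x $ i * coeff (B $ i $ x) m)
        = (\<Sum>x\<in>UNIV. \<Sum>l\<le>m. d l * (\<Sum>i\<in>UNIV. X $ x $ i * mpow X (m - l) $ i $ x))"
      unfolding Bm sum_distrib_left by (subst (2) sum.swap) (simp add: mult_ac)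
    also have "\<dots> = (\<Sum>l\<le>m. d l * trace (mpow X (Suc m - l)))"
      unfolding trace_def sum_distrib_left
      by (subst sum.swap, intro sum.cong refl) (simp add: Suc_diff_le matrix_mul_component sum_distrib_left)
    finally show ?thesis by (simp add: coeff_pd d_def del: of_nat_Suc)
  qed
qed

section \<open>Krylov determinants\<close>

text \<open>A fixed enumeration from 0: the index types carry no order, but Krylov rows have to be
  ordered and divided into residue classes.\<close>

definition ix :: "'a::finite \<Rightarrow> nat" where "ix = (SOME f. bij_betw f UNIV {..<CARD('a)})"

lemma bij_ix: "bij_betw (ix :: 'a::finite \<Rightarrow> nat) UNIV {..<CARD('a)}"
proof -
  have "\<exists>f :: 'a \<Rightarrow> nat. bij_betw f UNIV {..<CARD('a)}"
    using ex_bij_betw_finite_nat[OF finite_class.finite_UNIV] unfolding atLeast0LessThan .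
  then show ?thesis unfolding ix_def by (rule someI_ex)
qed

lemma inj_ix: "inj ix"
  using bij_ix by (rule bij_betw_imp_inj_on)

lemma ix_eq [simp]: "ix x = ix y \<longleftrightarrow> x = y"
  using inj_ix by (auto simp: inj_def)

lemma ix_less [simp]: "ix (x :: 'a::finite) < CARD('a)"
  using bij_betwE[OF bij_ix] by blast

lemma ex_ix: "u < CARD('a) \<Longrightarrow> \<exists>x :: 'a::finite. ix x = u"
  using bij_ix unfolding bij_betw_def by (metis imageE lessThan_iff)

definition KD :: "('N \<Rightarrow> 'n \<times> nat) \<Rightarrow> ('n::finite, 'N::finite) pol"
  where "KD \<tau> = det (\<chi> i. rho (fst (\<tau> i)) (snd (\<tau> i)))"

definition KM :: "('N \<Rightarrow> 'n \<times> nat) \<Rightarrow> complex^'N^'N \<Rightarrow> complex^'N^'n::finite \<Rightarrow> complex^'N::finite^'N"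
  where "KM \<tau> X A = (\<chi> i. (A ** mpow X (snd (\<tau> i))) $ fst (\<tau> i))"

lemma eval_KD: "eval_pol (KD \<tau>) X A = det (KM \<tau> X A)"
  by (auto simp: KD_def KM_def eval_det vec_eq_iff intro!: arg_cong[where f = det])

text \<open>Label the coordinates by \<open>\<tau>\<close>. Let A^a be the unit row labelled (a, 0),
  or 0 if there is none, and let X send the unit row (a, j) to (a, j + 1). Since the labels are
  closed downwards, A^a X^m reaches every unit row with label (a, m).\<close>

lemma KM_eq_1:
  fixes \<tau> :: "'N::finite \<Rightarrow> 'n::finite \<times> nat"
  assumes "inj \<tau>" and down: "\<And>a j. (a, Suc j) \<in> range \<tau> \<Longrightarrow> (a, j) \<in> range \<tau>"
  shows "\<exists>X A. KM \<tau> X A = mat 1"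
proof -
  define A :: "complex^'N^'n" where "A = (\<chi> a i. if \<tau> i = (a, 0) then 1 else 0)"
  define X :: "complex^'N^'N" where "X = (\<chi> l i. if \<tau> i = (fst (\<tau> l), Suc (snd (\<tau> l))) then 1 else 0)"
  have *: "(A ** mpow X m) $ a $ i = (if \<tau> i = (a, m) then 1 else 0)" for a m i
  proof (induction m arbitrary: i)
    case (Suc m)
    have "A ** mpow X (Suc m) = A ** mpow X m ** X"
      using mpow_add[of X m 1] by (simp add: matrix_mul_assoc del: mpow.simps)
    then have "(A ** mpow X (Suc m)) $ a $ i = (\<Sum>l\<in>UNIV. if \<tau> l = (a, m) \<and> \<tau> i = (a, Suc m) then 1 else 0)"
      by (simp only: matrix_mul_component[of "A ** mpow X m" X] Suc.IH)
        (auto simp: X_def intro!: sum.cong)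
    also have "\<dots> = (if \<tau> i = (a, Suc m) then 1 else 0)"
    proof (cases "\<tau> i = (a, Suc m)")
      case True
      then obtain l where l: "\<tau> l = (a, m)" using down[of a m] by (metis rangeE rangeI)
      have "(\<Sum>l'\<in>UNIV. if \<tau> l' = (a, m) \<and> \<tau> i = (a, Suc m) then 1 else 0) = (\<Sum>l'\<in>UNIV. if l' = l then 1 else (0::complex))"
        using True l \<open>inj \<tau>\<close> by (intro sum.cong) (auto simp: inj_def)
      then show ?thesis using True by simp
    qed simp
    finally show ?case .
  qed (simp add: A_def)
  have "KM \<tau> X A = mat 1"
    using \<open>inj \<tau>\<close> by (auto simp: KM_def vec_eq_iff * mat_def inj_def)
  then show ?thesis by blast
qed

lemma KD_nonzero:
  fixes \<tau> :: "'N::finite \<Rightarrow> 'n::finite \<times> nat"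
  assumes "inj \<tau>" "\<And>a j. (a, Suc j) \<in> range \<tau> \<Longrightarrow> (a, j) \<in> range \<tau>"
  shows "KD \<tau> \<noteq> 0"
  using KM_eq_1[OF assms] eval_KD[of \<tau>] by (metis det_I eval_0 zero_neq_one)

section \<open>Two nonzero stable subspaces meet\<close>

definition row1 :: "'n \<Rightarrow> 'N::finite \<Rightarrow> 'n::finite \<times> nat"
  where "row1 a i = (a, ix i)"

lemma KD_row1_nonzero: "KD (row1 a :: 'N::finite \<Rightarrow> 'n::finite \<times> nat) \<noteq> 0"
proof (rule KD_nonzero)
  show "inj (row1 a :: 'N \<Rightarrow> 'n \<times> nat)" by (auto simp: inj_def row1_def)
  fix b j assume "(b, Suc j) \<in> range (row1 a :: 'N \<Rightarrow> 'n \<times> nat)"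
  then obtain i :: 'N where "b = a" "Suc j = ix i" by (auto simp: row1_def)
  then show "(b, j) \<in> range (row1 a :: 'N \<Rightarrow> 'n \<times> nat)"
    using ex_ix[of j, where 'a = 'N] ix_less[of i] by (auto simp: row1_def image_iff)
qed

lemma KM_row1: "KM (row1 a) X A $ i $ j = (A ** mpow X (ix i)) $ a $ j"
  by (simp add: KM_def row1_def)

definition only_row :: "'n::finite \<Rightarrow> ('n, 'N::finite) pol \<Rightarrow> bool"
  where "only_row a f \<longleftrightarrow> (\<forall>X A A'. A $ a = A' $ a \<longrightarrow> eval_pol f X A = eval_pol f X A')"

lemma mult_row_cong: "A $ a = A' $ a \<Longrightarrow> (A ** M) $ a $ j = (A' ** M) $ a $ j"
  by (simp add: matrix_mul_component)

text \<open>Choose a point where f is nonzero and A^a, A^a X, ..., A^a X^(N-1) are independent.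
  There each row A^b equals A^a p_b(X) with constant coefficients in p_b. Substituting A^a p_b(X)
  for A^b leaves the value at this point unchanged, and the result involves no other row of
  A.\<close>

lemma stable_only_row:
  fixes f :: "('n::finite, 'N::finite) pol"
  assumes W: "stable k W" and f: "f \<in> W" "f \<noteq> 0"
  shows "\<exists>h\<in>W. h \<noteq> 0 \<and> only_row a h"
proof -
  obtain X A where XA: "eval_pol (f * KD (row1 a)) X A \<noteq> 0"
    using pol_nonzeroE[OF pol_mult_nonzero[OF f(2) KD_row1_nonzero[of a]]] by blast
  let ?Q = "KM (row1 a) X A"
  have "invertible ?Q" using XA by (simp add: eval_mult eval_KD invertible_det_nz)
  note inv = matrix_inv_works[OF this]
  let ?q = "A ** matrix_inv ?Q"
  define y :: "'n glz" where "y = (\<chi> c b. if c = a then (\<Sum>i\<in>UNIV. monom (?q $ b $ i) (ix i)) else 0)"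
  have GA: "GA y b j = (\<Sum>i\<in>UNIV. pc (?q $ b $ i) * rho a (ix i) $ j)" for b and j :: 'N
  proof -
    have "GA y b j = (\<Sum>c\<in>UNIV. if c = a then rowp (\<Sum>i\<in>UNIV. monom (?q $ b $ i) (ix i)) a j else 0)"
      unfolding GA_def y_def by (intro sum.cong) auto
    then show ?thesis by (simp add: rowp_sum rowp_monom)
  qed
  have "eval_pol (GA y b j) X A = (?q ** ?Q) $ b $ j" for b j
    by (simp add: GA eval_sum eval_mult eval_pc KM_row1 matrix_mul_component[of ?q ?Q])
  moreover have "?q ** ?Q = A"
    by (simp add: inv flip: matrix_mul_assoc)
  ultimately have "(\<chi> b j. eval_pol (GA y b j) X A) = A" by (simp add: vec_eq_iff)
  then have "eval_pol (subG y f) X A = eval_pol f X A" by (simp add: eval_subG)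
  then have "subG y f \<noteq> 0" using XA by (auto simp: eval_mult)
  moreover have "only_row a (subG y f)"
    unfolding only_row_def eval_subG
  proof (intro allI impI)
    fix X and A A' :: "complex^'N^'n" assume "A $ a = A' $ a"
    then have "eval_pol (GA y b j) X A = eval_pol (GA y b j) X A'" for b j
      by (simp add: GA eval_sum eval_mult eval_pc mult_row_cong[of A a A'])
    then show "eval_pol f X (\<chi> b j. eval_pol (GA y b j) X A) = eval_pol f X (\<chi> b j. eval_pol (GA y b j) X A')"
      by simp
  qed
  ultimately show ?thesis using stable_subG[OF W f(1)] by blast
qed

text \<open>The coefficients of det(1 - tX) as a polynomial in t; the initial value and Newton's
  identities determine them.\<close>

definition chp :: "nat \<Rightarrow> ('n::finite, 'N::finite) pol"
  where "chp = (SOME d. d 0 = 1 \<and> (\<forall>i j. (\<Sum>l\<le>CARD('N). d l * mpow XM (CARD('N) - l) $ i $ j) = 0) \<and>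
     (\<forall>m. of_nat (Suc m) * d (Suc m) = - (\<Sum>l\<le>m. d l * trX (Suc m - l))))"

lemma chp:
  "chp 0 = (1 :: ('n::finite, 'N::finite) pol)"
  "(\<Sum>l\<le>CARD('N). chp l * (mpow XM (CARD('N) - l) $ i $ j :: ('n, 'N) pol)) = 0"
  "of_nat (Suc m) * chp (Suc m) = - (\<Sum>l\<le>m. chp l * (trX (Suc m - l) :: ('n, 'N) pol))"
proof -
  let ?P = "\<lambda>d :: nat \<Rightarrow> ('n, 'N) pol. d 0 = 1 \<and> (\<forall>i j. (\<Sum>l\<le>CARD('N). d l * mpow XM (CARD('N) - l) $ i $ j) = 0) \<and>
     (\<forall>m. of_nat (Suc m) * d (Suc m) = - (\<Sum>l\<le>m. d l * trX (Suc m - l)))"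
  have "\<exists>d. ?P d"
    by (rule newton_cayley_hamilton[of "XM :: ('n, 'N) pol^'N^'N"], rule exI)
      (unfold trX_def, intro conjI allI, assumption+)
  then have "?P chp" unfolding chp_def by (rule someI_ex)
  then show "chp 0 = (1 :: ('n, 'N) pol)"
    "(\<Sum>l\<le>CARD('N). chp l * (mpow XM (CARD('N) - l) $ i $ j :: ('n, 'N) pol)) = 0"
    "of_nat (Suc m) * chp (Suc m) = - (\<Sum>l\<le>m. chp l * (trX (Suc m - l) :: ('n, 'N) pol))"
    by blast+
qed

text \<open>Newton's identities express \<open>chp m\<close> by traces and earlier coefficients
  after division by m. The induction lets \<open>f\<close> vary because the trace factor is absorbed
  into it.\<close>

lemma stable_chp:
  assumes W: "stable k W" and k: "k > 0"
  shows "f \<in> W \<Longrightarrow> chp m * f \<in> W"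
proof (induction m arbitrary: f rule: less_induct)
  case (less m)
  have sub: "polv.subspace W" using W by (simp add: stable_def)
  show ?case
  proof (cases m)
    case 0
    then show ?thesis using less by (simp add: chp)
  next
    case (Suc l)
    have "smul (of_nat (Suc l)) (chp (Suc l) * f) = (of_nat (Suc l) * chp (Suc l)) * f"
      by (simp add: smul_pc pc_def del: of_nat_Suc)
    also have "\<dots> = - (\<Sum>i\<le>l. chp i * (trX (Suc l - i) * f))"
      unfolding chp(3) by (simp add: sum_distrib_right mult.assoc)
    also have "\<dots> \<in> W"
      using less Suc by (intro polv.subspace_neg polv.subspace_sum sub less.IH stable_trX[OF W k]) auto
    finally have "smul (1 / of_nat (Suc l)) (smul (of_nat (Suc l)) (chp (Suc l) * f)) \<in> W"
      by (rule polv.subspace_scale[OF sub])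
    then show ?thesis using Suc by (simp del: of_nat_Suc)
  qed
qed

text \<open>
  For the matrix \<open>Q\<close> of the rows \<open>A\<^sup>aX\<^sup>i\<close>, \<open>i < N\<close>, the conjugate \<open>QXQ\<^sup>-\<^sup>1\<close> is the companion matrix
  \<open>cmp\<close> and \<open>A\<^sup>aQ\<^sup>-\<^sup>1\<close> is the first unit row, which \<open>normsub\<close> substitutes.
\<close>

definition cmp :: "('n::finite, 'N::finite) pol^'N^'N"
  where "cmp = (\<chi> i j. if Suc (ix i) < CARD('N) then (if ix j = Suc (ix i) then 1 else 0)
    else - chp (CARD('N) - ix j))"

definition normsub :: "'n \<Rightarrow> ('n::finite, 'N::finite) var \<Rightarrow> ('n, 'N) pol"
  where "normsub a v = (case v of XV i j \<Rightarrow> cmp $ i $ j | AV b j \<Rightarrow> if b = a \<and> ix j = 0 then 1 else 0)"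

text \<open>Right multiplication by X moves each Krylov row to the next one; only the last row
  requires the Cayley-Hamilton theorem, which gives the last row of the companion matrix.\<close>

lemma KM_row1_mult:
  fixes X :: "complex^'N^'N::finite" and A :: "complex^'N^'n::finite" and a
  defines "Q \<equiv> KM (row1 a) X A"
  shows "Q ** X = (\<chi> i j. eval_pol (cmp $ i $ j) X A) ** Q"
proof -
  let ?N = "CARD('N)"
  have QX: "(Q ** X) $ i $ j = (A ** mpow X (Suc (ix i))) $ a $ j" for i j
  proof -
    have "(Q ** X) $ i $ j = (A ** mpow X (ix i) ** X) $ a $ j"
      by (simp add: Q_def KM_row1 matrix_mul_component[of _ X])
    also have "A ** mpow X (ix i) ** X = A ** mpow X (Suc (ix i))"
      using mpow_add[of X "ix i" 1] by (simp add: matrix_mul_assoc del: mpow.simps)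
    finally show ?thesis .
  qed
  have Q: "Q $ l $ j = (A ** mpow X (ix l)) $ a $ j" for l j
    by (simp add: Q_def KM_row1)
  have CH: "(A ** mpow X ?N) $ a $ j = (\<Sum>l<?N. - eval_pol (chp (?N - l)) X A * (A ** mpow X l) $ a $ j)" for j
  proof -
    have *: "(\<Sum>l\<le>?N. eval_pol (chp l) X A * mpow X (?N - l) $ i $ j) = 0" for i
      using arg_cong[OF chp(2)[of i j], of "\<lambda>p. eval_pol p X A"] by (simp add: eval_sum eval_mult)
    have "mpow X ?N $ i $ j = (\<Sum>l<?N. - eval_pol (chp (?N - l)) X A * mpow X l $ i $ j)" for i
    proof -
      have "(\<Sum>l\<le>?N. eval_pol (chp l) X A * mpow X (?N - l) $ i $ j)
          = (\<Sum>l\<le>?N. eval_pol (chp (?N - l)) X A * mpow X l $ i $ j)"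
        by (rule sum.reindex_bij_witness[of _ "\<lambda>l. ?N - l" "\<lambda>l. ?N - l"]) auto
      also have "\<dots> = (\<Sum>l<?N. eval_pol (chp (?N - l)) X A * mpow X l $ i $ j) + mpow X ?N $ i $ j"
        by (simp add: chp(1) flip: lessThan_Suc_atMost del: mpow.simps)
      finally show ?thesis using * by (simp add: sum_negf eq_neg_iff_add_eq_0 add.commute)
    qed
    then show ?thesis
      by (simp add: matrix_mul_component sum_distrib_left mult_ac sum_negf sum.swap[of _ "{..<?N}"])
  qed
  have "(Q ** X) $ i $ j = ((\<chi> i j. eval_pol (cmp $ i $ j) X A) ** Q) $ i $ j" for i j
  proof (cases "Suc (ix i) < ?N")
    case True
    then obtain l :: 'N where l: "ix l = Suc (ix i)" using ex_ix by blast
    have "((\<chi> i j. eval_pol (cmp $ i $ j) X A) ** Q) $ i $ j = (\<Sum>l'\<in>UNIV. if l' = l then Q $ l' $ j else 0)"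
      unfolding matrix_mul_component using True by (intro sum.cong) (auto simp: cmp_def simp flip: l)
    then show ?thesis by (simp add: QX Q l)
  next
    case False
    then have N: "Suc (ix i) = ?N" using ix_less[of i] by linarith
    have "((\<chi> i j. eval_pol (cmp $ i $ j) X A) ** Q) $ i $ j
        = (\<Sum>l\<in>(UNIV :: 'N set). - eval_pol (chp (?N - ix l)) X A * (A ** mpow X (ix l)) $ a $ j)"
      using False by (simp add: matrix_mul_component[of _ Q] cmp_def Q eval_pol_psub id_hom.psub_uminus)
    also have "\<dots> = (\<Sum>l<?N. - eval_pol (chp (?N - l)) X A * (A ** mpow X l) $ a $ j)"
      by (rule sum.reindex_bij_betw[OF bij_ix])
    finally show ?thesis by (simp only: QX N CH)
  qed
  then show ?thesis by (simp add: vec_eq_iff)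
qed

text \<open>Use the Krylov matrix Q of A^a as group element. The other rows of A may be set to zero;
  then X becomes the companion matrix, A^a becomes the first unit row, and the factor of the group
  action is the k-th power of the Krylov determinant.\<close>

lemma only_row_normal_form:
  fixes f :: "('n::finite, 'N::finite) pol"
  assumes f: "f \<in> HN k" "only_row a f" and nz: "eval_pol (KD (row1 a)) X A \<noteq> 0"
  shows "eval_pol f X A = eval_pol (KD (row1 a)) X A ^ k * eval_pol (psub pc (normsub a) f) X A"
proof -
  let ?Q = "KM (row1 a) X A"
  have "invertible ?Q" using nz by (simp add: eval_KD invertible_det_nz)
  note inv = matrix_inv_works[OF this]
  let ?C = "(\<chi> i j. eval_pol (cmp $ i $ j) X A) :: complex^'N^'N"
  define A' where "A' = (\<chi> b. if b = a then A $ a else 0)"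
  define A0 :: "complex^'N^'n" where "A0 = (\<chi> b j. if b = a \<and> ix j = 0 then 1 else 0)"
  have "(\<lambda>v. psub (\<lambda>c. c) (pt X A) (normsub a v)) = pt ?C A0"
    by (rule ext) (simp add: pt_def normsub_def A0_def eval_pol_psub id_hom.psub_0 id_hom.psub_1 split: var.split)
  then have 1: "eval_pol (psub pc (normsub a) f) X A = eval_pol f ?C A0"
    unfolding eval_pol_psub
    by (subst psub_compose[where \<phi> = "psub (\<lambda>c. c) (pt X A)", OF coeff_hom_pc coeff_hom_id])
      (simp_all add: id_hom.psub_add id_hom.psub_mult eval_pol_psub)
  have "A' = A0 ** ?Q"
  proof -
    obtain l :: 'N where l: "ix l = 0" using ex_ix[of 0] by auto
    have "(A0 ** ?Q) $ b $ j = (\<Sum>l'\<in>UNIV. if b = a \<and> l' = l then ?Q $ l' $ j else 0)" for b j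
      unfolding matrix_mul_component A0_def by (intro sum.cong) (auto simp flip: l)
    then have "(A0 ** ?Q) $ b $ j = A' $ b $ j" for b j
      by (cases "b = a") (simp_all add: A'_def KM_row1 l)
    then show ?thesis by (simp add: vec_eq_iff)
  qed
  then have A0: "A' ** matrix_inv ?Q = A0"
    by (simp add: inv flip: matrix_mul_assoc)
  have C: "?Q ** X ** matrix_inv ?Q = ?C"
    unfolding KM_row1_mult by (simp add: inv flip: matrix_mul_assoc)
  have "eval_pol f ?C A0 = det (matrix_inv ?Q) ^ k * eval_pol f X A'"
    using HN_D[OF f(1) inv, of X A'] by (simp add: A0 C)
  moreover have "eval_pol f X A' = eval_pol f X A"
    by (rule f(2)[unfolded only_row_def, rule_format]) (simp add: A'_def)
  moreover have "det ?Q * det (matrix_inv ?Q) = 1"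
    by (metis inv(1) det_mul det_I)
  ultimately show ?thesis
    by (simp add: 1 eval_KD flip: power_mult_distrib mult.assoc)
qed

text \<open>After the substitution only 0, 1 and negatives of \<open>chp\<close> remain in place of
  the variables, and multiplication by \<open>chp\<close> preserves \<open>W\<close>.\<close>

lemma stable_normsub:
  assumes W: "stable k W" and k: "k > 0" and f: "f \<in> W"
  shows "psub pc (normsub a) p * f \<in> W"
  using f
proof (induction p arbitrary: f rule: pol_induct)
  case (const c)
  then show ?case using W by (simp add: stable_def polv.subspace_scale flip: smul_pc)
next
  case (var v)
  have sub: "polv.subspace W" using W by (simp add: stable_def)
  then show ?case
    using var stable_chp[OF W k var] polv.subspace_neg[OF sub]
    by (auto simp: normsub_def cmp_def polv.subspace_0 split: var.split)
next
  case (add p q)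
  then show ?case using W by (simp add: pc_hom.psub_add distrib_right stable_def polv.subspace_add)
next
  case (mult p q)
  then show ?case by (simp add: pc_hom.psub_mult mult.assoc)
qed

text \<open>Both one-row elements are the same determinant power times a function of the
  characteristic polynomial. Multiplying each by the function of the other gives a common element,
  which lies in both subspaces by \<open>stable_normsub\<close>.\<close>

theorem stable_meet:
  fixes W W' :: "('n::finite, 'N::finite) pol set"
  assumes W: "stable k W" "W \<noteq> {0}" and W': "stable k W'" "W' \<noteq> {0}" and k: "k > 0"
  shows "\<exists>f\<in>W \<inter> W'. f \<noteq> 0"
proof -
  fix a :: 'n
  have "0 \<in> W" "0 \<in> W'" using W W' by (auto simp: stable_def polv.subspace_0)
  then obtain h where h: "h \<in> W" "h \<noteq> 0" "only_row a h"
    using stable_only_row[OF W(1)] W(2) by blast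
  obtain h' where h': "h' \<in> W'" "h' \<noteq> 0" "only_row a h'"
    using stable_only_row[OF W'(1)] W'(2) \<open>0 \<in> W'\<close> by blast
  let ?\<psi> = "psub pc (normsub a)"
  have HN: "h \<in> HN k" "h' \<in> HN k" using h h' W W' by (auto simp: stable_def)
  note nf = only_row_normal_form[OF HN(1) h(3)] only_row_normal_form[OF HN(2) h'(3)]
  have "?\<psi> h' * h = ?\<psi> h * h'"
    by (rule pol_eqI_generic[OF KD_row1_nonzero[of a]]) (simp add: eval_mult nf)
  moreover have "?\<psi> h' \<noteq> 0"
  proof
    assume "?\<psi> h' = 0"
    then have "h' = 0" by (intro pol_eqI_generic[OF KD_row1_nonzero[of a]]) (simp add: nf)
    then show False using h' by simp
  qed
  ultimately show ?thesis
    using stable_normsub[OF W(1) k h(1), of a h'] stable_normsub[OF W'(1) k h'(1), of a h]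
      pol_mult_nonzero[of "?\<psi> h'" h] h(2) by (intro bexI[of _ "?\<psi> h' * h"]) auto
qed

section \<open>Products of Krylov determinants\<close>

text \<open>The rows of all k factors form one family indexed by slots (s, i), factor and row. The
  product is linear in each slot, and a derivation acts on one slot at a time.\<close>

definition Phi :: "nat \<Rightarrow> (nat \<times> 'N \<Rightarrow> ('n, 'N) pol^'N) \<Rightarrow> ('n::finite, 'N::finite) pol"
  where "Phi k r = (\<Prod>s<k. det (\<chi> i. r (s, i)))"

abbreviation slots :: "nat \<Rightarrow> (nat \<times> 'N) set" where "slots k \<equiv> {..<k} \<times> UNIV"

lemma Phi_upd:
  fixes r :: "nat \<times> 'N::finite \<Rightarrow> ('n::finite, 'N) pol^'N"
  assumes "x \<in> slots k"
  shows "Phi k (r(x := w)) = det (\<chi> i. if i = snd x then w else r (fst x, i)) *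
    (\<Prod>s\<in>{..<k} - {fst x}. det (\<chi> i. r (s, i)))"
proof -
  obtain s i where x: "x = (s, i)" "s < k" using assms by auto
  have "Phi k (r(x := w)) = det (\<chi> i. (r(x := w)) (s, i)) * (\<Prod>s'\<in>{..<k} - {s}. det (\<chi> i. (r(x := w)) (s', i)))"
    unfolding Phi_def using x(2) by (subst prod.remove[of _ s]) auto
  also have "(\<Prod>s'\<in>{..<k} - {s}. det (\<chi> i. (r(x := w)) (s', i))) = (\<Prod>s\<in>{..<k} - {s}. det (\<chi> i. r (s, i)))"
    by (intro prod.cong) (auto simp: x)
  also have "(\<chi> j. (r(x := w)) (s, j)) = (\<chi> j. if j = i then w else r (s, j))"
    by (simp add: x vec_eq_iff)
  finally show ?thesis unfolding x fst_conv snd_conv .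
qed

lemma Phi_expand:
  assumes "x \<in> slots k"
  shows "Phi k (r(x := w)) = (\<Sum>l\<in>UNIV. w $ l * Phi k (r(x := axis l 1)))"
  unfolding Phi_upd[OF assms]
  using det_row_expand[of "snd x" w "\<chi> i. r (fst x, i)"]
  by (simp add: sum_distrib_right mult.assoc cong: if_cong)

lemma Phi_upd_sum:
  assumes "x \<in> slots k"
  shows "Phi k (r(x := (\<chi> l. \<Sum>z\<in>Z. c z * w z $ l))) = (\<Sum>z\<in>Z. c z * Phi k (r(x := w z)))"
  by (subst (1 2) Phi_expand[OF assms])
    (simp add: sum_distrib_left sum_distrib_right mult.assoc sum.swap[of _ Z])

lemma Phi_expand2:
  assumes "x \<in> slots k" "y \<in> slots k" "x \<noteq> y"
  shows "Phi k (r(x := u, y := w)) = (\<Sum>l\<in>UNIV. \<Sum>l'\<in>UNIV. u $ l * w $ l' * Phi k (r(x := axis l 1, y := axis l' 1)))"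
proof -
  have "Phi k (r(x := u, y := w)) = (\<Sum>l\<in>UNIV. u $ l * Phi k (r(y := w, x := axis l 1)))"
    using Phi_expand[OF assms(1), of "r(y := w)" u] fun_upd_twist[OF assms(3), of r u w] by simp
  also have "\<dots> = (\<Sum>l\<in>UNIV. u $ l * (\<Sum>l'\<in>UNIV. w $ l' * Phi k (r(x := axis l 1, y := axis l' 1))))"
  proof (intro sum.cong refl arg_cong[where f = "(*) _"])
    fix l
    show "Phi k (r(y := w, x := axis l 1)) = (\<Sum>l'\<in>UNIV. w $ l' * Phi k (r(x := axis l 1, y := axis l' 1)))"
      using Phi_expand[OF assms(2), of "r(x := axis l 1)" w] fun_upd_twist[OF assms(3), of r "axis l 1" w] by simp
  qed
  finally show ?thesis by (simp add: sum_distrib_left mult.assoc)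
qed

lemma derivation_Phi:
  fixes r :: "nat \<times> 'N::finite \<Rightarrow> ('n::finite, 'N) pol^'N"
  assumes "derivation D'"
  shows "D' (Phi k r) = (\<Sum>x\<in>slots k. Phi k (r(x := (\<chi> j. D' (r x $ j)))))"
proof -
  interpret D': derivation D' by fact
  have "D' (Phi k r) = (\<Sum>s<k. \<Sum>i\<in>UNIV. Phi k (r((s, i) := (\<chi> j. D' (r (s, i) $ j)))))"
    unfolding Phi_def[of k r] D'.D_prod[OF finite_lessThan]
  proof (rule sum.cong[OF refl])
    fix s assume s: "s \<in> {..<k}"
    have "D' (det (\<chi> i. r (s, i))) = (\<Sum>i\<in>UNIV. det (\<chi> i'. if i' = i then (\<chi> j. D' (r (s, i) $ j)) else r (s, i')))"
      unfolding D'.D_det by (intro sum.cong refl arg_cong[where f = det]) (simp add: vec_eq_iff)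
    then show "D' (det (\<chi> i. r (s, i))) * (\<Prod>s\<in>{..<k} - {s}. det (\<chi> i. r (s, i)))
        = (\<Sum>i\<in>UNIV. Phi k (r((s, i) := (\<chi> j. D' (r (s, i) $ j)))))"
      using s by (simp add: Phi_upd sum_distrib_right cong: if_cong)
  qed
  then show ?thesis by (simp add: sum.cartesian_product)
qed

definition krow :: "(nat \<times> 'N \<Rightarrow> 'n \<times> nat) \<Rightarrow> nat \<times> 'N \<Rightarrow> ('n::finite, 'N::finite) pol^'N"
  where "krow t x = rho (fst (t x)) (snd (t x))"

lemma krow_upd: "krow (t(x := (a, m))) = (krow t)(x := rho a m)"
  by (auto simp: krow_def)

definition Pspan :: "nat \<Rightarrow> ('n::finite, 'N::finite) pol set"
  where "Pspan k = polv.span {Phi k (krow t) | t. True}"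

lemma Pspan_base: "Phi k (krow t) \<in> Pspan k"
  unfolding Pspan_def by (rule polv.span_base) auto

lemma subspace_Pspan: "polv.subspace (Pspan k)"
  unfolding Pspan_def by (rule polv.subspace_span)

lemma Pspan_closed:
  assumes "\<And>f g. F (f + g) = F f + F g" "\<And>c f. F (smul c f) = smul c (F f)"
    and "\<And>t. F (Phi k (krow t)) \<in> Pspan k" and "f \<in> Pspan k"
  shows "F f \<in> Pspan k"
proof -
  have "F 0 = 0" using assms(2)[of 0 0] by (simp add: smul_pc)
  then have "polv.subspace {f. F f \<in> Pspan k}"
    by (intro polv.subspaceI)
      (auto simp: assms(1,2) polv.subspace_0[OF subspace_Pspan] polv.subspace_add[OF subspace_Pspan]
        polv.subspace_scale[OF subspace_Pspan])
  then have "polv.span {Phi k (krow t) | t. True} \<subseteq> {f. F f \<in> Pspan k}"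
    by (intro polv.span_minimal) (use assms(3) in auto)
  then show ?thesis using assms(4) unfolding Pspan_def by blast
qed

text \<open>The operator replaces a row A^b X^l by A^a X^(m+l) and annihilates the rows starting
  with another A^c, so each term of the product rule is again a Krylov product or zero.\<close>

lemma Pspan_T:
  fixes f :: "('n::finite, 'N::finite) pol"
  assumes "f \<in> Pspan k"
  shows "T a m b f \<in> Pspan k"
proof (rule Pspan_closed[OF _ _ _ assms])
  fix t :: "nat \<times> 'N \<Rightarrow> 'n \<times> nat"
  have "Phi k ((krow t)(x := (\<chi> j. T a m b (krow t x $ j)))) \<in> Pspan k" if x: "x \<in> slots k" for x
  proof (cases "b = fst (t x)")
    case True
    then have "(\<chi> j. T a m b (krow t x $ j)) = rho a (m + snd (t x))"
      by (simp add: vec_eq_iff T_rho krow_def)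
    then show ?thesis using Pspan_base[of k "t(x := (a, m + snd (t x)))"] by (simp add: krow_upd)
  next
    case False
    have "Phi k ((krow t)(x := (\<chi> j. T a m b (krow t x $ j)))) = 0"
      by (subst Phi_expand[OF x]) (simp add: T_rho False krow_def)
    then show ?thesis by (simp add: polv.subspace_0[OF subspace_Pspan])
  qed
  then show "T a m b (Phi k (krow t)) \<in> Pspan k"
    unfolding derivation_Phi[OF T.derivation_axioms] by (intro polv.subspace_sum subspace_Pspan)
qed (simp_all add: T.D_add T_smul)

lemma KM_conj:
  assumes "g ** h = mat 1" "h ** g = mat 1"
  shows "KM \<tau> (g ** X ** h) (A ** h) = KM \<tau> X A ** h"
proof -
  have "A ** h ** mpow (g ** X ** h) m = A ** (h ** g) ** mpow X m ** h" for m
    by (simp add: mpow_conj[OF assms] matrix_mul_assoc)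
  then have *: "A ** h ** mpow (g ** X ** h) m = A ** mpow X m ** h" for m by (simp add: assms)
  show ?thesis by (simp add: KM_def * vec_eq_iff matrix_mul_component[of _ h])
qed

lemma Phi_krow: "Phi k (krow t) = (\<Prod>s<k. KD (\<lambda>i. t (s, i)))"
  by (simp add: Phi_def KD_def krow_def)

lemma Phi_HN: "Phi k (krow t) \<in> HN k"
  unfolding HN_iff Phi_krow
  by (simp add: eval_prod eval_KD KM_conj det_mul prod.distrib mult.commute)

lemma Pspan_HN: "Pspan k \<subseteq> HN k"
  unfolding Pspan_def by (intro polv.span_minimal subspace_HN) (auto simp: Phi_HN)

lemma stable_Pspan: "stable k (Pspan k)"
  by (simp add: stable_def subspace_Pspan Pspan_HN Pspan_T)

text \<open>Division with remainder by n: the row in position i is the one whose index a + nm equals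
  i.\<close>

definition seq0 :: "'N::finite \<Rightarrow> 'n::finite \<times> nat"
  where "seq0 i = ((SOME a. ix a = ix i mod CARD('n)), ix i div CARD('n))"

lemma ix_seq0: "ix (fst (seq0 i :: 'n::finite \<times> nat)) = ix i mod CARD('n)"
proof -
  have "\<exists>a :: 'n. ix a = ix i mod CARD('n)" by (rule ex_ix) simp
  then show ?thesis unfolding seq0_def fst_conv by (rule someI_ex)
qed

lemma seq0_eq: "seq0 i = (a :: 'n::finite, j) \<longleftrightarrow> ix i = ix a + CARD('n) * j"
proof
  assume "seq0 i = (a, j)"
  then show "ix i = ix a + CARD('n) * j"
    using ix_seq0[where 'n = 'n, of i] by (auto simp: seq0_def)
next
  assume i: "ix i = ix a + CARD('n) * j"
  have "ix (fst (seq0 i :: 'n \<times> nat)) = ix a" unfolding ix_seq0 by (simp add: i)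
  then show "seq0 i = (a, j)" by (simp add: prod_eq_iff) (simp add: seq0_def i)
qed

definition v0 :: "nat \<Rightarrow> ('n::finite, 'N::finite) pol"
  where "v0 k = Phi k (krow (\<lambda>x. seq0 (snd x)))"

lemma KD_seq0_nonzero: "KD (seq0 :: 'N::finite \<Rightarrow> 'n::finite \<times> nat) \<noteq> 0"
proof (rule KD_nonzero)
  show "inj (seq0 :: 'N \<Rightarrow> 'n \<times> nat)"
  proof (rule injI)
    fix x y :: 'N assume "(seq0 x :: 'n \<times> nat) = seq0 y"
    then have "ix x = ix y"
      using seq0_eq[of x "fst (seq0 y :: 'n \<times> nat)" "snd (seq0 y :: 'n \<times> nat)"]
        seq0_eq[of y "fst (seq0 y :: 'n \<times> nat)" "snd (seq0 y :: 'n \<times> nat)"] by simp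
    then show "x = y" by simp
  qed
  fix a :: 'n and j assume "(a, Suc j) \<in> range (seq0 :: 'N \<Rightarrow> 'n \<times> nat)"
  then obtain i :: 'N where i: "seq0 i = (a, Suc j)" by (auto simp: image_iff)
  then have "ix a + CARD('n) * j < CARD('N)"
    using ix_less[of i] unfolding seq0_eq by (simp add: algebra_simps)
  then obtain l :: 'N where "ix l = ix a + CARD('n) * j" using ex_ix by metis
  then have "seq0 l = (a, j)" by (simp add: seq0_eq)
  then show "(a, j) \<in> range (seq0 :: 'N \<Rightarrow> 'n \<times> nat)" by (metis rangeI)
qed

lemma v0_power: "v0 k = KD seq0 ^ k"
  by (simp add: v0_def Phi_krow)

lemma v0_nonzero: "v0 k \<noteq> (0 :: ('n::finite, 'N::finite) pol)"
proof -
  have "KD seq0 ^ k \<noteq> (0 :: ('n, 'N) pol)"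
    by (induction k) (simp_all add: pol_mult_nonzero KD_seq0_nonzero)
  then show ?thesis by (simp add: v0_power)
qed

lemma v0_HN: "v0 k \<in> HN k"
  unfolding v0_def by (rule Phi_HN)

lemma Pspan_trX: "k > 0 \<Longrightarrow> f \<in> Pspan k \<Longrightarrow> trX m * f \<in> Pspan k"
  by (rule stable_trX[OF stable_Pspan])

section \<open>The Laplacian\<close>

text \<open>This is Tr Y^2. Unlike A Y^m B it is easily seen to preserve the Krylov span, and its
  commutators turn X into Y.\<close>

definition Lap :: "('n::finite, 'N::finite) oper"
  where "Lap f = (\<Sum>i\<in>UNIV. \<Sum>j\<in>UNIV. deriv_var (XV i j) (deriv_var (XV j i) f))"

lemma Lap_add: "Lap (f + g) = Lap f + Lap g"
  by (simp add: Lap_def deriv_var_add sum.distrib)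

lemma Lap_smul: "Lap (smul c f) = smul c (Lap f)"
  unfolding Lap_def deriv_var_smul by (simp add: smul_pc sum_distrib_left)

lemma Lap_sum: "Lap (\<Sum>i\<in>I. f i) = (\<Sum>i\<in>I. Lap (f i))"
  by (induction I rule: infinite_finite_induct) (simp_all add: Lap_add Lap_def[of 0])

lemma sum_swap3: "(\<Sum>i\<in>I. \<Sum>j\<in>J. \<Sum>c\<in>C. F i j c) = (\<Sum>c\<in>C. \<Sum>i\<in>I. \<Sum>j\<in>J. F i j c)"
proof -
  have "(\<Sum>i\<in>I. \<Sum>j\<in>J. \<Sum>c\<in>C. F i j c) = (\<Sum>i\<in>I. \<Sum>c\<in>C. \<Sum>j\<in>J. F i j c)"
    by (intro sum.cong refl sum.swap)
  also have "\<dots> = (\<Sum>c\<in>C. \<Sum>i\<in>I. \<Sum>j\<in>J. F i j c)" by (rule sum.swap)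
  finally show ?thesis .
qed

lemma sum_swap4: "(\<Sum>i\<in>I. \<Sum>j\<in>J. \<Sum>c\<in>C. \<Sum>d\<in>D. F i j c d) = (\<Sum>c\<in>C. \<Sum>d\<in>D. \<Sum>i\<in>I. \<Sum>j\<in>J. F i j c d)"
  by (subst sum_swap3, rule sum.cong[OF refl], rule sum_swap3)

text \<open>Two contracted derivatives cut A^a X^m at two places. The closed segment between the
  cuts becomes a trace, and the ends join to a shorter Krylov row; the two inner sums distinguish
  whether the second cut lies before or after the first.\<close>

lemma Lap_rho:
  "Lap (rho a m $ q) =
    (\<Sum>c<m. (\<Sum>e<c. trX (c - 1 - e) * rho a (e + (m - 1 - c)) $ q) +
      (\<Sum>e<m - 1 - c. trX e * rho a (c + (m - 1 - c - 1 - e)) $ q))"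
proof -
  have "Lap (rho a m $ q) = (\<Sum>i\<in>UNIV. \<Sum>j\<in>UNIV. \<Sum>c<m.
      (\<Sum>e<c. mpow XM (c - 1 - e) $ j $ j * (rho a e $ i * mpow XM (m - 1 - c) $ i $ q)) +
      (\<Sum>e<m - 1 - c. mpow XM e $ i $ i * (rho a c $ j * mpow XM (m - 1 - c - 1 - e) $ j $ q)))"
    unfolding Lap_def deriv_X_rho deriv_var_sum deriv_var_mult deriv_X_mpow
    by (simp add: sum_distrib_left sum_distrib_right mult_ac)
  also have "\<dots> = (\<Sum>c<m. (\<Sum>e<c. trX (c - 1 - e) * rho a (e + (m - 1 - c)) $ q) +
      (\<Sum>e<m - 1 - c. trX e * rho a (c + (m - 1 - c - 1 - e)) $ q))"
  proof (subst sum_swap3, rule sum.cong[OF refl], unfold sum.distrib, rule arg_cong2[where f = "(+)"])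
    fix c
    show "(\<Sum>i\<in>UNIV. \<Sum>j\<in>UNIV. \<Sum>e<c. mpow XM (c - 1 - e) $ j $ j * (rho a e $ i * mpow XM (m - 1 - c) $ i $ q))
        = (\<Sum>e<c. trX (c - 1 - e) * rho a (e + (m - 1 - c)) $ q)"
      unfolding trX_def trace_def rho_add
      by (subst sum_swap3, rule sum.cong[OF refl]) (simp only: sum_product, rule sum.swap)
    show "(\<Sum>i\<in>UNIV. \<Sum>j\<in>UNIV. \<Sum>e<m - 1 - c. mpow XM e $ i $ i * (rho a c $ j * mpow XM (m - 1 - c - 1 - e) $ j $ q))
        = (\<Sum>e<m - 1 - c. trX e * rho a (c + (m - 1 - c - 1 - e)) $ q)"
      unfolding trX_def trace_def rho_add
      by (subst sum_swap3, rule sum.cong[OF refl]) (simp only: sum_product)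
  qed
  finally show ?thesis .
qed

lemma Pspan_Phi_upd_trX:
  assumes "k > 0" "x \<in> slots k" and w: "\<And>q. w $ q = (\<Sum>z\<in>Z. trX (p z) * rho a (l z) $ q)"
  shows "Phi k ((krow t)(x := w)) \<in> Pspan k"
proof -
  have "w = (\<chi> q. \<Sum>z\<in>Z. trX (p z) * rho a (l z) $ q)"
    by (simp add: vec_eq_iff w)
  then have "Phi k ((krow t)(x := w)) = (\<Sum>z\<in>Z. trX (p z) * Phi k (krow (t(x := (a, l z)))))"
    by (simp add: Phi_upd_sum[OF assms(2)] krow_upd)
  then show ?thesis
    by (simp add: polv.subspace_sum[OF subspace_Pspan] Pspan_trX[OF assms(1)] Pspan_base)
qed

lemma Pspan_Phi_upd_Lap:
  assumes "k > 0" "x \<in> slots k"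
  shows "Phi k ((krow t)(x := (\<chi> q. Lap (krow t x $ q)))) \<in> Pspan k"
proof -
  obtain a m where t: "t x = (a, m)" by fastforce
  let ?Z = "Sigma {..<m} (\<lambda>c. {..<c})" and ?Z' = "Sigma {..<m} (\<lambda>c. {..<m - 1 - c})"
  \<comment> \<open>The two double sums of \<open>Lap_rho\<close> are merged into a single index
    set, so that linearity in the slot can be applied once.\<close>
  define Z where "Z = Inl ` ?Z \<union> Inr ` ?Z'"
  define p where "p z = (case z of Inl (c, e) \<Rightarrow> c - 1 - e | Inr (c, e) \<Rightarrow> e)" for z :: "nat \<times> nat + nat \<times> nat"
  define l where "l z = (case z of Inl (c, e) \<Rightarrow> e + (m - 1 - c) | Inr (c, e) \<Rightarrow> c + (m - 1 - c - 1 - e))"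
    for z :: "nat \<times> nat + nat \<times> nat"
  show ?thesis
  proof (rule Pspan_Phi_upd_trX[OF assms])
    fix q
    have "Lap (krow t x $ q) = (\<Sum>(c, e)\<in>?Z. trX (c - 1 - e) * rho a (e + (m - 1 - c)) $ q)
        + (\<Sum>(c, e)\<in>?Z'. trX e * rho a (c + (m - 1 - c - 1 - e)) $ q)"
      unfolding krow_def t fst_conv snd_conv Lap_rho sum.distrib by (subst (1 2) sum.Sigma) auto
    then show "(\<chi> q. Lap (krow t x $ q)) $ q = (\<Sum>z\<in>Z. trX (p z) * rho a (l z) $ q)"
      unfolding Z_def
      by (subst sum.union_disjoint) (auto simp: sum.reindex inj_on_def p_def l_def case_prod_unfold)
  qed
qed

text \<open>Contracted derivatives on two different rows cut both of them and join the head of each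
  to the tail of the other, so that two Krylov rows result again.\<close>

lemma Pspan_Phi_upd2:
  fixes t :: "nat \<times> 'N::finite \<Rightarrow> 'n::finite \<times> nat"
  assumes xy: "x \<in> slots k" "y \<in> slots k" "x \<noteq> y"
  shows "(\<Sum>i\<in>UNIV. \<Sum>j\<in>UNIV. Phi k ((krow t)(x := (\<chi> q. deriv_var (XV j i) (krow t x $ q)),
      y := (\<chi> q. deriv_var (XV i j) (krow t y $ q))))) \<in> Pspan k"
proof -
  obtain a m where x: "t x = (a, m)" by fastforce
  obtain b m' where y: "t y = (b, m')" by fastforce
  let ?C = "\<lambda>l l'. Phi k ((krow t)(x := axis l 1, y := axis l' 1))"
  have "(\<Sum>i\<in>UNIV. \<Sum>j\<in>UNIV. Phi k ((krow t)(x := (\<chi> q. deriv_var (XV j i) (krow t x $ q)),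
      y := (\<chi> q. deriv_var (XV i j) (krow t y $ q)))))
    = (\<Sum>i\<in>UNIV. \<Sum>j\<in>UNIV. \<Sum>l\<in>UNIV. \<Sum>l'\<in>UNIV. \<Sum>c<m. \<Sum>d<m'.
        (rho a c $ j * mpow XM (m' - 1 - d) $ j $ l') * (rho b d $ i * mpow XM (m - 1 - c) $ i $ l) * ?C l l')"
  proof (subst Phi_expand2[OF xy], intro sum.cong refl)
    fix i j l l' :: 'N
    have D: "(\<chi> q. deriv_var (XV j i) (krow t x $ q)) $ l = (\<Sum>c<m. rho a c $ j * mpow XM (m - 1 - c) $ i $ l)"
      "(\<chi> q. deriv_var (XV i j) (krow t y $ q)) $ l' = (\<Sum>d<m'. rho b d $ i * mpow XM (m' - 1 - d) $ j $ l')"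
      by (simp_all only: vec_lambda_beta krow_def x y fst_conv snd_conv deriv_X_rho)
    show "(\<chi> q. deriv_var (XV j i) (krow t x $ q)) $ l * (\<chi> q. deriv_var (XV i j) (krow t y $ q)) $ l' * ?C l l'
        = (\<Sum>c<m. \<Sum>d<m'. (rho a c $ j * mpow XM (m' - 1 - d) $ j $ l') *
            (rho b d $ i * mpow XM (m - 1 - c) $ i $ l) * ?C l l')"
      unfolding D unfolding sum_product unfolding sum_distrib_right by (intro sum.cong refl) (simp only: mult_ac)
  qed
  also have "\<dots> = (\<Sum>i\<in>UNIV. \<Sum>j\<in>UNIV. \<Sum>c<m. \<Sum>d<m'. \<Sum>l\<in>UNIV. \<Sum>l'\<in>UNIV.
        (rho a c $ j * mpow XM (m' - 1 - d) $ j $ l') * (rho b d $ i * mpow XM (m - 1 - c) $ i $ l) * ?C l l')"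
    by (intro sum.cong refl, subst sum_swap3, intro sum.cong refl, rule sum_swap3)
  also have "\<dots> = (\<Sum>c<m. \<Sum>d<m'. \<Sum>i\<in>UNIV. \<Sum>j\<in>UNIV. \<Sum>l\<in>UNIV. \<Sum>l'\<in>UNIV.
        (rho a c $ j * mpow XM (m' - 1 - d) $ j $ l') * (rho b d $ i * mpow XM (m - 1 - c) $ i $ l) * ?C l l')"
    by (subst sum_swap3, intro sum.cong refl, rule sum_swap3)
  also have "\<dots> = (\<Sum>c<m. \<Sum>d<m'. \<Sum>l\<in>UNIV. \<Sum>l'\<in>UNIV. \<Sum>i\<in>UNIV. \<Sum>j\<in>UNIV.
        (rho a c $ j * mpow XM (m' - 1 - d) $ j $ l') * (rho b d $ i * mpow XM (m - 1 - c) $ i $ l) * ?C l l')"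
    by (rule sum.cong[OF refl], rule sum.cong[OF refl], rule sum_swap4)
  also have "\<dots> = (\<Sum>c<m. \<Sum>d<m'. Phi k (krow (t(x := (b, d + (m - 1 - c)), y := (a, c + (m' - 1 - d))))))"
  proof (intro sum.cong refl)
    fix c d
    have "Phi k (krow (t(x := (b, d + (m - 1 - c)), y := (a, c + (m' - 1 - d)))))
        = (\<Sum>l\<in>UNIV. \<Sum>l'\<in>UNIV. rho b (d + (m - 1 - c)) $ l * rho a (c + (m' - 1 - d)) $ l' * ?C l l')"
      unfolding krow_upd by (rule Phi_expand2[OF xy])
    then show "(\<Sum>l\<in>UNIV. \<Sum>l'\<in>UNIV. \<Sum>i\<in>UNIV. \<Sum>j\<in>UNIV.
        (rho a c $ j * mpow XM (m' - 1 - d) $ j $ l') * (rho b d $ i * mpow XM (m - 1 - c) $ i $ l) * ?C l l')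
      = Phi k (krow (t(x := (b, d + (m - 1 - c)), y := (a, c + (m' - 1 - d)))))"
      by (simp add: rho_add sum_product sum_distrib_left sum_distrib_right mult_ac)
  qed
  finally show ?thesis
    by (simp add: polv.subspace_sum[OF subspace_Pspan] Pspan_base)
qed

text \<open>By the product rule the two derivatives fall either on one row, where
  \<open>Lap_rho\<close> applies, or on two different rows, which then exchange their tails.\<close>

lemma Pspan_Lap:
  fixes f :: "('n::finite, 'N::finite) pol"
  assumes k: "k > 0" and f: "f \<in> Pspan k"
  shows "Lap f \<in> Pspan k"
proof (rule Pspan_closed[OF _ _ _ f])
  fix t :: "nat \<times> 'N \<Rightarrow> 'n \<times> nat"
  let ?D = "\<lambda>i j x. (\<chi> q. deriv_var (XV i j) (krow t x $ q))"
  let ?DD = "\<lambda>i j x. (\<chi> q. deriv_var (XV i j) (deriv_var (XV j i) (krow t x $ q)))"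
  let ?S = "slots k :: (nat \<times> 'N) set"
  have fin: "finite ?S" by simp
  have "deriv_var (XV i j) (deriv_var (XV j i) (Phi k (krow t)))
      = (\<Sum>x\<in>?S. Phi k ((krow t)(x := ?DD i j x)) + (\<Sum>y\<in>?S - {x}. Phi k ((krow t)(x := ?D j i x, y := ?D i j y))))" for i j
    unfolding derivation_Phi[OF deriv_var.derivation_axioms] deriv_var_sum
    by (intro sum.cong refl, subst sum.remove[OF fin], assumption)
      (auto intro!: sum.cong)
  then have "Lap (Phi k (krow t)) = (\<Sum>i\<in>UNIV. \<Sum>j\<in>UNIV. \<Sum>x\<in>?S. Phi k ((krow t)(x := ?DD i j x)) +
      (\<Sum>y\<in>?S - {x}. Phi k ((krow t)(x := ?D j i x, y := ?D i j y))))"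
    by (simp add: Lap_def)
  also have "\<dots> = (\<Sum>x\<in>?S. (\<Sum>i\<in>UNIV. \<Sum>j\<in>UNIV. Phi k ((krow t)(x := ?DD i j x))) +
      (\<Sum>y\<in>?S - {x}. \<Sum>i\<in>UNIV. \<Sum>j\<in>UNIV. Phi k ((krow t)(x := ?D j i x, y := ?D i j y))))"
    by (subst sum_swap3, rule sum.cong[OF refl], unfold sum.distrib,
        rule arg_cong2[where f = "(+)", OF refl], rule sum_swap3)
  also have "\<dots> = (\<Sum>x\<in>?S. Phi k ((krow t)(x := (\<chi> q. Lap (krow t x $ q)))) +
      (\<Sum>y\<in>?S - {x}. \<Sum>i\<in>UNIV. \<Sum>j\<in>UNIV. Phi k ((krow t)(x := ?D j i x, y := ?D i j y))))"
  proof (intro sum.cong refl arg_cong2[where f = "(+)"])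
    fix x assume x: "x \<in> ?S"
    show "(\<Sum>i\<in>UNIV. \<Sum>j\<in>UNIV. Phi k ((krow t)(x := ?DD i j x))) = Phi k ((krow t)(x := (\<chi> q. Lap (krow t x $ q))))"
    proof -
      let ?C = "\<lambda>l. Phi k ((krow t)(x := axis l 1))"
      have "(\<Sum>i\<in>UNIV. \<Sum>j\<in>UNIV. Phi k ((krow t)(x := ?DD i j x)))
          = (\<Sum>i\<in>UNIV. \<Sum>j\<in>UNIV. \<Sum>l\<in>UNIV. deriv_var (XV i j) (deriv_var (XV j i) (krow t x $ l)) * ?C l)"
        by (subst Phi_expand[OF x]) (simp only: vec_lambda_beta)
      also have "\<dots> = (\<Sum>l\<in>UNIV. \<Sum>i\<in>UNIV. \<Sum>j\<in>UNIV. deriv_var (XV i j) (deriv_var (XV j i) (krow t x $ l)) * ?C l)"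
        by (rule sum_swap3)
      also have "\<dots> = (\<Sum>l\<in>UNIV. Lap (krow t x $ l) * ?C l)"
        by (simp only: Lap_def sum_distrib_right)
      also have "\<dots> = Phi k ((krow t)(x := (\<chi> q. Lap (krow t x $ q))))"
        by (subst (2) Phi_expand[OF x]) (simp only: vec_lambda_beta)
      finally show ?thesis .
    qed
  qed
  also have "\<dots> \<in> Pspan k"
    by (intro polv.subspace_sum polv.subspace_add subspace_Pspan Pspan_Phi_upd_Lap[OF k] Pspan_Phi_upd2) auto
  finally show "Lap (Phi k (krow t)) \<in> Pspan k" .
qed (simp_all add: Lap_add Lap_smul)

section \<open>Adjoints\<close>

text \<open>Words in \<open>X\<close> (\<^const>\<open>True\<close>) and \<open>Y\<close> (\<^const>\<open>False\<close>).\<close>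

definition XY :: "bool \<Rightarrow> 'N \<Rightarrow> 'N \<Rightarrow> ('n, 'N) oper"
  where "XY b = (if b then opX else opY)"

definition ABw :: "'n::finite \<Rightarrow> bool list \<Rightarrow> 'n \<Rightarrow> ('n, 'N::finite) oper"
  where "ABw a w b = AB a (mat_word (map XY w)) b"

lemma smul_sum: "smul c (\<Sum>i\<in>I. f i) = (\<Sum>i\<in>I. smul c (f i))"
  by (simp add: smul_pc sum_distrib_left)

lemma mult_smul: "f * smul c g = smul c (f * g)"
  by (simp add: smul_pc mult.left_commute)

lemma XY_add: "XY b i j (f + g) = XY b i j f + XY b i j g"
  by (simp add: XY_def opX_def opY_def mul_var_pv deriv_var_add distrib_left)

lemma XY_0 [simp]: "XY b i j 0 = 0"
  by (simp add: XY_def opX_def opY_def mul_var_pv)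

lemma XY_sum: "XY b i j (\<Sum>l\<in>I. f l) = (\<Sum>l\<in>I. XY b i j (f l))"
  by (induction I rule: infinite_finite_induct) (simp_all add: XY_add)

lemma ip_XY: "ip (XY b i j f) g = ip f (XY (\<not> b) j i g)"
  by (simp add: XY_def opX_def opY_def mul_var_pv ip_pv ip_deriv_var)

lemma mat_word_XY_snoc:
  "mat_word (map XY w @ [XY b]) i j f = (\<Sum>l\<in>UNIV. mat_word (map XY w) i l (XY b l j f))"
proof (induction w arbitrary: i)
  case Nil
  then show ?case by (simp add: if_distrib[of "XY b i _"] cong: if_cong)
next
  case (Cons c w)
  then show ?case by (simp add: XY_sum) (rule sum.swap)
qed

text \<open>The adjoint of a letter exchanges X with Y and transposes its matrix indices; taking
  adjoints reverses the order of the letters.\<close>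

lemma ip_mat_word:
  "ip (mat_word (map XY w) i j f) g = ip f (mat_word (map XY (rev (map Not w))) j i g)"
proof (induction w arbitrary: i g)
  case (Cons b w)
  then show ?case
    by (simp add: ip_sum_left ip_sum_right ip_XY mat_word_XY_snoc)
qed simp

lemma ip_ABw: "ip (ABw a w b f) g = ip f (ABw b (rev (map Not w)) a g)"
  unfolding ABw_def AB_def ip_sum_left ip_sum_right opA_def opB_def mul_var_pv ip_pv ip_mat_word ip_deriv_var
  by (rule sum.swap)

lemma ABw_X: "ABw a (replicate m True) b f = T a m b f"
  by (simp add: ABw_def XY_def map_replicate flip: AB_mat_word_X)

lemma ip_T: "ip (T a m b f) g = ip f (ABw b (replicate m False) a g)"
  by (simp add: ip_ABw map_replicate flip: ABw_X)

text \<open>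
  \<open>UXY m j\<close> is the sum of all words with \<open>j\<close> letters \<open>Y\<close> and \<open>m - j\<close> letters \<open>X\<close>. The commutator with
  \<open>Tr Y\<^sup>2\<close> turns every \<open>X\<close> in turn into \<open>2Y\<close>, so iterating it leads from \<open>X\<^sup>m\<close> to \<open>Y\<^sup>m\<close>.
\<close>

fun UXY :: "nat \<Rightarrow> nat \<Rightarrow> 'N::finite \<Rightarrow> 'N \<Rightarrow> ('n, 'N) oper" where
  "UXY 0 j p q f = (if j = 0 \<and> p = q then f else 0)"
| "UXY (Suc m) j p q f = (\<Sum>l\<in>UNIV. opX p l (UXY m j l q f)) +
     (case j of 0 \<Rightarrow> 0 | Suc i \<Rightarrow> \<Sum>l\<in>UNIV. opY p l (UXY m i l q f))"

lemma UXY_gt: "j > m \<Longrightarrow> UXY m j p q f = 0"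
  by (induction m arbitrary: j p) (auto simp: opX_def opY_def mul_var_pv split: nat.split)

lemma UXY_X: "UXY m 0 p q f = mat_word (replicate m opX) p q f"
  by (induction m arbitrary: p) auto

lemma UXY_Y: "UXY m m p q f = mat_word (replicate m opY) p q f"
  by (induction m arbitrary: p) (auto simp: UXY_gt opX_def mul_var_pv)

lemma Lap_opX:
  fixes f :: "('n::finite, 'N::finite) pol"
  shows "Lap (opX p l f) = opX p l (Lap f) + smul 2 (opY p l f)"
proof -
  have "Lap (opX p l f) = (\<Sum>i\<in>UNIV. \<Sum>j\<in>UNIV. (if i = p \<and> j = l then deriv_var (XV j i) f else 0)
      + (if j = p \<and> i = l then deriv_var (XV i j) f else 0) + pv (XV p l) * deriv_var (XV i j) (deriv_var (XV j i) f))"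
    unfolding Lap_def opX_def mul_var_pv
  proof (intro sum.cong refl)
    fix i j
    have *: "deriv_var v (if c then g else 0) = (if c then deriv_var v g else 0)" for v c and g :: "('n, 'N) pol"
      by simp
    have "deriv_var (XV j i) (pv (XV p l) * f) = (if j = p \<and> i = l then f else 0) + pv (XV p l) * deriv_var (XV j i) f"
      by (simp add: deriv_var_mult)
    then show "deriv_var (XV i j) (deriv_var (XV j i) (pv (XV p l) * f))
      = (if i = p \<and> j = l then deriv_var (XV j i) f else 0) + (if j = p \<and> i = l then deriv_var (XV i j) f else 0)
        + pv (XV p l) * deriv_var (XV i j) (deriv_var (XV j i) f)"
      by (simp only: deriv_var_add * deriv_var_mult deriv_var_pv var.inject)
        (simp only: if_distrib[of "\<lambda>x. x * _"] mult_1_left mult_zero_left add_ac)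
  qed
  also have "\<dots> = opX p l (Lap f) + smul 2 (opY p l f)"
    unfolding sum.distrib
  proof -
    have 1: "(\<Sum>i\<in>UNIV. \<Sum>j\<in>UNIV. if i = p \<and> j = l then deriv_var (XV j i) f else 0) = opY p l f"
    proof -
      have "(\<Sum>i\<in>UNIV. \<Sum>j\<in>UNIV. if i = p \<and> j = l then deriv_var (XV j i) f else 0)
          = (\<Sum>i\<in>UNIV. if i = p then deriv_var (XV l p) f else 0)"
        by (intro sum.cong) auto
      then show ?thesis by (simp add: opY_def)
    qed
    have "(\<Sum>i\<in>UNIV. \<Sum>j\<in>UNIV. if j = p \<and> i = l then deriv_var (XV i j) f else 0) = opY p l f"
      using 1 by (subst sum.swap) simp
    moreover have "smul 2 g = g + g" for g :: "('n, 'N) pol"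
      using polv.scale_left_distrib[of 1 1 g] by (simp only: polv.scale_one one_add_one)
    ultimately show "(\<Sum>i\<in>UNIV. \<Sum>j\<in>UNIV. if i = p \<and> j = l then deriv_var (XV j i) f else 0) +
        (\<Sum>i\<in>UNIV. \<Sum>j\<in>UNIV. if j = p \<and> i = l then deriv_var (XV i j) f else 0) +
        (\<Sum>i\<in>UNIV. \<Sum>j\<in>UNIV. pv (XV p l) * deriv_var (XV i j) (deriv_var (XV j i) f))
      = opX p l (Lap f) + smul 2 (opY p l f)"
      by (simp add: 1 opX_def mul_var_pv Lap_def sum_distrib_left)
  qed
  finally show ?thesis .
qed

lemma Lap_deriv: "Lap (deriv_var v f) = deriv_var v (Lap f)"
  by (simp add: Lap_def deriv_var_sum deriv_var_commute[of _ v])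

lemma Lap_opY: "Lap (opY p l f) = opY p l (Lap f)"
  by (simp add: opY_def Lap_deriv)

lemma Lap_opA: "Lap (opA a i f) = opA a i (Lap f)"
  by (simp add: opA_def mul_var_pv Lap_def deriv_var_mult sum_distrib_left)

lemma Lap_opB: "Lap (opB i a f) = opB i a (Lap f)"
  by (simp add: opB_def Lap_deriv)

lemma opX_lin: "opX p l (f + g) = opX p l f + opX p l g" "opX p l (smul c f) = smul c (opX p l f)"
  by (simp_all add: opX_def mul_var_pv distrib_left mult_smul)

lemma opY_lin: "opY p l (f + g) = opY p l f + opY p l g" "opY p l (smul c f) = smul c (opY p l f)"
  by (simp_all add: opY_def deriv_var_add deriv_var_smul)

text \<open>In a word with j + 1 letters Y, any one of them may be the letter just turned from X
  into 2Y; this accounts for the factor 2(j + 1).\<close>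

lemma Lap_UXY:
  fixes f :: "('n::finite, 'N::finite) pol"
  shows "Lap (UXY m j p q f) = UXY m j p q (Lap f) + smul (of_nat (2 * Suc j)) (UXY m (Suc j) p q f)"
proof (induction m arbitrary: j p)
  case 0
  then show ?case by (simp add: Lap_def)
next
  case (Suc m)
  have X: "Lap (\<Sum>l\<in>UNIV. opX p l (UXY m j l q f)) = (\<Sum>l\<in>UNIV. opX p l (UXY m j l q (Lap f)))
      + smul (of_nat (2 * Suc j)) (\<Sum>l\<in>UNIV. opX p l (UXY m (Suc j) l q f))
      + smul 2 (\<Sum>l\<in>UNIV. opY p l (UXY m j l q f))"
    unfolding Lap_sum Lap_opX Suc.IH by (simp only: opX_lin sum.distrib smul_sum)
  show ?case
  proof (cases j)
    case 0
    have "smul (of_nat (2 * Suc j)) g = smul 2 g" for g :: "('n, 'N) pol" using 0 by simp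
    then show ?thesis
      using X 0 by (simp add: polv.scale_right_distrib add_ac)
  next
    case j: (Suc i)
    have Y: "Lap (\<Sum>l\<in>UNIV. opY p l (UXY m i l q f)) = (\<Sum>l\<in>UNIV. opY p l (UXY m i l q (Lap f)))
        + smul (of_nat (2 * j)) (\<Sum>l\<in>UNIV. opY p l (UXY m j l q f))"
      unfolding Lap_sum Lap_opY Suc.IH j by (simp only: opY_lin sum.distrib smul_sum)
    have c: "smul (of_nat (2 * Suc j)) g = smul 2 g + smul (of_nat (2 * j)) g" for g :: "('n, 'N) pol"
      by (subst polv.scale_left_distrib[symmetric]) (simp add: algebra_simps)
    have "Lap (UXY (Suc m) j p q f)
        = Lap (\<Sum>l\<in>UNIV. opX p l (UXY m j l q f)) + Lap (\<Sum>l\<in>UNIV. opY p l (UXY m i l q f))"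
      by (simp add: j Lap_add)
    also have "\<dots> = UXY (Suc m) j p q (Lap f) + smul (of_nat (2 * Suc j)) (UXY (Suc m) (Suc j) p q f)"
    proof -
      have "UXY (Suc m) j p q (Lap f)
          = (\<Sum>l\<in>UNIV. opX p l (UXY m j l q (Lap f))) + (\<Sum>l\<in>UNIV. opY p l (UXY m i l q (Lap f)))"
        by (simp add: j)
      moreover have "UXY (Suc m) (Suc j) p q f
          = (\<Sum>l\<in>UNIV. opX p l (UXY m (Suc j) l q f)) + (\<Sum>l\<in>UNIV. opY p l (UXY m j l q f))"
        by simp
      ultimately show ?thesis
        unfolding X Y by (simp only: polv.scale_right_distrib c add_ac)
    qed
    finally show ?thesis .
  qed
qed

lemma AB_lin:
  assumes "\<And>i j f. P i j f = Q i j f + smul c (R i j f)"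
  shows "AB a P b f = AB a Q b f + smul c (AB a R b f)"
  unfolding AB_def assms smul_sum
  by (simp only: opA_def mul_var_pv distrib_left sum.distrib mult_smul)

lemma Lap_AB_UXY:
  "Lap (AB a (UXY m j) b f) = AB a (UXY m j) b (Lap f) + smul (of_nat (2 * Suc j)) (AB a (UXY m (Suc j)) b f)"
proof -
  have "Lap (AB a (UXY m j) b f) = (\<Sum>p\<in>UNIV. \<Sum>q\<in>UNIV. opA a p (Lap (UXY m j p q (opB q b f))))"
    by (simp add: AB_def Lap_sum Lap_opA)
  also have "\<dots> = AB a (\<lambda>p q f. Lap (UXY m j p q f)) b f"
    by (simp add: AB_def)
  also have "\<dots> = AB a (\<lambda>p q f. UXY m j p q (Lap f)) b f + smul (of_nat (2 * Suc j)) (AB a (UXY m (Suc j)) b f)"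
    by (rule AB_lin, rule Lap_UXY)
  also have "AB a (\<lambda>p q f. UXY m j p q (Lap f)) b f = AB a (UXY m j) b (Lap f)"
    by (simp add: AB_def Lap_opB)
  finally show ?thesis .
qed

text \<open>\<open>Lap\<close> commutes with A and B, so the commutators of \<open>Lap_UXY\<close>
  act inside A...B; dividing by 2(j + 1) at each step leads from X^m to Y^m. This is what makes the
  orthogonal complement of \<open>Pspan k\<close> stable.\<close>

lemma Pspan_ABw_Y:
  fixes f :: "('n::finite, 'N::finite) pol"
  assumes k: "k > 0" and f: "f \<in> Pspan k"
  shows "ABw a (replicate m False) b f \<in> Pspan k"
proof -
  have "\<forall>f\<in>(Pspan k :: ('n, 'N) pol set). AB a (UXY m j) b f \<in> Pspan k" for j
  proof (induction j)
    case 0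
    have "AB a (UXY m 0) b f = T a m b f" for f :: "('n, 'N) pol"
      unfolding AB_mat_word_X[symmetric] by (simp add: AB_def UXY_X)
    then show ?case by (simp add: Pspan_T)
  next
    case (Suc j)
    show ?case
    proof
      fix f :: "('n, 'N) pol" assume f: "f \<in> Pspan k"
      have "smul (of_nat (2 * Suc j)) (AB a (UXY m (Suc j)) b f) = Lap (AB a (UXY m j) b f) - AB a (UXY m j) b (Lap f)"
        by (simp add: Lap_AB_UXY)
      also have "\<dots> \<in> Pspan k"
        using Suc f by (intro polv.subspace_diff subspace_Pspan) (auto simp: Pspan_Lap[OF k])
      finally have "smul (1 / of_nat (2 * Suc j)) (smul (of_nat (2 * Suc j)) (AB a (UXY m (Suc j)) b f)) \<in> Pspan k"
        by (rule polv.subspace_scale[OF subspace_Pspan])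
      then show "AB a (UXY m (Suc j)) b f \<in> Pspan k"
        by (simp del: of_nat_Suc of_nat_mult)
    qed
  qed
  from this[of m] f have "AB a (UXY m m) b f \<in> Pspan k" by blast
  also have "AB a (UXY m m) b f = ABw a (replicate m False) b f"
    by (simp add: ABw_def AB_def UXY_Y XY_def map_replicate)
  finally show ?thesis .
qed

section \<open>The space of states is spanned by products of Krylov determinants\<close>

lemma homog_mpow:
  assumes "\<And>i j. w (XV i j) = x"
  shows "homog w (x * m) (mpow (XM :: ('n::finite, 'N::finite) pol^'N^'N) m $ i $ j)"
proof (induction m arbitrary: i)
  case (Suc m)
  let ?X = "XM :: ('n, 'N) pol^'N^'N"
  have "homog w (x + x * m) (?X $ i $ l * mpow ?X m $ l $ j)" for l
    using homog_pv[of w "XV i l :: ('n, 'N) var"] by (intro homog_mult Suc) (simp add: XM_def assms)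
  then show ?case by (auto simp: matrix_mul_component intro!: homog_sum)
qed (simp add: mat_def)

lemma homog_rho_gen:
  assumes "\<And>i j. w (XV i j) = x" "\<And>i. w (AV a i) = e"
  shows "homog w (e + x * m) (rho a m $ j)"
proof -
  have "homog w (e + x * m) (AM $ a $ l * mpow XM m $ l $ j)" for l
    using homog_pv[of w "AV a l"] by (intro homog_mult homog_mpow assms) (simp add: AM_def assms)
  then show ?thesis by (auto simp: rho_def matrix_mul_component intro!: homog_sum)
qed

lemma homog_rho: "homog xw m (rho a m $ j)"
  using homog_rho_gen[of xw 1 a 0] by simp

lemma homog_KD_gen:
  assumes "\<And>i j. w (XV i j) = x" "\<And>a i. w (AV a i) = e a"
  shows "homog w (\<Sum>i\<in>UNIV. e (fst (\<tau> i)) + x * snd (\<tau> i)) (KD \<tau>)"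
  unfolding KD_def by (rule homog_det) (simp add: homog_rho_gen assms)

lemma homog_Phi_gen:
  assumes "\<And>i j. w (XV i j) = x" "\<And>a i. w (AV a i) = e a"
  shows "homog w (\<Sum>s<k. \<Sum>i\<in>UNIV. e (fst (t (s, i))) + x * snd (t (s, i))) (Phi k (krow t))"
  unfolding Phi_krow by (rule homog_prod) (auto intro: homog_KD_gen assms)

lemma homog_Phi: "homog xw (\<Sum>s<k. \<Sum>i\<in>UNIV. snd (t (s, i))) (Phi k (krow t))"
  using homog_Phi_gen[of xw 1 "\<lambda>_. 0"] by simp

lemma weightop_lin: "weightop w (f + g) = weightop w f + weightop w g" "weightop w (smul c f) = smul c (weightop w f)"
  by (rule poly_mapping_eqI, simp add: lookup_add algebra_simps)+

lemma hcomp_Pspan: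
  fixes f :: "('n::finite, 'N::finite) pol"
  assumes "f \<in> Pspan k"
  shows "hcomp xw d f \<in> Pspan k"
proof (rule hcomp_in_subspace[OF subspace_Pspan _ assms])
  show "weightop xw f \<in> Pspan k" if "f \<in> Pspan k" for f :: "('n, 'N) pol"
  proof (rule Pspan_closed[OF _ _ _ that])
    fix t :: "nat \<times> 'N \<Rightarrow> 'n \<times> nat"
    show "weightop xw (Phi k (krow t)) \<in> Pspan k"
      using homog_Phi[of t k] unfolding homog_weightop
      by (simp add: polv.subspace_scale[OF subspace_Pspan] Pspan_base)
  qed (rule weightop_lin)+
qed

text \<open>Under the form, A^a X^m B_b moves to the other side as A^b Y^m B_a, which preserves
  \<open>W\<close> by assumption.\<close>

lemma stable_complement:
  assumes W: "W \<subseteq> HN k" "\<And>f a m b. f \<in> W \<Longrightarrow> ABw a (replicate m False) b f \<in> W"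
  shows "stable k {f \<in> HN k. \<forall>w\<in>W. ip f w = 0}"
  unfolding stable_def
proof (intro conjI ballI allI)
  show "polv.subspace {f \<in> HN k. \<forall>w\<in>W. ip f w = 0}"
    by (rule polv.subspaceI) (auto simp: HN_add HN_smul ip_add_left ip_smul_left)
qed (auto simp: HN_T ip_T W)

text \<open>Were the span proper, its complement would be a nonzero stable subspace. It would then
  meet the span in a nonzero element orthogonal to itself.\<close>

theorem HN_eq_Pspan:
  assumes k: "k > 0"
  shows "HN k = (Pspan k :: ('n::finite, 'N::finite) pol set)"
proof (rule ccontr)
  let ?P = "Pspan k :: ('n, 'N) pol set"
  let ?C = "{f \<in> HN k. \<forall>w\<in>?P. ip f w = 0}"
  assume "HN k \<noteq> ?P"
  then obtain f d where f: "f \<in> HN_degree k d" "f \<noteq> 0" "\<And>w. w \<in> ?P \<Longrightarrow> ip f w = 0"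
    using graded_complement[OF subspace_Pspan Pspan_HN hcomp_Pspan, where k = k] by metis
  then have "?C \<noteq> {0}" by (auto simp: HN_degree_iff)
  moreover have "?P \<noteq> {0}"
    using Pspan_base[of k "\<lambda>x. seq0 (snd x)"] v0_nonzero[of k] by (auto simp flip: v0_def)
  moreover have "stable k ?C"
    by (rule stable_complement[OF Pspan_HN Pspan_ABw_Y[OF k]])
  ultimately obtain g where "g \<in> ?P" "g \<in> ?C" "g \<noteq> 0"
    using stable_meet[OF stable_Pspan _ _ _ k, of ?C] by auto
  then show False using ip_self_eq_0[of g] by auto
qed

section \<open>The ground state \<open>v0\<close> generates the space of states\<close>

definition lowb :: "nat \<Rightarrow> ('n::finite, 'N::finite) pol \<Rightarrow> bool"
  where "lowb d f \<longleftrightarrow> (\<forall>m. lk f m \<noteq> 0 \<longrightarrow> d \<le> wdeg xw m)"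

lemma lowb_0 [simp]: "lowb d 0"
  by (simp add: lowb_def)

lemma lowb_any: "lowb 0 f"
  by (simp add: lowb_def)

lemma homog_lowb: "homog xw e f \<Longrightarrow> d \<le> e \<Longrightarrow> lowb d f"
  by (auto simp: lowb_def homog_def)

lemma lowb_add: "lowb d f \<Longrightarrow> lowb d g \<Longrightarrow> lowb d (f + g)"
  unfolding lowb_def lookup_add by (metis add.right_neutral)

lemma lowb_smul: "lowb d f \<Longrightarrow> lowb d (smul c f)"
  by (auto simp: lowb_def)

lemma lowb_sum: "(\<And>i. i \<in> I \<Longrightarrow> lowb d (f i)) \<Longrightarrow> lowb d (\<Sum>i\<in>I. f i)"
  by (induction I rule: infinite_finite_induct) (auto intro: lowb_add)

lemma lowb_mult: 
  assumes "lowb d f" "lowb e g"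
  shows "lowb (d + e) (f * g)"
proof -
  have "\<exists>p q. m = p + q \<and> p \<in> ks f \<and> q \<in> ks g" if "lk (f * g) m \<noteq> 0" for m
    using keys_mult[of f g] that by (auto simp: in_keys_iff)
  then show ?thesis
    using assms unfolding lowb_def by (metis in_keys_iff wdeg_add add_mono)
qed

lemma lowb_mult_left: "lowb d g \<Longrightarrow> lowb d (f * g)"
  and lowb_mult_right: "lowb d g \<Longrightarrow> lowb d (g * f)"
  using lowb_mult[of 0 f d g] lowb_mult[of d g 0 f] by (simp_all add: lowb_any)

lemma lowb_deriv_A: "lowb d f \<Longrightarrow> lowb d (deriv_var (AV b j) f)"
  unfolding lowb_def lookup_deriv_var
proof (intro allI impI)
  fix m assume a: "\<forall>m. lk f m \<noteq> 0 \<longrightarrow> d \<le> wdeg xw m"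
    "of_nat (lk m (AV b j) + 1) * lk f (m + sg (AV b j) 1) \<noteq> 0"
  then have "d \<le> wdeg xw (m + sg (AV b j) 1)" by auto
  then show "d \<le> wdeg xw m" by (simp add: wdeg_add)
qed

lemma lowb_T: "lowb d f \<Longrightarrow> lowb (d + m) (T a m b f)"
  unfolding T_def
  by (intro lowb_sum, subst add.commute, intro lowb_mult lowb_deriv_A)
    (auto intro: homog_lowb[OF homog_rho])

lemma homog_deriv_A: "homog xw d f \<Longrightarrow> homog xw d (deriv_var (AV b j) f)"
  unfolding homog_def lookup_deriv_var
proof (intro allI impI)
  fix m assume a: "\<forall>m. lk f m \<noteq> 0 \<longrightarrow> wdeg xw m = d"
    "of_nat (lk m (AV b j) + 1) * lk f (m + sg (AV b j) 1) \<noteq> 0"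
  then have "wdeg xw (m + sg (AV b j) 1) = d" by auto
  then show "wdeg xw m = d" by (simp add: wdeg_add)
qed

lemma homog_T: "homog xw d f \<Longrightarrow> homog xw (m + d) (T a m b f)"
  unfolding T_def by (intro homog_sum homog_mult homog_deriv_A homog_rho)

lemma ip_lowb: "lowb e f \<Longrightarrow> homog xw d g \<Longrightarrow> d < e \<Longrightarrow> ip f g = 0"
  unfolding ip_def lowb_def homog_def
  by (intro sum.neutral ballI) (metis complex_cnj_zero mult_zero_left mult_zero_right leD)

lemma lowb_prod_diff:
  assumes "finite I" "\<And>i. i \<in> I \<Longrightarrow> lowb d (f i - g i)"
  shows "lowb d ((\<Prod>i\<in>I. f i) - (\<Prod>i\<in>I. g i))"
  using assms
proof (induction I)
  case (insert i I)
  have "(\<Prod>i\<in>insert i I. f i) - (\<Prod>i\<in>insert i I. g i)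
      = f i * ((\<Prod>i\<in>I. f i) - (\<Prod>i\<in>I. g i)) + (f i - g i) * (\<Prod>i\<in>I. g i)"
    using insert(1,2) by (simp add: algebra_simps)
  moreover have "lowb d (f i * ((\<Prod>i\<in>I. f i) - (\<Prod>i\<in>I. g i)))"
    using insert by (intro lowb_mult_left) auto
  moreover have "lowb d ((f i - g i) * (\<Prod>i\<in>I. g i))"
    using insert by (intro lowb_mult_right) auto
  ultimately show ?case by (simp only: lowb_add)
qed simp

lemma lowb_det_diff:
  fixes M M' :: "('n::finite, 'N::finite) pol^'N^'N"
  assumes "\<And>i j. lowb d (M $ i $ j - M' $ i $ j)"
  shows "lowb d (det M - det M')"
proof -
  have "det M - det M' = (\<Sum>p | p permutes UNIV. of_int (sign p) * ((\<Prod>i\<in>UNIV. M $ i $ p i) - (\<Prod>i\<in>UNIV. M' $ i $ p i)))"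
    by (simp add: det_def sum_subtractf right_diff_distrib)
  then show ?thesis
    by (simp add: assms lowb_sum lowb_mult_left lowb_prod_diff)
qed

lemma lowb_power_diff: "lowb d (f - g) \<Longrightarrow> lowb d (f ^ k - g ^ k)"
  using lowb_prod_diff[of "{..<k}" d "\<lambda>_. f" "\<lambda>_. g"] by simp

text \<open>The sum runs over all functions \<open>\<tau>\<close> instead of subsets: non-injective
  ones contribute 0 and each N-element subset is counted N! times, whence the factorial.\<close>

lemma cauchy_binet:
  fixes R \<rho> :: "'z \<Rightarrow> 'r::comm_ring_1^'N"
  assumes J: "finite J"
  shows "of_nat (fact CARD('N)) * det (\<chi> l q. \<Sum>z\<in>J. R z $ l * \<rho> z $ q)
    = (\<Sum>\<tau>\<in>Pi\<^sub>E UNIV (\<lambda>_. J). det (\<chi> i. R (\<tau> i)) * det (\<chi> i. \<rho> (\<tau> i)))"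
proof -
  let ?F = "Pi\<^sub>E (UNIV :: 'N set) (\<lambda>_. J)"
  let ?P = "{\<pi>. \<pi> permutes (UNIV :: 'N set)}"
  let ?g = "\<lambda>\<tau>. (\<Prod>i\<in>UNIV. R (\<tau> i) $ i) * det (\<chi> i. \<rho> (\<tau> i))"
  have 1: "det (\<chi> l q. \<Sum>z\<in>J. R z $ l * \<rho> z $ q) = (\<Sum>\<tau>\<in>?F. ?g \<tau>)"
  proof -
    have "det (\<chi> l q. \<Sum>z\<in>J. R z $ l * \<rho> z $ q)
        = (\<Sum>\<pi>\<in>?P. of_int (sign \<pi>) * (\<Sum>\<tau>\<in>?F. \<Prod>i\<in>UNIV. R (\<tau> i) $ i * \<rho> (\<tau> i) $ \<pi> i))"
      unfolding det_def by (simp add: prod_sum_PiE J)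
    also have "\<dots> = (\<Sum>\<tau>\<in>?F. \<Sum>\<pi>\<in>?P. of_int (sign \<pi>) * (\<Prod>i\<in>UNIV. R (\<tau> i) $ i * \<rho> (\<tau> i) $ \<pi> i))"
      unfolding sum_distrib_left by (rule sum.swap)
    also have "\<dots> = (\<Sum>\<tau>\<in>?F. ?g \<tau>)"
      by (simp add: det_def sum_distrib_left prod.distrib mult_ac)
    finally show ?thesis .
  qed
  \<comment> \<open>Composing \<open>\<tau>\<close> with a permutation permutes the index set and
    changes the second determinant by the sign. Hence every permutation contributes the same sum,
    and adding over all of them completes the first factor to a determinant.\<close>
  have 2: "(\<Sum>\<tau>\<in>?F. of_int (sign \<pi>) * (\<Prod>i\<in>UNIV. R (\<tau> i) $ \<pi> i) * det (\<chi> i. \<rho> (\<tau> i))) = (\<Sum>\<tau>\<in>?F. ?g \<tau>)"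
    if \<pi>: "\<pi> permutes UNIV" for \<pi> :: "'N \<Rightarrow> 'N"
  proof (rule sum.reindex_bij_witness[of _ "\<lambda>\<tau>. \<tau> \<circ> \<pi>" "\<lambda>\<tau>. \<tau> \<circ> inv_into UNIV \<pi>"])
    fix \<tau> assume "\<tau> \<in> ?F"
    show "\<tau> \<circ> inv_into UNIV \<pi> \<circ> \<pi> = \<tau>" by (simp add: comp_assoc permutes_inv_o(2)[OF \<pi>])
    have "(\<Prod>i\<in>UNIV. R (\<tau> i) $ \<pi> i) = (\<Prod>i\<in>UNIV. R ((\<tau> \<circ> inv_into UNIV \<pi>) i) $ i)"
      by (subst prod.permute[OF permutes_inv[OF \<pi>]]) (simp add: permutes_inverses[OF \<pi>] comp_def)
    moreover have "det (\<chi> i. \<rho> (\<tau> i)) = of_int (sign \<pi>) * det (\<chi> i. \<rho> ((\<tau> \<circ> inv_into UNIV \<pi>) i))"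
      using det_permute_rows[OF \<pi>, of "\<chi> i. \<rho> ((\<tau> \<circ> inv_into UNIV \<pi>) i)"] by (simp add: permutes_inverses[OF \<pi>])
    moreover have "s * P * (s * d) = P * d" if "s * s = 1" for s P d :: 'r
      using arg_cong[OF that, of "\<lambda>x. x * (P * d)"] by (simp only: mult_ac mult_1_left)
    moreover have "of_int (sign \<pi>) * of_int (sign \<pi>) = (1 :: 'r)"
      by (simp flip: of_int_mult)
    ultimately show "?g (\<tau> \<circ> inv_into UNIV \<pi>) = of_int (sign \<pi>) * (\<Prod>i\<in>UNIV. R (\<tau> i) $ \<pi> i) * det (\<chi> i. \<rho> (\<tau> i))"
      by (simp only:)
  qed (auto simp: comp_assoc permutes_inv_o[OF \<pi>])
  have "(\<Sum>\<tau>\<in>?F. det (\<chi> i. R (\<tau> i)) * det (\<chi> i. \<rho> (\<tau> i)))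
      = (\<Sum>\<pi>\<in>?P. \<Sum>\<tau>\<in>?F. of_int (sign \<pi>) * (\<Prod>i\<in>UNIV. R (\<tau> i) $ \<pi> i) * det (\<chi> i. \<rho> (\<tau> i)))"
    unfolding det_def[of "\<chi> i. R (_ i)"] sum_distrib_right by (subst sum.swap) simp
  also have "\<dots> = (\<Sum>\<pi>\<in>?P. \<Sum>\<tau>\<in>?F. ?g \<tau>)"
    by (intro sum.cong refl 2) simp
  also have "\<dots> = of_nat (fact CARD('N)) * det (\<chi> l q. \<Sum>z\<in>J. R z $ l * \<rho> z $ q)"
    by (simp add: 1 card_permutations)
  finally show ?thesis by simp
qed

text \<open>Conjugation of coefficients. Krylov products have real coefficients and are fixed by it,
  so a linear relation between them may be conjugated.\<close>

definition cj :: "('n::finite, 'N::finite) pol \<Rightarrow> ('n, 'N) pol"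
  where "cj = psub (\<lambda>c. pc (cnj c)) pv"

lemma coeff_hom_cj: "coeff_hom (\<lambda>c. pc (cnj c))"
  by (rule coeff_hom.intro) (simp_all add: pc_add pc_mult)

global_interpretation cj_hom: coeff_hom "\<lambda>c. pc (cnj c)" by (rule coeff_hom_cj)

lemma cj_mpow: "cj (mpow XM m $ i $ j) = mpow XM m $ i $ j"
  by (induction m arbitrary: i)
    (simp_all add: cj_def mat_def matrix_mul_component cj_hom.psub_sum cj_hom.psub_mult XM_def)

lemma cj_rho: "cj (rho a m $ j) = rho a m $ j"
  by (simp add: cj_mpow[unfolded cj_def] cj_def rho_def matrix_mul_component cj_hom.psub_sum cj_hom.psub_mult AM_def)

lemma cj_Phi: "cj (Phi k (krow t)) = Phi k (krow t)"
  by (simp add: cj_rho[unfolded cj_def] cj_def Phi_def cj_hom.psub_prod cj_hom.psub_det krow_def)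

text \<open>The hypothesis says that the Krylov products satisfy a linear relation whose
  coefficients are their own pairings with \<open>f\<close>. Conjugating this relation and pairing
  it with \<open>f\<close> gives a vanishing sum of squared absolute values.\<close>

lemma eval_zero_imp_coeffs_orthogonal:
  fixes f :: "('n::finite, 'N::finite) pol"
  assumes fin: "finite I" and nz: "h \<noteq> 0"
    and zero: "\<And>X A. eval_pol h X A \<noteq> 0 \<Longrightarrow> (\<Sum>\<alpha>\<in>I. eval_pol (Phi k (krow (t \<alpha>))) X A * ip (Phi k (krow (t \<alpha>))) f) = 0"
    and "\<alpha> \<in> I"
  shows "ip (Phi k (krow (t \<alpha>))) f = 0"
proof -
  let ?b = "\<lambda>\<alpha>. ip (Phi k (krow (t \<alpha>))) f"
  let ?z = "(\<Sum>\<alpha>\<in>I. smul (?b \<alpha>) (Phi k (krow (t \<alpha>))))"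
  have "?z = 0"
    by (rule pol_eqI_generic[OF nz]) (simp add: eval_sum eval_smul zero[unfolded mult.commute[of "eval_pol _ _ _"]])
  then have "cj ?z = 0" by (simp add: cj_def)
  moreover have "cj (smul c g) = smul (cnj c) (cj g)" for c and g :: "('n, 'N) pol"
    by (simp add: cj_def smul_pc cj_hom.psub_mult)
  ultimately have "(\<Sum>\<alpha>\<in>I. smul (cnj (?b \<alpha>)) (cj (Phi k (krow (t \<alpha>))))) = 0"
    by (simp add: cj_def cj_hom.psub_sum)
  then have "(\<Sum>\<alpha>\<in>I. smul (cnj (?b \<alpha>)) (Phi k (krow (t \<alpha>)))) = 0"
    by (simp add: cj_Phi)
  then have "ip (\<Sum>\<alpha>\<in>I. smul (cnj (?b \<alpha>)) (Phi k (krow (t \<alpha>)))) f = 0" by simp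
  then have "(\<Sum>\<alpha>\<in>I. cnj (?b \<alpha>) * ?b \<alpha>) = 0"
    by (simp add: ip_sum_left ip_smul_left)
  moreover have "(\<Sum>\<alpha>\<in>I. cnj (?b \<alpha>) * ?b \<alpha>) = of_real (\<Sum>\<alpha>\<in>I. (cmod (?b \<alpha>))\<^sup>2)"
    unfolding of_real_sum by (intro sum.cong refl) (simp only: complex_norm_square mult.commute)
  ultimately have "complex_of_real (\<Sum>\<alpha>\<in>I. (cmod (?b \<alpha>))\<^sup>2) = 0" by (simp only:)
  then have "(\<Sum>\<alpha>\<in>I. (cmod (?b \<alpha>))\<^sup>2) = 0" by (simp only: of_real_eq_0_iff)
  then have "\<forall>\<alpha>\<in>I. (cmod (?b \<alpha>))\<^sup>2 = 0"
    by (subst (asm) sum_nonneg_eq_0_iff) (auto simp: fin)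
  then show ?thesis using \<open>\<alpha> \<in> I\<close> by simp
qed

section \<open>The truncated reproducing kernel\<close>

definition krp :: "complex^'N^'N \<Rightarrow> complex^'N^'n \<Rightarrow> 'n \<times> nat \<Rightarrow> complex^'N::finite"
  where "krp X A z = (A ** mpow X (snd z)) $ fst z"

text \<open>A sum of column times row over the Krylov rows of order at most d, the column taken at
  the point (X, A). By Cauchy-Binet, (N!)^k times the k-th power of its determinant is the sum of
  all Krylov products of this order, each multiplied by its value at the point.\<close>

definition Kker :: "complex^'N^'N \<Rightarrow> complex^'N^'n \<Rightarrow> nat \<Rightarrow> ('n::finite, 'N::finite) pol^'N^'N"
  where "Kker X A d = (\<chi> l q. \<Sum>z\<in>UNIV \<times> {..d}. pc (krp X A z $ l) * rho (fst z) (snd z) $ q)"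

lemma pc_sum: "pc (\<Sum>i\<in>I. f i) = (\<Sum>i\<in>I. pc (f i))"
  by (induction I rule: infinite_finite_induct) (simp_all add: pc_add)

lemma pc_prod: "pc (\<Prod>i\<in>I. f i) = (\<Prod>i\<in>I. pc (f i))"
  by (induction I rule: infinite_finite_induct) (simp_all add: pc_mult)

lemma pc_of_int: "pc (of_int c) = of_int c"
  by (simp add: pc_def)

lemma det_pc: "det (\<chi> i j. pc (M $ i $ j)) = pc (det M)"
  by (simp add: det_def pc_of_int pc_sum pc_prod pc_mult)

text \<open>Expanding the kernel turns the hypothesis into the relation of
  \<open>eval_zero_imp_coeffs_orthogonal\<close>, which covers rows of order at most d. A product
  with a row of higher order has energy above d and is orthogonal to \<open>f\<close> for this
  reason.\<close>

lemma Pspan_orthogonal: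
  fixes f :: "('n::finite, 'N::finite) pol"
  assumes f: "homog xw d f" and h: "h \<noteq> 0"
    and zero: "\<And>X A. eval_pol h X A \<noteq> 0 \<Longrightarrow> ip (det (Kker X A d) ^ k) f = 0"
    and g: "g \<in> Pspan k"
  shows "ip g f = 0"
proof -
  let ?J = "UNIV \<times> {..d} :: ('n \<times> nat) set"
  let ?F = "Pi\<^sub>E (UNIV :: 'N set) (\<lambda>_. ?J)"
  let ?I = "Pi\<^sub>E {..<k} (\<lambda>_. ?F)"
  let ?t = "\<lambda>\<alpha> x. \<alpha> (fst x) (snd x)"
  have finF: "finite ?F" by (intro finite_PiE) auto
  then have finI: "finite ?I" by (intro finite_PiE) auto
  have 1: "of_nat (fact CARD('N)) * det (Kker X A d) = (\<Sum>\<tau>\<in>?F. pc (det (KM \<tau> X A)) * KD \<tau>)" for X A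
  proof -
    have "of_nat (fact CARD('N)) * det (Kker X A d)
        = (\<Sum>\<tau>\<in>?F. det (\<chi> i. \<chi> l. pc (krp X A (\<tau> i) $ l)) * det (\<chi> i. rho (fst (\<tau> i)) (snd (\<tau> i))))"
      using cauchy_binet[of ?J "\<lambda>z. \<chi> l. pc (krp X A z $ l)" "\<lambda>z. rho (fst z) (snd z)"]
      by (simp add: Kker_def)
    also have "\<dots> = (\<Sum>\<tau>\<in>?F. pc (det (KM \<tau> X A)) * KD \<tau>)"
    proof (intro sum.cong refl)
      fix \<tau>
      have "det (\<chi> i. \<chi> l. pc (krp X A (\<tau> i) $ l)) = (pc (det (KM \<tau> X A)) :: ('n, 'N) pol)"
        using det_pc[of "KM \<tau> X A"] by (simp add: KM_def krp_def)
      then show "det (\<chi> i. \<chi> l. pc (krp X A (\<tau> i) $ l)) * det (\<chi> i. rho (fst (\<tau> i)) (snd (\<tau> i))) = pc (det (KM \<tau> X A)) * KD \<tau>"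
        by (simp add: KD_def)
    qed
    finally show ?thesis .
  qed
  have 2: "of_nat (fact CARD('N)) ^ k * det (Kker X A d) ^ k
      = (\<Sum>\<alpha>\<in>?I. smul (eval_pol (Phi k (krow (?t \<alpha>))) X A) (Phi k (krow (?t \<alpha>))))" for X A
  proof -
    have "of_nat (fact CARD('N)) ^ k * det (Kker X A d) ^ k = (\<Prod>s<k. \<Sum>\<tau>\<in>?F. pc (det (KM \<tau> X A)) * KD \<tau>)"
      unfolding 1[symmetric] by (simp add: power_mult_distrib)
    also have "\<dots> = (\<Sum>\<alpha>\<in>?I. \<Prod>s<k. pc (det (KM (\<alpha> s) X A)) * KD (\<alpha> s))"
      by (intro prod_sum_PiE finF) simp
    also have "\<dots> = (\<Sum>\<alpha>\<in>?I. smul (eval_pol (Phi k (krow (?t \<alpha>))) X A) (Phi k (krow (?t \<alpha>))))"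
    proof (intro sum.cong refl)
      fix \<alpha>
      show "(\<Prod>s<k. pc (det (KM (\<alpha> s) X A)) * KD (\<alpha> s)) = smul (eval_pol (Phi k (krow (?t \<alpha>))) X A) (Phi k (krow (?t \<alpha>)))"
        by (simp add: Phi_krow eval_prod eval_KD smul_pc prod.distrib pc_prod)
    qed
    finally show ?thesis .
  qed
  have 3: "(\<Sum>\<alpha>\<in>?I. eval_pol (Phi k (krow (?t \<alpha>))) X A * ip (Phi k (krow (?t \<alpha>))) f) = 0"
    if "eval_pol h X A \<noteq> 0" for X A
  proof -
    have "(of_nat (fact CARD('N)) ^ k :: ('n, 'N) pol) = pc (of_nat (fact CARD('N)) ^ k)"
      by (metis of_nat_power pc_def single_of_nat)
    then have "ip (of_nat (fact CARD('N)) ^ k * det (Kker X A d) ^ k) f = 0"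
      using zero[OF that] by (simp add: ip_smul_left flip: smul_pc)
    then show ?thesis unfolding 2 by (simp add: ip_sum_left ip_smul_left)
  qed
  have "ip (Phi k (krow t)) f = 0" for t :: "nat \<times> 'N \<Rightarrow> 'n \<times> nat"
  proof (cases "\<forall>s<k. \<forall>i. snd (t (s, i)) \<le> d")
    case True
    define \<alpha> where "\<alpha> = restrict (\<lambda>s i. t (s, i)) {..<k}"
    have "\<alpha> \<in> ?I" using True by (auto simp: \<alpha>_def mem_Times_iff)
    from eval_zero_imp_coeffs_orthogonal[OF finI h 3 this]
    have "ip (Phi k (krow (?t \<alpha>))) f = 0" by simp
    moreover have "Phi k (krow (?t \<alpha>)) = Phi k (krow t)"
      by (auto simp: Phi_krow \<alpha>_def intro!: prod.cong)
    ultimately show ?thesis by simp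
  next
    case False
    then obtain s i where si: "s < k" "d < snd (t (s, i))" by (auto simp: not_le)
    have "snd (t (s, i)) \<le> (\<Sum>i\<in>UNIV. snd (t (s, i)))" by (rule member_le_sum) auto
    also have "\<dots> \<le> (\<Sum>s<k. \<Sum>i\<in>UNIV. snd (t (s, i)))"
      using si by (intro member_le_sum[of s "{..<k}" "\<lambda>s. \<Sum>i\<in>UNIV. snd (t (s, i))"]) auto
    finally show ?thesis
      using ip_homog[OF homog_Phi f, of t k] si by simp
  qed
  then have "ip f x = 0" if "x \<in> {Phi k (krow t) | t. True}" for x
    using that by (auto simp: ip_commute[of f])
  then have "ip f g = 0"
    using g unfolding Pspan_def by (rule ip_span_right)
  then show ?thesis by (simp add: ip_commute[of g])
qed

section \<open>Dual Krylov columns and the substitution that approximates the kernel\<close>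

definition dot :: "complex^'N::finite \<Rightarrow> complex^'N \<Rightarrow> complex"
  where "dot r c = (\<Sum>l\<in>UNIV. r $ l * c $ l)"

lemma dot_krp_mpow: "dot (krp X A (a, m)) (mpow X s *v w) = dot (krp X A (a, m + s)) w"
proof -
  have "dot (krp X A (a, m)) (mpow X s *v w) = (\<Sum>l\<in>UNIV. \<Sum>j\<in>UNIV. krp X A (a, m) $ l * mpow X s $ l $ j * w $ j)"
    by (simp add: dot_def matrix_vector_mult_def sum_distrib_left mult.assoc)
  also have "\<dots> = (\<Sum>j\<in>UNIV. (\<Sum>l\<in>UNIV. krp X A (a, m) $ l * mpow X s $ l $ j) * w $ j)"
    by (subst sum.swap) (simp add: sum_distrib_right)
  also have "\<dots> = dot (krp X A (a, m + s)) w"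
    by (simp add: dot_def krp_def mpow_add matrix_mul_assoc matrix_mul_component[of "A ** mpow X m"])
  finally show ?thesis .
qed

lemma subG_mult: "subG y (f * g) = subG y f * subG y g"
  and subG_sum: "subG y (\<Sum>i\<in>I. F i) = (\<Sum>i\<in>I. subG y (F i))"
  by (simp_all add: subG_def pc_hom.psub_mult pc_hom.psub_sum)

lemma subG_mpow: "subG y (mpow XM m $ i $ j) = mpow XM m $ i $ j"
proof (induction m arbitrary: i)
  case 0
  then show ?case by (simp add: subG_def mat_def)
next
  case (Suc m)
  have "subG y (XM $ i $ l) = XM $ i $ l" for l
    by (simp add: subG_def XM_def)
  then show ?case by (simp add: matrix_mul_component subG_sum subG_mult Suc)
qed

lemma subG_rho: "subG y (rho b j $ q) = (\<Sum>a\<in>UNIV. rowp (y $ a $ b * monom 1 j) a q)"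
proof -
  have "subG y (AM $ b $ l) = GA y b l" for l :: 'b
    by (simp add: subG_def AM_def)
  then have "subG y (rho b j $ q) = (\<Sum>l\<in>UNIV. GA y b l * mpow XM j $ l $ q)"
    by (simp add: rho_def matrix_mul_component subG_sum subG_mult subG_mpow)
  also have "\<dots> = (\<Sum>a\<in>UNIV. rowp (y $ a $ b * monom 1 j) a q)"
    unfolding GA_def rowp_mult_monom sum_distrib_right by (rule sum.swap)
  finally show ?thesis .
qed

text \<open>
  At a point where the Krylov rows \<open>A\<^sup>aX\<^sup>m\<close> of lowest index form a basis, the columns \<open>c\<^sub>i\<close> are chosen
  with \<open>A\<^sup>aX\<^sup>m c\<^sub>i = 0\<close> for rows of index below \<open>i\<close>, \<open>= 1\<close> for index \<open>i\<close>, and \<open>X c\<^sub>i = c\<^bsub>i-n\<^esub>\<close>.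
\<close>

lemma dual_krylov_basis:
  fixes X :: "complex^'N^'N::finite" and A :: "complex^'N^'n::finite"
  assumes nz: "eval_pol (KD (seq0 :: 'N \<Rightarrow> 'n \<times> nat)) X A \<noteq> 0"
  obtains c :: "'N \<Rightarrow> complex^'N" where
    "\<And>a m i. ix (a :: 'n) + CARD('n) * m \<le> ix i \<Longrightarrow> dot (krp X A (a, m)) (c i) = (if ix a + CARD('n) * m = ix i then 1 else 0)"
    "\<And>i b j i0 a m. seq0 i = (b :: 'n, j) \<Longrightarrow> ix i0 = ix b \<Longrightarrow> dot (krp X A (a, m)) (c i0) = dot (krp X A (a, m + j)) (c i)"
    "det (\<chi> i l. c i $ l) \<noteq> 0"
proof -
  let ?N = "CARD('N)" and ?n = "CARD('n)"
  let ?Q = "KM seq0 X A"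
  have "invertible ?Q" using nz by (simp add: eval_KD invertible_det_nz)
  note inv = matrix_inv_works[OF this]
  \<comment> \<open>\<open>top i\<close> is the last position congruent to \<open>ix i\<close>
    modulo n, reached after \<open>s i\<close> steps of length n. Applying X^(s i) to the true dual
    column of \<open>top i\<close> relates all columns of a residue class by X, and keeps duality
    with the rows of index at most \<open>ix i\<close>.\<close>
  define s where "s i = (?N - 1 - ix i) div ?n" for i :: 'N
  define top where "top i = (SOME l :: 'N. ix l = ix i + ?n * s i)" for i :: 'N
  have le: "ix i + ?n * s i < ?N" for i :: 'N
  proof -
    have "?n * s i \<le> ?N - 1 - ix i" unfolding s_def by simp
    then show ?thesis using ix_less[of i] by linarith
  qed
  have top: "ix (top i) = ix i + ?n * s i" for i
    unfolding top_def by (rule someI_ex) (rule ex_ix[OF le])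
  define c where "c i = mpow X (s i) *v (matrix_inv ?Q *v axis (top i) 1)" for i
  have dotQ: "dot (krp X A (a, m)) (matrix_inv ?Q *v axis t 1) = (if l = t then 1 else 0)"
    if "ix l = ix a + ?n * m" for a m l t
  proof -
    have "seq0 l = (a, m)" using that by (simp add: seq0_eq)
    then have "krp X A (a, m) = ?Q $ l" by (simp add: krp_def KM_def)
    then have "dot (krp X A (a, m)) (matrix_inv ?Q *v axis t 1) = (?Q ** matrix_inv ?Q) $ l $ t"
      by (simp add: dot_def matrix_mul_component matrix_vector_mult_def axis_def if_distrib cong: if_cong)
    then show ?thesis by (simp add: inv mat_def)
  qed
  have c1: "dot (krp X A (a, m)) (c i) = (if ix a + ?n * m = ix i then 1 else 0)" if "ix a + ?n * m \<le> ix i" for a m i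
  proof -
    have "ix a + ?n * (m + s i) \<le> ix (top i)" using that by (simp add: top distrib_left)
    then obtain l :: 'N where l: "ix l = ix a + ?n * (m + s i)"
      using ex_ix[of "ix a + ?n * (m + s i)"] ix_less[of "top i"] by (metis le_less_trans)
    have "l = top i \<longleftrightarrow> ix l = ix (top i)" by simp
    then show ?thesis
      by (simp only: c_def dot_krp_mpow dotQ[OF l]) (simp only: l top distrib_left add.assoc[symmetric] add_right_cancel)
  qed
  have c2: "dot (krp X A (a, m)) (c i0) = dot (krp X A (a, m + j)) (c i)"
    if "seq0 i = (b :: 'n, j)" "ix i0 = ix b" for i b j i0 a m
  proof -
    have i: "ix i = ix i0 + ?n * j" using that by (simp add: seq0_eq)
    have "?N - 1 - ix i0 = ?N - 1 - ix i + ?n * j" using ix_less[of i] i by linarith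
    then have s: "s i0 = s i + j" unfolding s_def by simp
    then have "ix (top i0) = ix (top i)" by (simp only: top i distrib_left add_ac)
    then have "top i0 = top i" by simp
    then show ?thesis
      by (simp add: c_def dot_krp_mpow s add_ac)
  qed
  \<comment> \<open>Triangularity: in a linear relation between the columns, pairing with row i
    isolates the i-th coefficient once those of smaller index are known to vanish.\<close>
  have "det (\<chi> i l. c i $ l) \<noteq> 0"
  proof -
    let ?C = "(\<chi> i l. c i $ l) :: complex^'N^'N"
    have "x = 0" if x: "transpose ?C *v x = 0" for x
    proof -
      have xc: "(\<Sum>t\<in>UNIV. x $ t * c t $ l) = 0" for l
        using arg_cong[OF x, of "\<lambda>v. v $ l"] by (simp add: matrix_vector_mult_def transpose_def mult.commute)
      have "x $ i = 0" for i
      proof (induction "ix i" arbitrary: i rule: less_induct)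
        case less
        obtain a m where am: "seq0 i = (a :: 'n, m)" by fastforce
        then have u: "ix i = ix a + ?n * m" by (simp add: seq0_eq)
        have "0 = (\<Sum>l\<in>UNIV. krp X A (a, m) $ l * (\<Sum>t\<in>UNIV. x $ t * c t $ l))"
          by (simp add: xc)
        also have "\<dots> = (\<Sum>t\<in>UNIV. x $ t * dot (krp X A (a, m)) (c t))"
          unfolding dot_def sum_distrib_left by (subst sum.swap) (simp add: mult_ac)
        also have "\<dots> = (\<Sum>t\<in>UNIV. if t = i then x $ i else 0)"
        proof (intro sum.cong refl)
          fix t
          show "x $ t * dot (krp X A (a, m)) (c t) = (if t = i then x $ i else 0)"
          proof (cases "ix t < ix i")
            case True
            then show ?thesis using less[of t] by auto
          next
            case False
            then have "dot (krp X A (a, m)) (c t) = (if ix i = ix t then 1 else 0)"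
              using c1[of a m t] u by simp
            then show ?thesis by auto
          qed
        qed
        finally show ?case by simp
      qed
      then show ?thesis by (simp add: vec_eq_iff)
    qed
    then have "\<exists>B. B ** transpose ?C = mat 1"
      by (simp add: matrix_left_invertible_ker)
    then have "invertible (transpose ?C)" by (simp add: invertible_left_inverse)
    then show ?thesis by (simp add: invertible_det_nz)
  qed
  then show ?thesis
    by (rule that[of c, rotated 2]) (rule c1, assumption, rule c2, assumption+)
qed

lemma sum_shift_truncate:
  fixes g :: "nat \<Rightarrow> 'a::ab_group_add"
  assumes "\<And>m. m < j \<Longrightarrow> g m = 0"
  shows "(\<Sum>m\<le>d. g (m + j)) - (\<Sum>m\<le>d. g m) = (\<Sum>m\<in>{d<..d + j}. g m)"
proof -
  have "(\<Sum>m\<le>d. g (m + j)) = (\<Sum>m\<in>{j..d + j}. g m)"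
    by (rule sum.reindex_bij_witness[of _ "\<lambda>m. m - j" "\<lambda>m. m + j"]) auto
  also have "\<dots> = (\<Sum>m\<le>d + j. g m)"
    by (rule sum.mono_neutral_left) (auto simp: assms)
  also have "\<dots> = (\<Sum>m\<le>d. g m) + (\<Sum>m\<in>{d<..d + j}. g m)"
    by (subst sum.union_disjoint[symmetric]) (auto intro: sum.cong)
  finally show ?thesis by simp
qed

text \<open>The entries of \<open>y\<close> are the power series of pairings of A^a X^m with dual
  columns, cut off at order d. Substitution in A^b X^j shifts the series by j; since X^j c_i is the
  column for j = 0 and the pairings of c_i with orders below j vanish, the result agrees with c_i
  times \<open>Kker\<close> up to energy d. The determinant of the columns is the constant
  \<open>e\<close>.\<close>

lemma subG_KD_seq0:
  fixes X :: "complex^'N^'N::finite" and A :: "complex^'N^'n::finite"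
  assumes nz: "eval_pol (KD (seq0 :: 'N \<Rightarrow> 'n \<times> nat)) X A \<noteq> 0"
  obtains y :: "'n glz" and e where "e \<noteq> 0"
    "lowb (Suc d) (subG y (KD (seq0 :: 'N \<Rightarrow> 'n \<times> nat)) - pc e * det (Kker X A d))"
proof -
  let ?N = "CARD('N)" and ?n = "CARD('n)"
  obtain c :: "'N \<Rightarrow> complex^'N" where
    c1: "\<And>a m i. ix (a :: 'n) + ?n * m \<le> ix i \<Longrightarrow> dot (krp X A (a, m)) (c i) = (if ix a + ?n * m = ix i then 1 else 0)" and
    c2: "\<And>i b j i0 a m. seq0 i = (b :: 'n, j) \<Longrightarrow> ix i0 = ix b \<Longrightarrow> dot (krp X A (a, m)) (c i0) = dot (krp X A (a, m + j)) (c i)" and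
    c3: "det (\<chi> i l. c i $ l) \<noteq> 0"
    by (rule dual_krylov_basis[OF nz]) blast
  \<comment> \<open>For n > N some \<open>b\<close> have no position; \<open>i0 b\<close> is then
    arbitrary, but such \<open>b\<close> do not occur in \<open>seq0\<close>.\<close>
  define i0 where "i0 b = (SOME l :: 'N. ix l = ix b)" for b :: 'n
  define y :: "'n glz" where "y = (\<chi> a b. \<Sum>m\<le>d. monom (dot (krp X A (a, m)) (c (i0 b))) m)"
  define h where "h i a m = (pc (dot (krp X A (a, m)) (c i)) :: ('n, 'N) pol)" for i a m
  let ?M = "(\<chi> i q. subG y (rho (fst (seq0 i)) (snd (seq0 i :: 'n \<times> nat)) $ q)) :: ('n, 'N) pol^'N^'N"
  let ?C = "(\<chi> i l. pc (c i $ l)) :: ('n, 'N) pol^'N^'N"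
  have entry: "lowb (Suc d) (?M $ i $ q - (?C ** Kker X A d) $ i $ q)" for i q
  proof -
    obtain b j where bj: "seq0 i = (b :: 'n, j)" by fastforce
    then have ixi: "ix i = ix b + ?n * j" by (simp add: seq0_eq)
    then have ixb: "ix b < ?N" using ix_less[of i] by simp
    have i0: "ix (i0 b) = ix b" unfolding i0_def by (rule someI_ex, rule ex_ix[OF ixb])
    have "?M $ i $ q = (\<Sum>a\<in>UNIV. \<Sum>m\<le>d. h i a (m + j) * rho a (m + j) $ q)"
      by (simp add: bj subG_rho y_def sum_distrib_right mult_monom rowp_sum rowp_monom c2[OF bj i0] h_def)
    moreover have "(?C ** Kker X A d) $ i $ q = (\<Sum>a\<in>UNIV. \<Sum>m\<le>d. h i a m * rho a m $ q)"
    proof -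
      have "(?C ** Kker X A d) $ i $ q
          = (\<Sum>l\<in>UNIV. \<Sum>z\<in>UNIV \<times> {..d}. pc (krp X A z $ l * c i $ l) * rho (fst z) (snd z) $ q)"
        by (simp add: matrix_mul_component Kker_def sum_distrib_left pc_mult mult_ac)
      also have "\<dots> = (\<Sum>z\<in>UNIV \<times> {..d}. pc (dot (krp X A z) (c i)) * rho (fst z) (snd z) $ q)"
        by (subst sum.swap) (simp add: dot_def pc_sum sum_distrib_right)
      finally show ?thesis by (simp add: h_def sum.cartesian_product case_prod_unfold)
    qed
    moreover have h0: "h i a m = 0" if "m < j" for a m
    proof -
      have "?n * Suc m \<le> ?n * j" using that by (intro mult_le_mono2) simp
      then have "ix a + ?n * m < ix i" using ix_less[of a] ixi unfolding mult_Suc_right by linarith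
      then show ?thesis using c1[of a m i] by (simp add: h_def)
    qed
    ultimately have "?M $ i $ q - (?C ** Kker X A d) $ i $ q = (\<Sum>a\<in>UNIV. \<Sum>m\<in>{d<..d + j}. h i a m * rho a m $ q)"
    proof -
      have "(\<Sum>m\<le>d. h i a (m + j) * rho a (m + j) $ q) - (\<Sum>m\<le>d. h i a m * rho a m $ q)
          = (\<Sum>m\<in>{d<..d + j}. h i a m * rho a m $ q)" for a
        by (rule sum_shift_truncate) (simp add: h0)
      then show ?thesis
        unfolding \<open>?M $ i $ q = _\<close> \<open>(?C ** Kker X A d) $ i $ q = _\<close> sum_subtractf[symmetric] by simp
    qed
    then show ?thesis
      by (auto intro!: lowb_sum lowb_mult_left intro: homog_lowb[OF homog_rho])
  qed
  have "subG y (KD seq0) = det ?M"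
    unfolding KD_def subG_def pc_hom.psub_det by simp
  moreover have "det (?C ** Kker X A d) = pc (det (\<chi> i l. c i $ l)) * det (Kker X A d)"
    using det_pc[of "\<chi> i l. c i $ l", where ?'a = 'n and ?'b = 'N] by (simp add: det_mul)
  ultimately have "lowb (Suc d) (subG y (KD seq0) - pc (det (\<chi> i l. c i $ l)) * det (Kker X A d))"
    using lowb_det_diff[OF entry] by simp
  then show ?thesis using that c3 by blast
qed

lemma pc_power: "pc (c ^ k) = pc c ^ k"
  by (induction k) (simp_all add: pc_mult)

theorem stable_v0:
  fixes W :: "('n::finite, 'N::finite) pol set"
  assumes W: "stable k W" and k: "k > 0" and v0: "v0 k \<in> W"
  shows "W = HN k"
proof (rule ccontr)
  assume neq: "W \<noteq> HN k"
  have sub: "polv.subspace W" and WHN: "W \<subseteq> HN k" using W by (auto simp: stable_def)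
  \<comment> \<open>\<open>W\<close> is not known to be graded, as \<open>graded_complement\<close>
    requires. The span of its homogeneous elements is graded, still stable, and contains the
    homogeneous \<open>v0 k\<close>.\<close>
  let ?G = "{f \<in> W. \<exists>d. homog xw d f}"
  let ?W' = "polv.span ?G"
  have W'W: "?W' \<subseteq> W" by (rule polv.span_minimal[OF _ sub]) auto
  have closed: "F f \<in> ?W'" if "\<And>f g. F (f + g) = F f + F g" "\<And>c f. F (smul c f) = smul c (F f)"
    "\<And>f. f \<in> ?G \<Longrightarrow> F f \<in> ?W'" "f \<in> ?W'" for F :: "('n, 'N) oper" and f
  proof -
    have "F 0 = 0" using that(2)[of 0 0] by (simp add: smul_pc)
    then have "polv.subspace {f. F f \<in> ?W'}"
      by (intro polv.subspaceI) (auto simp: that(1,2) polv.span_zero polv.span_add polv.span_scale)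
    then have "?W' \<subseteq> {f. F f \<in> ?W'}"
      by (intro polv.span_minimal) (use that(3) in auto)
    then show ?thesis using that(4) by blast
  qed
  have W': "stable k ?W'"
    unfolding stable_def
  proof (intro conjI ballI allI)
    fix f :: "('n, 'N) pol" and a m b assume f: "f \<in> ?W'"
    show "T a m b f \<in> ?W'"
    proof (rule closed[OF _ _ _ f])
      fix g :: "('n, 'N) pol" assume g: "g \<in> ?G"
      then have "T a m b g \<in> W" using W by (simp add: stable_def)
      with g show "T a m b g \<in> ?W'" by (intro polv.span_base) (auto intro: homog_T)
    qed (rule T.D_add T_smul)+
  qed (use W'W WHN in \<open>auto simp: polv.subspace_span\<close>)
  have graded: "hcomp xw d f \<in> ?W'" if "f \<in> ?W'" for d f
  proof (rule closed[OF _ _ _ that])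
    fix g :: "('n, 'N) pol" assume "g \<in> ?G"
    then show "hcomp xw d g \<in> ?W'" 
      using polv.span_base[of g ?G] hcomp_homog[of xw _ g d] by (auto simp: polv.span_zero)
  qed (rule hcomp_add hcomp_smul)+
  have neq': "?W' \<noteq> HN k" using neq W'W WHN by auto
  have W'HN: "?W' \<subseteq> HN k" using W'W WHN by (rule subset_trans)
  obtain f d where f: "f \<in> HN_degree k d" "f \<noteq> 0" "\<And>w. w \<in> ?W' \<Longrightarrow> ip f w = 0"
    by (rule graded_complement[OF polv.subspace_span W'HN graded neq']) (assumption | rule that)+
  have fd: "homog xw d f" "f \<in> HN k" using f(1) by (auto simp: HN_degree_iff)
  have v0': "v0 k \<in> ?W'"
    using v0 homog_Phi unfolding v0_def by (intro polv.span_base) blast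
  have "ip (det (Kker X A d) ^ k) f = 0" if nz: "eval_pol (KD (seq0 :: 'N \<Rightarrow> 'n \<times> nat)) X A \<noteq> 0" for X A
  proof -
    obtain y :: "'n glz" and e where e: "e \<noteq> 0"
      "lowb (Suc d) (subG y (KD (seq0 :: 'N \<Rightarrow> 'n \<times> nat)) - pc e * det (Kker X A d))"
      using subG_KD_seq0[OF nz, of d] by blast
    have "subG y (v0 k :: ('n, 'N) pol) = subG y (KD seq0) ^ k"
      by (simp add: v0_power subG_def pc_hom.psub_power)
    then have "lowb (Suc d) (subG y (v0 k) - (pc e * det (Kker X A d)) ^ k)"
      using lowb_power_diff[OF e(2), of k] by simp
    \<comment> \<open>The error has energy above d, whereas \<open>f\<close> has energy d.\<close>
    then have "ip (subG y (v0 k) - (pc e * det (Kker X A d)) ^ k) f = 0"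
      using fd(1) by (rule ip_lowb) simp
    moreover have "ip (subG y (v0 k)) f = 0"
      using f(3)[OF stable_subG[OF W' v0', of y]] ip_commute[of f] by (metis complex_cnj_zero_iff)
    ultimately have "ip ((pc e * det (Kker X A d)) ^ k) f = 0" by (simp add: ip_diff_left)
    then have "e ^ k * ip (det (Kker X A d) ^ k) f = 0"
      unfolding power_mult_distrib pc_power[symmetric] unfolding smul_pc[symmetric] ip_smul_left .
    then show ?thesis using e(1) by simp
  qed
  then have "ip f f = 0"
    using Pspan_orthogonal[OF fd(1) KD_seq0_nonzero] fd(2) HN_eq_Pspan[OF k] by blast
  with f(2) show False by (simp add: ip_self_eq_0)
qed

section \<open>Ground states\<close>

text \<open>Exchange the elements of \<open>S\<close> outside the initial segment for the equally
  many missing ones. The former are at least \<open>card S\<close> and the latter strictly smaller,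
  so equality leaves nothing to exchange.\<close>

lemma sum_ge_initial:
  fixes S :: "nat set"
  assumes "finite S"
  shows "(\<Sum>i<card S. i) \<le> \<Sum>S" and "(\<Sum>i<card S. i) = \<Sum>S \<Longrightarrow> S = {..<card S}"
proof -
  let ?L = "{..<card S}"
  have card: "card (S - ?L) = card (?L - S)"
    using card_le_sym_Diff[of S ?L] card_le_sym_Diff[of ?L S] assms by simp
  have S: "\<Sum>S = \<Sum>(S - ?L) + \<Sum>(S \<inter> ?L)"
    using sum.Int_Diff[of S "\<lambda>x. x" ?L] assms by simp
  have L: "\<Sum>?L = \<Sum>(?L - S) + \<Sum>(S \<inter> ?L)"
    using sum.Int_Diff[of ?L "\<lambda>x. x" S] by (simp add: Int_commute)
  have 1: "card (S - ?L) * card S \<le> \<Sum>(S - ?L)"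
    using sum_bounded_below[of "S - ?L" "card S" "\<lambda>x. x"] by simp
  have 2: "\<Sum>(?L - S) + card (?L - S) \<le> card (?L - S) * card S"
  proof -
    have "\<Sum>(?L - S) + card (?L - S) = (\<Sum>x\<in>?L - S. Suc x)"
      by (simp add: sum_Suc)
    also have "\<dots> \<le> card (?L - S) * card S"
      using sum_bounded_above[of "?L - S" Suc "card S"] by simp
    finally show ?thesis .
  qed
  show "(\<Sum>i<card S. i) \<le> \<Sum>S" using S L 1 2 card by simp
  assume "(\<Sum>i<card S. i) = \<Sum>S"
  then have "card (?L - S) = 0" using S L 1[unfolded card] 2 by linarith
  then have "S - ?L = {}" "?L - S = {}"
    using card assms card_eq_0_iff[of "S - ?L"] card_eq_0_iff[of "?L - S"] by simp_all
  then show "S = ?L" by blast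
qed

text \<open>The weight in which the row \<open>A\<^sup>aX\<^sup>m\<close> has degree equal to its index \<open>a + nm\<close>.\<close>

definition tw :: "('n::finite, 'N) var \<Rightarrow> nat"
  where "tw v = (case v of XV i j \<Rightarrow> CARD('n) | AV a i \<Rightarrow> ix a)"

lemma tw_simps [simp]: "tw (XV i j :: ('n::finite, 'N) var) = CARD('n)" "tw (AV a i) = ix a"
  by (simp_all add: tw_def)

text \<open>The degree in row a of A. Its weight operator is the diagonal operator
  \<open>T a 0 a\<close>, so homogeneity for all \<open>wt a\<close> means having a gl_n
  weight.\<close>

definition wt :: "'n \<Rightarrow> ('n, 'N) var \<Rightarrow> nat"
  where "wt a v = (case v of XV i j \<Rightarrow> 0 | AV b i \<Rightarrow> if b = a then 1 else 0)"

lemma wt_simps [simp]: "wt a (XV i j) = 0" "wt a (AV b i) = (if b = a then 1 else 0)"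
  by (simp_all add: wt_def)

lemma weightop_wt: "weightop (wt a) f = T a 0 a f"
proof -
  have "(\<Sum>i\<in>UNIV. smul (of_nat (wt a (AV b i))) (pv (AV b i) * deriv_var (AV b i) f))
      = (if b = a then \<Sum>i\<in>UNIV. pv (AV b i) * deriv_var (AV b i) f else 0)" for b
    by simp
  then show ?thesis by (simp add: weightop_def sum_var T_def rho_def AM_def)
qed

text \<open>Energy and gl_n weight together determine the \<open>tw\<close>-degree, the quantity by
  which \<open>v0 k\<close> is singled out.\<close>

lemma wdeg_tw: "wdeg tw m = CARD('n) * wdeg xw m + (\<Sum>a\<in>UNIV. ix a * wdeg (wt a) m)"
  for m :: "('n::finite, 'N::finite) mon"
proof -
  have "(\<Sum>c\<in>UNIV. ix c * (if b = c then 1 else 0)) = ix b" for b :: 'n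
    by (simp add: if_distrib[of "(*) _"] cong: if_cong)
  then have "tw v = CARD('n) * xw v + (\<Sum>a\<in>UNIV. ix a * wt a v)" for v :: "('n, 'N) var"
    by (cases v) simp_all
  then show ?thesis
    by (simp add: wdeg_def sum.distrib sum_distrib_left sum_distrib_right distrib_right mult.assoc)
      (rule sum.swap)
qed

lemma homog_tw:
  fixes f :: "('n::finite, 'N::finite) pol"
  assumes "homog xw d f" "\<And>a. homog (wt a) (e a) f"
  shows "homog tw (CARD('n) * d + (\<Sum>a\<in>UNIV. ix a * e a)) f"
  using assms by (simp add: homog_def wdeg_tw)

lemma homog_unique: "homog w d f \<Longrightarrow> homog w e f \<Longrightarrow> f \<noteq> 0 \<Longrightarrow> d = e"
  unfolding homog_def by (metis lookup_zero poly_mapping_eqI)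

text \<open>The \<open>tw\<close>-degree of \<open>v0 k\<close>. It is the least one for a nonzero
  Krylov product, because the N row indices within each determinant must be distinct.\<close>

definition tdeg0 :: "nat \<Rightarrow> 'N::finite itself \<Rightarrow> nat"
  where "tdeg0 k _ = (\<Sum>s<k. \<Sum>i\<in>(UNIV :: 'N set). ix i)"

lemma ix_seq0_sum: "ix (fst (seq0 i :: 'n::finite \<times> nat)) + CARD('n) * snd (seq0 i :: 'n \<times> nat) = ix i"
  using seq0_eq[of i "fst (seq0 i :: 'n \<times> nat)" "snd (seq0 i :: 'n \<times> nat)"] by simp

lemma homog_tw_v0: "homog tw (tdeg0 k TYPE('N)) (v0 k :: ('n::finite, 'N::finite) pol)"
  unfolding v0_def
  using homog_Phi_gen[of "tw :: ('n, 'N) var \<Rightarrow> nat" "CARD('n)" ix "\<lambda>x. seq0 (snd x)" k]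
  by (simp add: tdeg0_def ix_seq0_sum)

lemma sum_ix: "(\<Sum>i\<in>(UNIV :: 'N::finite set). ix i) = (\<Sum>i<CARD('N). i)"
  by (rule sum.reindex_bij_betw[OF bij_ix])

lemma KD_minimal:
  fixes \<tau> :: "'N::finite \<Rightarrow> 'n::finite \<times> nat"
  assumes "inj \<tau>" and range: "range (\<lambda>i. ix (fst (\<tau> i)) + CARD('n) * snd (\<tau> i)) = {..<CARD('N)}"
  shows "\<exists>c. KD \<tau> = smul c (KD seq0)"
proof -
  let ?u = "\<lambda>z :: 'n \<times> nat. ix (fst z) + CARD('n) * snd z"
  define \<pi> where "\<pi> i = (SOME l :: 'N. ix l = ?u (\<tau> i))" for i
  have \<pi>: "ix (\<pi> i) = ?u (\<tau> i)" for i
  proof -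
    have "?u (\<tau> i) < CARD('N)" using range by (metis lessThan_iff rangeI)
    then show ?thesis unfolding \<pi>_def by (rule someI_ex[OF ex_ix])
  qed
  have \<tau>: "\<tau> i = seq0 (\<pi> i)" for i
    using \<pi>[of i] seq0_eq[of "\<pi> i" "fst (\<tau> i)" "snd (\<tau> i)"] by simp
  have "inj \<pi>" using \<open>inj \<tau>\<close> \<tau> unfolding inj_def by metis
  then have "bij \<pi>" by (simp add: bij_def finite_UNIV_inj_surj)
  then have p: "\<pi> permutes UNIV" by (rule bij_imp_permutes) simp
  have "KD \<tau> = of_int (sign \<pi>) * KD seq0"
    using det_permute_rows[OF p, of "\<chi> i. rho (fst (seq0 i)) (snd (seq0 i :: 'n \<times> nat))"]
    by (simp add: KD_def \<tau>)
  then show ?thesis by (metis pc_of_int smul_pc)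
qed

text \<open>A repeated row in some factor makes the product vanish. Otherwise each factor has N
  distinct indices with sum at least 0 + ... + (N-1); equality of the totals forces equality in
  every factor, so its rows are those of \<open>seq0\<close> in another order.\<close>

lemma Phi_minimal:
  fixes t :: "nat \<times> 'N::finite \<Rightarrow> 'n::finite \<times> nat"
  assumes deg: "(\<Sum>s<k. \<Sum>i\<in>UNIV. ix (fst (t (s, i))) + CARD('n) * snd (t (s, i))) = tdeg0 k TYPE('N)"
  shows "\<exists>c. Phi k (krow t) = smul c (v0 k)"
proof (cases "\<forall>s<k. inj (\<lambda>i. t (s, i))")
  case False
  then obtain s i j where s: "s < k" and ij: "i \<noteq> j" "t (s, i) = t (s, j)" by (auto simp: inj_def)
  have "KD (\<lambda>i. t (s, i)) = 0"
    unfolding KD_def by (rule det_identical_rows[OF ij(1)]) (simp add: row_def ij(2))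
  then have "Phi k (krow t) = smul 0 (v0 k)"
    using s unfolding Phi_krow by (subst prod_zero) (auto simp: smul_pc)
  then show ?thesis by blast
next
  case True
  let ?u = "\<lambda>z :: 'n \<times> nat. ix (fst z) + CARD('n) * snd z"
  let ?U = "\<lambda>s. range (\<lambda>i. ?u (t (s, i)))"
  have inj_u: "inj ?u"
  proof (rule injI)
    fix x y :: "'n \<times> nat" assume eq: "?u x = ?u y"
    have "?u z mod CARD('n) = ix (fst z)" "?u z div CARD('n) = snd z" for z :: "'n \<times> nat"
      by simp_all
    with eq have "ix (fst x) = ix (fst y)" "snd x = snd y" by metis+
    then show "x = y" by (simp add: prod_eq_iff)
  qed
  have inj_s: "inj (\<lambda>i. ?u (t (s, i)))" if "s < k" for s
    using inj_compose[OF inj_u, of "\<lambda>i. t (s, i)"] True that by (simp add: o_def)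
  have card: "card (?U s) = CARD('N)" if "s < k" for s
    by (rule card_image[OF inj_s[OF that]])
  have sum: "(\<Sum>i\<in>UNIV. ?u (t (s, i))) = \<Sum>(?U s)" if "s < k" for s
    using sum.reindex[OF inj_s[OF that], of "\<lambda>x. x"] by simp
  have eq: "(\<Sum>i\<in>(UNIV :: 'N set). ix i) = (\<Sum>i\<in>UNIV. ?u (t (s, i)))" if "s < k" for s
  proof (rule sum_mono_inv[where I = "{..<k}" and f = "\<lambda>s. \<Sum>i\<in>(UNIV :: 'N set). ix i" and i = s
        and g = "\<lambda>s. \<Sum>i\<in>UNIV. ?u (t (s, i))"])
    show "(\<Sum>s<k. \<Sum>i\<in>(UNIV :: 'N set). ix i) = (\<Sum>s<k. \<Sum>i\<in>UNIV. ?u (t (s, i)))"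
      using deg by (simp add: tdeg0_def)
    show "(\<Sum>i\<in>(UNIV :: 'N set). ix i) \<le> (\<Sum>i\<in>UNIV. ?u (t (s, i)))" if "s \<in> {..<k}" for s
      using sum_ge_initial(1)[of "?U s"] card[of s] sum[of s] that by (simp add: sum_ix)
  qed (use that in auto)
  have range: "?U s = {..<CARD('N)}" if "s < k" for s
    by (rule sum_ge_initial(2)[of "?U s", unfolded card[OF that]])
      (simp_all only: finite_imageI finite_class.finite_UNIV flip: sum[OF that] eq[OF that] sum_ix)
  have "\<exists>c. KD (\<lambda>i. t (s, i)) = smul c (KD seq0)" if "s < k" for s
    using KD_minimal[of "\<lambda>i. t (s, i)"] True range that by blast
  then obtain c where "\<And>s. s < k \<Longrightarrow> KD (\<lambda>i. t (s, i)) = smul (c s) (KD seq0)" by metis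
  then have "Phi k (krow t) = (\<Prod>s<k. pc (c s) * KD seq0)"
    unfolding Phi_krow by (intro prod.cong) (auto simp: smul_pc)
  also have "\<dots> = smul (\<Prod>s<k. c s) (v0 k)"
    by (simp add: prod.distrib pc_prod smul_pc v0_power)
  finally show ?thesis by blast
qed

text \<open>Krylov products span the states and are homogeneous for \<open>tw\<close>, so the
  component of the minimal degree comes only from those treated in
  \<open>Phi_minimal\<close>.\<close>

lemma HN_minimal_weight:
  fixes f :: "('n::finite, 'N::finite) pol"
  assumes k: "k > 0" and f: "f \<in> HN k" "homog tw (tdeg0 k TYPE('N)) f"
  shows "\<exists>c. f = smul c (v0 k)"
proof -
  let ?e = "tdeg0 k TYPE('N)"
  let ?V = "polv.span {v0 k} :: ('n, 'N) pol set"
  have V: "polv.subspace ?V" by (rule polv.subspace_span)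
  have "polv.subspace {f. hcomp tw ?e f \<in> ?V}"
  proof (rule polv.subspaceI)
    have "hcomp tw ?e (0 :: ('n, 'N) pol) = 0" by (simp add: hcomp_def)
    then show "0 \<in> {f. hcomp tw ?e f \<in> ?V}"
      using polv.subspace_0[OF V] by (simp only: mem_Collect_eq)
  next
    fix f g :: "('n, 'N) pol" assume "f \<in> {f. hcomp tw ?e f \<in> ?V}" "g \<in> {f. hcomp tw ?e f \<in> ?V}"
    then show "f + g \<in> {f. hcomp tw ?e f \<in> ?V}"
      using polv.subspace_add[OF V] unfolding mem_Collect_eq hcomp_add by blast
  next
    fix c and f :: "('n, 'N) pol" assume "f \<in> {f. hcomp tw ?e f \<in> ?V}"
    then show "smul c f \<in> {f. hcomp tw ?e f \<in> ?V}"
      using polv.subspace_scale[OF V] unfolding mem_Collect_eq hcomp_smul by blast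
  qed
  moreover have "{Phi k (krow t) | t. True} \<subseteq> {f :: ('n, 'N) pol. hcomp tw ?e f \<in> ?V}"
  proof clarify
    fix t :: "nat \<times> 'N \<Rightarrow> 'n \<times> nat"
    let ?d = "\<Sum>s<k. \<Sum>i\<in>UNIV. ix (fst (t (s, i))) + CARD('n) * snd (t (s, i))"
    have "homog tw ?d (Phi k (krow t))"
      by (rule homog_Phi_gen) simp_all
    then have h: "hcomp tw ?e (Phi k (krow t)) = (if ?e = ?d then Phi k (krow t) else 0)"
      by (rule hcomp_homog)
    show "hcomp tw ?e (Phi k (krow t)) \<in> ?V"
    proof (cases "?e = ?d")
      case True
      then obtain c where "Phi k (krow t) = smul c (v0 k)" using Phi_minimal[of t k] by metis
      then show ?thesis using h True by (simp add: polv.span_base polv.span_scale)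
    next
      case False
      then show ?thesis using h polv.subspace_0[OF V] by simp
    qed
  qed
  ultimately have "Pspan k \<subseteq> {f :: ('n, 'N) pol. hcomp tw ?e f \<in> ?V}"
    unfolding Pspan_def by (intro polv.span_minimal)
  then have "hcomp tw ?e f \<in> ?V" using f(1) HN_eq_Pspan[OF k] by blast
  moreover have "hcomp tw ?e f = f" using hcomp_homog[OF f(2)] by simp
  ultimately show ?thesis by (auto simp: polv.span_singleton)
qed

theorem stable_ground_state:
  fixes W :: "('n::finite, 'N::finite) pol set"
  assumes W: "stable k W" and k: "k > 0" and v: "v \<in> W" "v \<in> ground_states k" "v \<noteq> 0"
  shows "W = HN k"
proof -
  define D where "D = (\<Sum>s<k. \<Sum>i\<in>(UNIV :: 'N set). snd (seq0 i :: 'n \<times> nat))"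
  have v0D: "homog xw D (v0 k :: ('n, 'N) pol)"
    unfolding v0_def D_def using homog_Phi[of "\<lambda>x. seq0 (snd x)" k] by simp
  \<comment> \<open>The states without terms of energy below D form a stable subspace containing
    \<open>v0 k\<close>, hence all of \<open>HN k\<close>; this identifies D as the ground
    energy.\<close>
  have low: "lowb D f" if "f \<in> HN k" for f :: "('n, 'N) pol"
  proof -
    have "stable k ({f \<in> HN k. lowb D f} :: ('n, 'N) pol set)"
      unfolding stable_def
    proof (intro conjI ballI allI)
      show "polv.subspace ({f \<in> HN k. lowb D f} :: ('n, 'N) pol set)"
        by (rule polv.subspaceI) (auto simp: HN_add HN_smul lowb_add lowb_smul)
      fix f :: "('n, 'N) pol" and a m b assume f: "f \<in> {f \<in> HN k. lowb D f}"
      then have "lowb (D + m) (T a m b f)" by (auto intro: lowb_T)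
      then have "lowb D (T a m b f)" by (auto simp: lowb_def)
      then show "T a m b f \<in> {f \<in> HN k. lowb D f}" using f by (auto simp: HN_T)
    qed auto
    moreover have "v0 k \<in> ({f \<in> HN k. lowb D f} :: ('n, 'N) pol set)" using v0D by (auto simp: v0_HN intro: homog_lowb)
    ultimately have "{f \<in> HN k. lowb D f} = (HN k :: ('n, 'N) pol set)" by (rule stable_v0[OF _ k])
    then show ?thesis using that by blast
  qed
  have least: "(LEAST d. \<exists>f\<in>(HN_degree k d :: ('n, 'N) pol set). f \<noteq> 0) = D"
  proof (rule Least_equality)
    show "\<exists>f\<in>(HN_degree k D :: ('n, 'N) pol set). f \<noteq> 0"
      using v0D by (intro bexI[of _ "v0 k"]) (auto simp: HN_degree_iff v0_HN v0_nonzero)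
    fix d assume "\<exists>f\<in>(HN_degree k d :: ('n, 'N) pol set). f \<noteq> 0"
    then obtain f :: "('n, 'N) pol" where f: "f \<in> HN k" "homog xw d f" "f \<noteq> 0" by (auto simp: HN_degree_iff)
    then obtain m where "lk f m \<noteq> 0" by (metis lookup_zero poly_mapping_eqI)
    then show "D \<le> d" using low[OF f(1)] f(2) unfolding lowb_def homog_def by metis
  qed
  then have vD: "v \<in> HN_degree k D" using v(2) by (simp add: ground_states_def)
  have sub: "polv.subspace W" using W by (simp add: stable_def)
  let ?W0 = "W \<inter> HN_degree k D"
  have W0: "polv.subspace ?W0" by (intro polv.subspace_inter sub subspace_HN_degree)
  have T0: "T a 0 b w \<in> ?W0" if "w \<in> ?W0" for a b w
    using that W homog_T[of D w 0 a b] by (auto simp: HN_degree_iff stable_def HN_T)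
  \<comment> \<open>\<open>w\<close> is the projection of \<open>v0 k\<close> to the ground states
    in \<open>W\<close>. It inherits the gl_n weight: \<open>T a 0 a\<close> is self-adjoint and
    preserves \<open>?W0\<close>, so \<open>T a 0 a - e a\<close>, which annihilates
    \<open>v0 k\<close>, sends \<open>w\<close> to a vector that lies in \<open>?W0\<close> and is
    orthogonal to it.\<close>
  obtain w where w: "w \<in> ?W0" "\<And>b. b \<in> ?W0 \<Longrightarrow> ip (v0 k - w) b = 0"
    using projection_HN_degree[OF W0, of k D "v0 k"] by auto
  define e where "e a = (\<Sum>s<k. \<Sum>i\<in>(UNIV :: 'N set). if fst (seq0 i) = a then 1 else 0 :: nat)" for a :: 'n
  have v0e: "homog (wt a) (e a) (v0 k :: ('n, 'N) pol)" for a
    unfolding v0_def e_def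
    using homog_Phi_gen[of "wt a" 0 "\<lambda>b. if b = a then 1 else 0" "\<lambda>x. seq0 (snd x)" k] by simp
  have we: "homog (wt a) (e a) w" for a
  proof -
    let ?E = "\<lambda>f :: ('n, 'N) pol. T a 0 a f - smul (of_nat (e a)) f"
    have Ew: "?E w \<in> ?W0"
      by (intro polv.subspace_diff polv.subspace_scale W0 T0 w)
    have "?E (v0 k) = 0" using v0e[of a] by (simp add: homog_weightop weightop_wt)
    then have "?E w = - ?E (v0 k - w)"
      by (simp add: T.D_diff polv.scale_right_diff_distrib)
    moreover have "ip (?E (v0 k - w)) b = 0" if "b \<in> ?W0" for b
    proof -
      have "ip (T a 0 a (v0 k - w)) b = ip (v0 k - w) (T a 0 a b)"
        unfolding weightop_wt[symmetric] by (rule ip_weightop)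
      then show ?thesis using w(2)[OF T0[OF that]] w(2)[OF that] by (simp add: ip_diff_left ip_smul_left)
    qed
    ultimately have "ip (?E w) (?E w) = 0"
      using Ew ip_diff_left[of 0 "?E (v0 k - w)" "?E w"] by simp
    then have "?E w = 0" by (simp only: ip_self_eq_0)
    then show ?thesis by (simp add: homog_weightop weightop_wt)
  qed
  have "tdeg0 k TYPE('N) = CARD('n) * D + (\<Sum>a\<in>UNIV. ix a * e a)"
    by (rule homog_unique[OF homog_tw_v0 homog_tw[OF v0D v0e] v0_nonzero])
  then have "homog tw (tdeg0 k TYPE('N)) w"
    using homog_tw[of D w e] we w(1) by (simp add: HN_degree_iff)
  then obtain c where c: "w = smul c (v0 k)"
    using HN_minimal_weight[OF k] w(1) by (auto simp: HN_degree_iff)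
  show ?thesis
  proof (cases "c = 0")
    case False
    then have "v0 k = smul (1 / c) w" by (simp add: c)
    then have "v0 k \<in> W" using w(1) polv.subspace_scale[OF sub] by auto
    then show ?thesis by (rule stable_v0[OF W k])
  next
    case True
    \<comment> \<open>Now \<open>v0 k\<close> is orthogonal to \<open>?W0\<close>. The complement
      \<open>?Z\<close> is stable: for m = 0 the adjoint of \<open>T a 0 b\<close> is
      \<open>T b 0 a\<close>, and for m > 0 the energy rises above D. Containing
      \<open>v0 k\<close>, it is everything, so \<open>v\<close> is orthogonal to itself.\<close>
    let ?Z = "{f \<in> HN k. \<forall>w\<in>?W0. ip f w = 0}"
    have "stable k ?Z"
      unfolding stable_def
    proof (intro conjI ballI allI)
      show "polv.subspace ?Z"
        by (rule polv.subspaceI) (auto simp: HN_add HN_smul ip_add_left ip_smul_left)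
      fix f a m b assume f: "f \<in> ?Z"
      have "ip (T a m b f) u = 0" if u: "u \<in> ?W0" for u
      proof (cases m)
        case 0
        have "ip (T a 0 b f) u = ip f (T b 0 a u)"
          using ip_T[of a 0 b f u] ABw_X[of b 0 a u] by simp
        then show ?thesis using f T0[OF u] 0 by simp
      next
        case (Suc l)
        have "lowb (D + m) (T a m b f)" using low f by (auto intro: lowb_T)
        then show ?thesis using u Suc by (auto intro: ip_lowb simp: HN_degree_iff)
      qed
      then show "T a m b f \<in> ?Z" using f by (auto simp: HN_T)
    qed auto
    moreover have "v0 k \<in> ?Z" using w(2) c True by (simp add: v0_HN)
    ultimately have "?Z = HN k" by (rule stable_v0[OF _ k])
    then have "v \<in> ?Z" using vD by (simp add: HN_degree_iff)
    then have "ip v v = 0" using v vD by blast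
    then show ?thesis using v(3) by (simp add: ip_self_eq_0)
  qed
qed

section \<open>Modules over presented algebras\<close>

lemma ideal_rel_ideal: "ideal (rel_ideal rel) free_ring"
  unfolding rel_ideal_def by (rule ring.genideal_ideal[OF ring_free_ring]) (simp add: free_ring_def)

lemma carrier_free_ring [simp]: "carrier free_ring = UNIV"
  by (simp add: free_ring_def)

lemma cls_hom: "cls rel \<in> ring_hom free_ring (presented rel)"
  unfolding cls_def[abs_def] presented_def by (rule ideal.rcos_ring_hom[OF ideal_rel_ideal])

lemma cls_add: "cls rel x \<oplus>\<^bsub>presented rel\<^esub> cls rel y = cls rel (x + y)"
  using ring_hom_add[OF cls_hom, of x y rel] by (simp add: free_ring_def)

lemma cls_mult: "cls rel x \<otimes>\<^bsub>presented rel\<^esub> cls rel y = cls rel (x * y)"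
  using ring_hom_mult[OF cls_hom, of x y rel] by (simp add: free_ring_def)

lemma cls_one: "\<one>\<^bsub>presented rel\<^esub> = cls rel 1"
  using ring_hom_one[OF cls_hom, of rel] by (simp add: free_ring_def)

lemma cls_carrier [simp]: "cls rel x \<in> carrier (presented rel)"
  by (simp add: carrier_presented)

lemma cls_eq_iff: "cls rel x = cls rel y \<longleftrightarrow> x - y \<in> rel_ideal rel"
proof -
  interpret ring "free_ring :: ('a, 'b) free_alg ring" by (rule ring_free_ring)
  have "\<ominus>\<^bsub>free_ring\<^esub> y = - y"
    by (rule minus_equality) (simp_all add: free_ring_def)
  then have "x \<ominus>\<^bsub>free_ring\<^esub> y = x - y"
    by (simp add: a_minus_def) (simp add: free_ring_def)
  then show ?thesis
    using quotient_eq_iff_same_a_r_cos[OF ideal_rel_ideal, of x y rel] by (simp add: cls_def)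
qed

lemma free_alg_induct [case_names const gen add mult]:
  fixes x :: "('g, 'r::comm_ring_1) free_alg"
  assumes "\<And>c. P (const c)" and "\<And>g. P (gen g)"
    and "\<And>x y. P x \<Longrightarrow> P y \<Longrightarrow> P (x + y)" and "\<And>x y. P x \<Longrightarrow> P y \<Longrightarrow> P (x * y)"
  shows "P x"
proof (induction x rule: pol_induct_add)
  case (1 w c)
  have "P (sg (Word gs) c)" for gs
  proof (induction gs)
    case Nil
    then show ?case using assms(1)[of c] by (simp add: const_def zero_word_def)
  next
    case (Cons g gs)
    then have "P (gen g * sg (Word gs) c)" by (intro assms)
    then show ?case by (simp add: gen_def mult_single plus_word_def)
  qed
  then show ?case by (cases w) simp
qed (rule assms)

lemma submodule_presentedI:
  assumes V: "left_module (presented rel) V act" and W: "W \<subseteq> V" "0 \<in> W" "\<And>v w. v \<in> W \<Longrightarrow> w \<in> W \<Longrightarrow> v - w \<in> W"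
    and const: "\<And>c v. v \<in> W \<Longrightarrow> act (cls rel (const c)) v \<in> W"
    and gen: "\<And>g v. v \<in> W \<Longrightarrow> act (cls rel (gen g)) v \<in> W"
  shows "submodule_of (presented rel) V act W"
proof -
  have add: "v + w \<in> W" if "v \<in> W" "w \<in> W" for v w
    using W(3)[OF that(1) W(3)[OF W(2) that(2)]] by simp
  have "\<forall>v\<in>W. act (cls rel x) v \<in> W" for x
  proof (induction x rule: free_alg_induct)
    case (add x y)
    have "act (cls rel (x + y)) v = act (cls rel x) v + act (cls rel y) v" if "v \<in> W" for v
      using V W(1) that unfolding left_module_def cls_add[symmetric] by (meson cls_carrier subsetD)
    then show ?case using add \<open>\<And>v w. v \<in> W \<Longrightarrow> w \<in> W \<Longrightarrow> v + w \<in> W\<close> by simp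
  next
    case (mult x y)
    have "act (cls rel (x * y)) v = act (cls rel x) (act (cls rel y) v)" if "v \<in> W" for v
      using V W(1) that unfolding left_module_def cls_mult[symmetric] by (meson cls_carrier subsetD)
    then show ?case using mult by simp
  qed (use const gen in auto)
  then have "\<forall>r\<in>carrier (presented rel). \<forall>v\<in>W. act r v \<in> W"
    by (auto simp: carrier_presented)
  then show ?thesis
    using V W unfolding submodule_of_def left_module_def by (intro conjI) blast+
qed

lemma submodule_stepD:
  assumes "submodule_of (presented rel) V act W" and "v \<in> W"
  shows "act (cls rel x) v \<in> W"
  using assms unfolding submodule_of_def left_module_def by (meson cls_carrier)

text \<open>Submodules are a priori only additive subgroups; complex scalars act on them through
  constants of the coefficient ring.\<close>

lemma submodule_subspace:
  fixes V :: "('n::finite, 'N::finite) pol set"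
  assumes W: "submodule_of (presented rel) V act W"
    and const: "\<And>c. \<exists>d. \<forall>v\<in>V. act (cls rel (const d)) v = smul c v"
  shows "polv.subspace W"
proof -
  have 0: "0 \<in> W" and minus: "\<And>v w. v \<in> W \<Longrightarrow> w \<in> W \<Longrightarrow> v - w \<in> W" and WV: "W \<subseteq> V"
    using W by (auto simp: submodule_of_def left_module_def)
  show ?thesis
  proof (rule polv.subspaceI)
    fix v w assume "v \<in> W" "w \<in> W"
    then show "v + w \<in> W" using minus[of v "0 - w"] minus[OF 0] by simp
  next
    fix c v assume v: "v \<in> W"
    obtain d where "\<forall>v\<in>V. act (cls rel (const d)) v = smul c v" using const by blast
    then have "smul c v = act (cls rel (const d)) v" using v WV by auto
    then show "smul c v \<in> W" using submodule_stepD[OF W v] by simp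
  qed (rule 0)
qed

section \<open>The action of the enveloping algebra\<close>

lemma TG_add: "TG x (f + g) = TG x f + TG x g"
  and TG_smul: "TG x (smul c f) = smul c (TG x f)"
  by (simp_all add: TG_def deriv_var_add deriv_var_smul distrib_left sum.distrib mult_smul smul_sum)

lemma TG_0 [simp]: "TG x 0 = 0"
  by (simp add: TG_def)

lemma TG_mult: "TG x (f * g) = TG x f * g + f * TG x g"
  by (simp add: TG_def deriv_var_mult algebra_simps sum.distrib sum_distrib_left)

lemma GA_add: "GA (x + y) b j = GA x b j + GA y b j"
  by (simp add: GA_def rowp_add sum.distrib)

lemma GA_minus: "GA (x - y) b j = GA x b j - GA y b j"
  using GA_add[of "x - y" y b j] by simp

lemma GA_scale: "GA (mat_scale [:c:] x) b j = pc c * GA x b j"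
  by (simp add: GA_def mat_scale_def rowp_smult sum_distrib_left)

lemma TG_add_left: "TG (x + y) f = TG x f + TG y f"
  by (simp add: TG_def GA_add distrib_right sum.distrib)

lemma TG_scale: "TG (mat_scale [:c:] x) f = smul c (TG x f)"
  by (simp add: TG_def GA_scale smul_pc sum_distrib_left mult.assoc)

lemma TG_pc [simp]: "TG x (pc c) = 0"
  by (simp add: TG_def)

lemma TG_var: "TG x (pv v) = (case v of XV i j \<Rightarrow> 0 | AV b j \<Rightarrow> GA x b j)"
proof (cases v)
  case (AV b j)
  have "(\<Sum>i\<in>UNIV. GA x c i * (if c = b \<and> i = j then 1 else 0)) = (if c = b then GA x b j else 0)" for c
    by (simp add: if_distrib[of "(*) _"] cong: if_cong)
  then show ?thesis using AV by (simp add: TG_def)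
qed (simp add: TG_def)

lemma TG_rho: "TG x (rho a m $ j) = (\<Sum>c\<in>UNIV. rowp (x $ c $ a * monom 1 m) c j)"
proof -
  have "TG x (rho a m $ j) = (\<Sum>b\<in>UNIV. if b = a then \<Sum>l\<in>UNIV. GA x a l * mpow XM m $ l $ j else 0)"
    unfolding TG_def deriv_A_rho by (intro sum.cong) auto
  also have "\<dots> = (\<Sum>l\<in>UNIV. GA x a l * mpow XM m $ l $ j)" by simp
  also have "\<dots> = (\<Sum>c\<in>UNIV. rowp (x $ c $ a * monom 1 m) c j)"
    unfolding GA_def rowp_mult_monom sum_distrib_right by (rule sum.swap)
  finally show ?thesis .
qed

lemma TG_rowp: "TG x (rowp q a j) = (\<Sum>c\<in>UNIV. rowp (x $ c $ a * q) c j)"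
proof (induction q rule: poly_monom_induct)
  case (1 c m)
  have "x $ b $ a * monom c m = smult c (x $ b $ a * monom 1 m)" for b
    by (simp add: smult_monom flip: mult_smult_right)
  then show ?case
    by (simp add: rowp_monom TG_mult TG_rho rowp_smult sum_distrib_left)
qed (simp add: rowp_add TG_add distrib_left sum.distrib)

lemma TG_sum: "TG x (\<Sum>i\<in>I. f i) = (\<Sum>i\<in>I. TG x (f i))"
  by (induction I rule: infinite_finite_induct) (simp_all add: TG_add)

lemma TG_GA: "TG x (GA y b j) = GA (x ** y) b j"
  unfolding GA_def TG_sum TG_rowp matrix_mul_component rowp_sum by (rule sum.swap)

text \<open>Both sides are derivations in f, so it suffices to compare them on variables, where
  \<open>TG_GA\<close> turns composition into the matrix product.\<close>

lemma TG_bracket: "TG (bracket x y) f = TG x (TG y f) - TG y (TG x f)"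
proof (induction f rule: pol_induct)
  case (var v)
  then show ?case by (cases v) (simp_all add: TG_var TG_GA bracket_def GA_minus)
next
  case (mult f g)
  show ?case unfolding TG_mult TG_add mult by (simp add: algebra_simps)
qed (simp_all add: TG_add)

definition free_act :: "('n glz, complex) free_alg \<Rightarrow> ('n::finite, 'N::finite) oper"
  where "free_act x f = (\<Sum>w\<in>ks x. smul (lk x w) (foldr TG (letters w) f))"

lemma free_act_superset:
  "finite S \<Longrightarrow> ks x \<subseteq> S \<Longrightarrow> free_act x f = (\<Sum>w\<in>S. smul (lk x w) (foldr TG (letters w) f))"
  unfolding free_act_def by (intro sum.mono_neutral_left) (auto simp: in_keys_iff)

lemma free_act_add: "free_act (x + y) f = free_act x f + free_act y f"
  using keys_add[of x y]
  by (simp add: free_act_superset[of "ks x \<union> ks y"] lookup_add polv.scale_left_distrib sum.distrib)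

lemma free_act_single: "free_act (sg w c) f = smul c (foldr TG (letters w) f)"
  by (subst free_act_superset[of "{w}"]) simp_all

lemma foldr_TG_add: "foldr TG ws (f + g) = foldr TG ws f + foldr TG ws g"
  and foldr_TG_smul: "foldr TG ws (smul c f) = smul c (foldr TG ws f)"
  by (induction ws) (simp_all add: TG_add TG_smul)

lemma free_act_add_right: "free_act x (f + g) = free_act x f + free_act x g"
  by (simp add: free_act_def foldr_TG_add polv.scale_right_distrib sum.distrib)

lemma free_act_mult: "free_act (x * y) f = free_act x (free_act y f)"
proof (induction x rule: pol_induct_add)
  case (1 w c)
  show ?case
    by (induction y rule: pol_induct_add)
      (simp_all add: mult_single free_act_single plus_word_def foldr_TG_smul foldr_TG_add free_act_add distrib_left
        polv.scale_right_distrib)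
qed (simp add: distrib_right free_act_add)

lemma free_act_gen [simp]: "free_act (gen x) f = TG x f"
  by (simp add: gen_def free_act_single)

lemma free_act_const [simp]: "free_act (const c) f = smul c f"
  by (simp add: const_def free_act_single zero_word_def)

lemma free_act_minus: "free_act (x - y) f = free_act x f - free_act y f"
  using free_act_add[of "x - y" y f] by simp

lemma free_act_zero [simp]: "free_act 0 f = 0" and free_act_uminus: "free_act (- x) f = - free_act x f"
  using free_act_minus[of 0 0 f] free_act_minus[of 0 x f] by simp_all

text \<open>The elements acting by zero form a two-sided ideal, and this ideal contains the defining
  relations.\<close>

lemma free_act_rel_ideal: "x \<in> rel_ideal Uglz_rel \<Longrightarrow> free_act x f = 0"
proof -
  let ?K = "{x. \<forall>f :: ('a, 'b) pol. free_act x f = 0}"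
  have free_act_0: "free_act x 0 = 0" for x :: "('a glz, complex) free_alg"
    using free_act_add_right[of x 0 0] by simp
  interpret ring "free_ring :: ('a glz, complex) free_alg ring" by (rule ring_free_ring)
  have inv: "\<ominus>\<^bsub>free_ring\<^esub> y = - y" for y :: "('a glz, complex) free_alg"
    by (rule minus_equality) (simp_all add: free_ring_def)
  have "ideal ?K free_ring"
  proof (rule idealI)
    show "ring (free_ring :: ('a glz, complex) free_alg ring)" by (rule ring_free_ring)
    show "subgroup ?K (add_monoid free_ring)"
    proof (rule add.subgroupI)
      show "?K \<noteq> {}" by (auto intro!: exI[of _ 0])
      show "\<ominus>\<^bsub>free_ring\<^esub> a \<in> ?K" if "a \<in> ?K" for a
        using that by (simp add: inv free_act_uminus)
    qed (auto simp: free_ring_def free_act_add)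
  qed (auto simp: free_ring_def free_act_mult free_act_0)
  moreover have "{l - r | l r. Uglz_rel l r} \<subseteq> ?K"
    by (auto simp: comm_def free_act_minus free_act_mult free_act_add TG_add_left TG_scale TG_bracket
        elim!: Uglz_rel.cases)
  ultimately have "rel_ideal Uglz_rel \<subseteq> ?K"
    unfolding rel_ideal_def by (rule genideal_minimal)
  then show "x \<in> rel_ideal Uglz_rel \<Longrightarrow> free_act x f = 0" by blast
qed

text \<open>The choice of a representative is immaterial by \<open>free_act_rel_ideal\<close>; in
  this way the action descends to the quotient.\<close>

definition Uact :: "('n glz, complex) free_alg set \<Rightarrow> ('n::finite, 'N::finite) oper"
  where "Uact r = free_act (SOME x. cls Uglz_rel x = r)"

lemma Uact_cls: "Uact (cls Uglz_rel x) f = free_act x f"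
proof -
  let ?y = "SOME y. cls Uglz_rel y = cls Uglz_rel x"
  have "cls Uglz_rel ?y = cls Uglz_rel x"
    by (rule someI[of _ x]) simp
  then have "free_act (?y - x) f = 0" by (intro free_act_rel_ideal) (simp only: cls_eq_iff)
  then show ?thesis by (simp add: Uact_def free_act_minus)
qed

lemma stable_free_act:
  assumes "stable k W" "f \<in> W"
  shows "free_act x f \<in> W"
  using assms(2)
proof (induction x arbitrary: f rule: free_alg_induct)
  case (add x y)
  then show ?case using assms(1) by (simp add: free_act_add stable_def polv.subspace_add)
next
  case (gen x)
  then show ?case using stable_TG[OF assms(1)] by simp
qed (use assms(1) in \<open>simp_all add: free_act_mult stable_def polv.subspace_scale\<close>)

lemma TG_unit:
  fixes f :: "('n::finite, 'N::finite) pol"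
  shows "TG (unit_mat_z a b m) f = T a m b f"
proof -
  have "GA (unit_mat_z a b m) c j = (if c = b then rho a m $ j else 0)" for c and j :: 'N
  proof -
    have "rowp (unit_mat_z a b m $ d $ c) d j = (if d = a then if c = b then rho a m $ j else 0 else 0)" for d
      by (simp add: unit_mat_z_def mat_scale_def unit_mat_def rowp_monom)
    then show ?thesis by (simp add: GA_def)
  qed
  then have "TG (unit_mat_z a b m) f
      = (\<Sum>c\<in>UNIV. if c = b then \<Sum>j\<in>UNIV. rho a m $ j * deriv_var (AV b j) f else 0)"
    unfolding TG_def by (intro sum.cong) auto
  then show ?thesis by (simp add: T_def)
qed

lemma left_module_Uact:
  assumes "stable k W"
  shows "left_module Uglz W Uact"
  using assms stable_free_act[OF assms]
  unfolding left_module_def Uglz_def carrier_presented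
  by (auto simp: cls_add cls_mult cls_one Uact_cls free_act_add free_act_mult free_act_add_right
      stable_def polv.subspace_0 polv.subspace_diff simp flip: single_one const_def)

lemma Uglz_action_Uact: "Uglz_action k Uact"
  unfolding Uglz_action_def
  by (simp add: left_module_Uact[OF stable_HN] Uact_cls TG_unit AB_mat_word_X)

text \<open>The orbit of \<open>v\<close> under the algebra is a stable subspace containing
  \<open>v\<close>, so \<open>stable_ground_state\<close> applies.\<close>

theorem generates_ground_state:
  fixes v :: "('n::finite, 'N::finite) pol"
  assumes k: "k > 0" and v: "v \<in> ground_states k" "v \<noteq> 0"
  shows "generates_module Uglz (HN k) Uact v"
proof -
  have vHN: "v \<in> HN k" using v(1) by (auto simp: ground_states_def HN_degree_def)
  let ?W = "{Uact r v | r. r \<in> carrier Uglz}"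
  have W_eq: "?W = range (\<lambda>x. free_act x v)"
    by (auto simp: Uglz_def carrier_presented Uact_cls intro!: exI[of _ "cls Uglz_rel _"])
  have "stable k ?W"
    unfolding stable_def W_eq
  proof (intro conjI ballI allI)
    show "polv.subspace (range (\<lambda>x. free_act x v))"
    proof (rule polv.subspaceI)
      show "0 \<in> range (\<lambda>x. free_act x v)"
        by (rule range_eqI[of _ _ "const 0"]) simp
    next
      fix f g assume "f \<in> range (\<lambda>x. free_act x v)" "g \<in> range (\<lambda>x. free_act x v)"
      then show "f + g \<in> range (\<lambda>x. free_act x v)"
        by (auto simp flip: free_act_add)
    next
      fix c f assume "f \<in> range (\<lambda>x. free_act x v)"
      then show "smul c f \<in> range (\<lambda>x. free_act x v)"
        by (auto simp flip: free_act_const free_act_mult)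
    qed
    show "range (\<lambda>x. free_act x v) \<subseteq> HN k"
      using stable_free_act[OF stable_HN vHN] by blast
    fix f a m b assume "f \<in> range (\<lambda>x. free_act x v)"
    then show "T a m b f \<in> range (\<lambda>x. free_act x v)"
      by (auto simp flip: TG_unit free_act_gen free_act_mult)
  qed
  moreover have "v \<in> ?W" unfolding W_eq by (rule range_eqI[of _ _ "const 1"]) simp
  ultimately have "?W = HN k" using k v by (intro stable_ground_state)
  then show ?thesis using vHN by (simp add: generates_module_def)
qed

section \<open>Simplicity over the deformed double current algebra\<close>

lemma permutations_replicate_mset: "permutations_of_multiset (replicate_mset m x) = {replicate m x}"
proof -
  have "xs = replicate m x" if "mset xs = replicate_mset m x" for xs
  proof (rule replicate_eqI)
    show "length xs = m" using that by (metis size_mset size_replicate_mset)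
    show "y = x" if "y \<in> set xs" for y
      using that \<open>mset xs = replicate_mset m x\<close> by (metis in_replicate_mset set_mset_mset)
  qed
  then show ?thesis by (auto simp: permutations_of_multiset_def)
qed

lemma AB_Sym_X: "AB a (Sym 0 m) b f = T a m b f"
  unfolding AB_mat_word_X[symmetric]
  by (simp add: AB_def Sym_def permutations_replicate_mset Let_def)

lemma AB_Sym_Y: "AB a (Sym m 0) b f = ABw a (replicate m False) b f"
  by (simp add: ABw_def AB_def Sym_def permutations_replicate_mset Let_def XY_def)

text \<open>Ensures that YX and XY count as two distinct words in the average
  \<open>Sym 1 1\<close>.\<close>

lemma opX_neq_opY: "opX \<noteq> (opY :: 'N \<Rightarrow> 'N \<Rightarrow> ('n::finite, 'N::finite) oper)"
proof
  fix i :: 'N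
  assume "opX = (opY :: 'N \<Rightarrow> 'N \<Rightarrow> ('n, 'N) oper)"
  then have "opX i i (1 :: ('n, 'N) pol) = opY i i 1" by simp
  then have "pv (XV i i) = (0 :: ('n, 'N) pol)" by (simp add: opX_def opY_def mul_var_pv)
  then have "eval_pol (pv (XV i i) :: ('n, 'N) pol) (\<chi> i j. 1) 0 = 0" by (simp add: eval_0)
  then show False by (simp add: eval_pv pt_def)
qed

text \<open>In each of the N^2 index pairs YX exceeds XY by the identity, and half of this survives
  in the average. The formula makes submodules of the double current algebra graded.\<close>

lemma Tr_Sym_1_1:
  fixes f :: "('n::finite, 'N::finite) pol"
  shows "Tr (Sym 1 1) f = Euler f + smul (of_nat (CARD('N) * CARD('N)) / 2) f"
proof -
  let ?X = "opX :: 'N \<Rightarrow> 'N \<Rightarrow> ('n, 'N) oper" and ?Y = "opY :: 'N \<Rightarrow> 'N \<Rightarrow> ('n, 'N) oper"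
  have W: "permutations_of_multiset (replicate_mset 1 ?Y + replicate_mset 1 ?X) = {[?Y, ?X], [?X, ?Y]}"
    by (auto simp: permutations_of_multiset_doubleton)
  have YX: "?Y i l (?X l i f) = f + pv (XV l i) * deriv_var (XV l i) f" for i l
    by (simp add: opX_def opY_def mul_var_pv deriv_var_mult)
  have XY: "?X i l (?Y l i f) = pv (XV i l) * deriv_var (XV i l) f" for i l
    by (simp add: opX_def opY_def mul_var_pv)
  have w: "mat_word [?Y, ?X] i i f = (\<Sum>l\<in>UNIV. ?Y i l (?X l i f))"
    "mat_word [?X, ?Y] i i f = (\<Sum>l\<in>UNIV. ?X i l (?Y l i f))" for i
    by (simp_all add: opX_def opY_def mul_var_pv if_distrib[of "(*) _"] if_distrib[of "deriv_var _"] cong: if_cong)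
  have "Tr (Sym 1 1) f = (\<Sum>i\<in>UNIV. smul (1 / 2) (mat_word [?Y, ?X] i i f + mat_word [?X, ?Y] i i f))"
    using opX_neq_opY[where 'n = 'n and 'N = 'N] unfolding Tr_def Sym_def W Let_def by simp
  also have "\<dots> = smul (1 / 2) ((\<Sum>i\<in>(UNIV :: 'N set). \<Sum>l\<in>(UNIV :: 'N set). f)
      + (\<Sum>i\<in>UNIV. \<Sum>l\<in>UNIV. pv (XV l i) * deriv_var (XV l i) f) + Euler f)"
    unfolding w YX XY Euler_def by (simp only: smul_sum[symmetric] sum.distrib)
  also have "(\<Sum>i\<in>UNIV. \<Sum>l\<in>UNIV. pv (XV l i) * deriv_var (XV l i) f) = Euler f"
    unfolding Euler_def by (rule sum.swap)
  also have "(\<Sum>i\<in>(UNIV :: 'N set). \<Sum>l\<in>(UNIV :: 'N set). f) = smul (of_nat (CARD('N) * CARD('N))) f"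
    using pc_of_int[of "int (CARD('N) * CARD('N))", where 'a = 'n and 'b = 'N]
    by (simp add: smul_pc flip: mult.assoc)
  also have "smul (1 / 2) (smul (of_nat (CARD('N) * CARD('N))) f + Euler f + Euler f)
      = Euler f + smul (of_nat (CARD('N) * CARD('N)) / 2) f"
  proof -
    have "smul (1 / 2) (Euler f + Euler f) = smul (1 / 2 + 1 / 2) (Euler f)"
      by (simp only: polv.scale_left_distrib polv.scale_right_distrib)
    then show ?thesis by (simp add: add.assoc polv.scale_right_distrib[of _ "smul _ _"])
  qed
  finally show ?thesis .
qed

text \<open>Three families of generators are used: T_{0,m} makes a submodule stable, T_{m,0} makes
  its complement stable, and t_{1,1} makes it graded, so that a proper submodule has a nonzero
  complement.\<close>

theorem simple_DDCA:
  fixes act :: "'n::finite ddca_free set \<Rightarrow> ('n, 'N::finite) oper"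
  assumes k: "k > 0" and act: "ddca_action k act"
  shows "simple_module DDCA (HN k) act"
proof -
  have mod: "left_module (presented ddca_rel) (HN k) act"
    and const: "\<And>c f. f \<in> HN k \<Longrightarrow> act (cls ddca_rel (const c)) f = smul (eval_coeffs 1 (of_nat k) c) f"
    and TT: "\<And>p q a b f. f \<in> HN k \<Longrightarrow> act (cls ddca_rel (TT p q (unit_mat a b))) f = AB a (Sym p q) b f"
    and tt: "\<And>p q f. f \<in> HN k \<Longrightarrow> act (cls ddca_rel (tt p q)) f = Tr (Sym p q) f"
    using act unfolding ddca_action_def DDCA_def by blast+
  have "W = {0} \<or> W = HN k" if W: "submodule_of (presented ddca_rel) (HN k) act W" for W
  proof -
    have WHN: "W \<subseteq> HN k" using W by (simp add: submodule_of_def)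
    have sub: "polv.subspace W"
    proof (rule submodule_subspace[OF W])
      fix c
      have "act (cls ddca_rel (const (num c))) f = smul c f" if "f \<in> HN k" for f
        using const[OF that, of "num c"] by (simp add: num_def eval_coeffs_def)
      then show "\<exists>d. \<forall>f\<in>HN k. act (cls ddca_rel (const d)) f = smul c f" by blast
    qed
    have Tcl: "T a m b f \<in> W" if "f \<in> W" for a m b f
      using submodule_stepD[OF W that, of "TT 0 m (unit_mat a b)"] TT that WHN by (auto simp: AB_Sym_X)
    have Ycl: "ABw a (replicate m False) b f \<in> W" if "f \<in> W" for a m b f
      using submodule_stepD[OF W that, of "TT m 0 (unit_mat a b)"] TT that WHN by (auto simp: AB_Sym_Y)
    have Ecl: "weightop xw f \<in> W" if "f \<in> W" for f
    proof -
      have "Tr (Sym 1 1) f \<in> W"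
        using submodule_stepD[OF W that, of "tt 1 1"] tt that WHN by auto
      then have "Tr (Sym 1 1) f - smul (of_nat (CARD('N) * CARD('N)) / 2) f \<in> W"
        using that by (intro polv.subspace_diff sub polv.subspace_scale)
      then show ?thesis unfolding Tr_Sym_1_1 Euler_weightop by simp
    qed
    have W': "stable k W" using sub WHN Tcl by (simp add: stable_def)
    let ?C = "{f \<in> HN k. \<forall>w\<in>W. ip f w = 0}"
    have C: "stable k ?C" by (rule stable_complement[OF WHN Ycl])
    show ?thesis
    proof (rule ccontr)
      assume n: "\<not> (W = {0} \<or> W = HN k)"
      obtain d f where "f \<in> HN_degree k d" "f \<noteq> 0" "\<And>w. w \<in> W \<Longrightarrow> ip f w = 0"
        using graded_complement[OF sub WHN hcomp_in_subspace[OF sub Ecl]] n by metis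
      then have "f \<in> ?C" "f \<noteq> 0" by (auto simp: HN_degree_iff)
      then have "?C \<noteq> {0}" by blast
      then obtain g where "g \<in> W \<inter> ?C" "g \<noteq> 0" using stable_meet[OF W' _ C _ k] n by blast
      then show False using ip_self_eq_0[of g] by blast
    qed
  qed
  moreover have "HN k \<noteq> ({0} :: ('n, 'N) pol set)" using v0_HN[of k] v0_nonzero[of k] by blast
  ultimately show ?thesis using mod by (simp add: simple_module_def DDCA_def)
qed

section \<open>Semisimplicity over the Yangian\<close>

definition yop :: "'n::finite \<Rightarrow> nat \<Rightarrow> 'n \<Rightarrow> ('n, 'N::finite) oper"
  where "yop a s b = ABw a (concat (replicate s [True, False])) b"

lemma AB_concat: "AB a (mat_word (concat (replicate s [opX, opY]))) b = yop a s b"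
  by (rule ext) (simp add: yop_def ABw_def map_concat XY_def)

text \<open>Reversing (XY)^s and exchanging X with Y gives (XY)^s back, so the adjoint merely
  exchanges the outer indices.\<close>

lemma ip_yop: "ip (yop a s b f) g = ip f (yop b s a g)"
proof -
  have snoc: "concat (replicate s [x, y]) @ [x, y] = [x, y] @ concat (replicate s [x, y])" for s and x y :: bool
    by (induction s) simp_all
  have "rev (map Not (concat (replicate s [True, False]))) = concat (replicate s [True, False])"
    by (induction s) (use snoc in simp_all)
  then show ?thesis by (simp add: yop_def ip_ABw)
qed

lemma homog_X_deriv:
  assumes "homog xw d f"
  shows "homog xw d (pv (XV i l) * deriv_var (XV p q) f)"
proof (cases d)
  case 0
  then have "deriv_var (XV p q) f = 0"
    using assms by (intro poly_mapping_eqI) (auto simp: homog_def lookup_deriv_var wdeg_add)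
  then show ?thesis by simp
next
  case (Suc e)
  then have "homog xw e (deriv_var (XV p q) f)"
    using assms by (auto simp: homog_def lookup_deriv_var wdeg_add)
  then show ?thesis using homog_mult[OF homog_pv[of xw "XV i l"]] Suc by (simp add: xw_def)
qed

lemma homog_yop:
  fixes f :: "('n::finite, 'N::finite) pol"
  assumes "homog xw d f"
  shows "homog xw d (yop a s b f)"
proof -
  have *: "homog xw d (mat_word (map XY (concat (replicate s [True, False]))) i j g)" if "homog xw d g" for i j and g :: "('n, 'N) pol"
    using that
  proof (induction s arbitrary: i)
    case (Suc s)
    have "homog xw d (\<Sum>l\<in>UNIV. \<Sum>m\<in>UNIV. pv (XV i l) * deriv_var (XV m l)
        (mat_word (map XY (concat (replicate s [True, False]))) m j g))"
      by (intro homog_sum homog_X_deriv Suc)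
    moreover have "XY True p q h = pv (XV p q) * h" "XY False p q h = deriv_var (XV q p) h" for p q and h :: "('n, 'N) pol"
      by (simp_all add: XY_def opX_def opY_def mul_var_pv)
    ultimately show ?case by (simp add: sum_distrib_left)
  qed simp
  have "homog xw d (pv (AV a i) * mat_word (map XY (concat (replicate s [True, False]))) i j (deriv_var (AV b j) f))" for i j
    using homog_mult[OF homog_pv[of xw "AV a i"] *[OF homog_deriv_A[OF assms]]] by (simp add: xw_def)
  then show ?thesis
    unfolding yop_def ABw_def AB_def opA_def opB_def mul_var_pv by (intro homog_sum)
qed

definition ystable :: "('n::finite, 'N::finite) pol set \<Rightarrow> bool"
  where "ystable U \<longleftrightarrow> polv.subspace U \<and> (\<forall>f\<in>U. \<forall>a s b. yop a s b f \<in> U)"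

definition yirreducible :: "('n::finite, 'N::finite) pol set \<Rightarrow> bool"
  where "yirreducible U \<longleftrightarrow> ystable U \<and> U \<noteq> {0} \<and> (\<forall>W. ystable W \<and> W \<subseteq> U \<longrightarrow> W = {0} \<or> W = U)"

lemma ystable_complement:
  assumes "ystable U" "ystable W"
  shows "ystable {f \<in> U. \<forall>w\<in>W. ip f w = 0}"
  using assms unfolding ystable_def
  by (auto intro!: polv.subspaceI simp: polv.subspace_0 polv.subspace_add polv.subspace_scale ip_add_left ip_smul_left ip_yop)

lemma dim_HN_degree_less:
  fixes U W :: "('n::finite, 'N::finite) pol set"
  assumes "polv.subspace U" "polv.subspace W" "W \<subset> U" "U \<subseteq> HN_degree k d"
  shows "polv.dim W < polv.dim U"
proof -
  have keys: "ks f \<subseteq> {m. wdeg xw m = d \<and> wdeg aw m = k * CARD('N)}" if "f \<in> U" for f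
    using keys_HN_degree that assms(4) by blast
  obtain B where B: "finite B" "B \<subseteq> U" "\<not> polv.dependent B" "polv.span B = U"
    using finite_dim_basis[OF assms(1) finite_mons keys] by metis
  obtain C where C: "finite C" "C \<subseteq> W" "\<not> polv.dependent C" "polv.span C = W"
    using finite_dim_basis[OF assms(2) finite_mons keys] assms(3) by (metis psubsetD)
  obtain f where f: "f \<in> U" "f \<notin> W" using assms(3) by blast
  then have "\<not> polv.dependent (insert f C)"
    using polv.independent_insert[of f C] C by auto
  moreover have "insert f C \<subseteq> polv.span B" using f C B assms(3) by auto
  ultimately have "card (insert f C) \<le> card B"
    using polv.independent_span_bound[OF B(1)] by blast
  moreover have "f \<notin> C" using f(2) C(2) by blast
  moreover have "polv.dim W = card C" "polv.dim U = card B"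
    using polv.dim_eq_card[of C W] polv.dim_eq_card[of B U] B C by (metis polv.span_span)+
  ultimately show ?thesis using C(1) by simp
qed

definition orth :: "('n::finite, 'N::finite) pol set set \<Rightarrow> bool"
  where "orth S \<longleftrightarrow> (\<forall>U\<in>S. \<forall>W\<in>S. U \<noteq> W \<longrightarrow> (\<forall>f\<in>U. \<forall>g\<in>W. ip f g = 0))"

text \<open>A nonzero invariant subspace of least dimension is irreducible. Its complement is
  invariant by \<open>ystable_complement\<close> and of smaller dimension, so the induction
  continues there.\<close>

lemma orthogonal_decomposition:
  fixes U :: "('n::finite, 'N::finite) pol set"
  assumes "ystable U" "U \<subseteq> HN_degree k d"
  shows "\<exists>S. (\<forall>W\<in>S. yirreducible W \<and> W \<subseteq> U) \<and> orth S \<and> U \<subseteq> polv.span (\<Union>S)"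
  using assms
proof (induction "polv.dim U" arbitrary: U rule: less_induct)
  case less
  have sub: "polv.subspace U" using less.prems by (simp add: ystable_def)
  show ?case
  proof (cases "U = {0}")
    case True
    then show ?thesis by (intro exI[of _ "{}"]) (simp add: orth_def)
  next
    case False
    define P where "P = (\<lambda>W. ystable W \<and> W \<subseteq> U \<and> W \<noteq> {0})"
    have "P U" using less.prems False by (simp add: P_def)
    then obtain W where W: "P W" "\<And>W'. P W' \<Longrightarrow> polv.dim W \<le> polv.dim W'"
      using ex_has_least_nat[of P U polv.dim] by blast
    then have yW: "ystable W" "W \<subseteq> U" "W \<noteq> {0}" and sW: "polv.subspace W" by (auto simp: P_def ystable_def)
    have irr: "yirreducible W"
      unfolding yirreducible_def
    proof (intro conjI allI impI yW)
      fix W' assume W': "ystable W' \<and> W' \<subseteq> W"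
      show "W' = {0} \<or> W' = W"
      proof (rule ccontr)
        assume n: "\<not> (W' = {0} \<or> W' = W)"
        then have "polv.dim W' < polv.dim W"
          using W' yW less.prems by (intro dim_HN_degree_less[OF sW]) (auto simp: ystable_def)
        moreover have "P W'" using W' n yW by (auto simp: P_def)
        ultimately show False using W(2)[of W'] by simp
      qed
    qed
    let ?C = "{f \<in> U. \<forall>w\<in>W. ip f w = 0}"
    have C: "ystable ?C" by (rule ystable_complement[OF less.prems(1) yW(1)])
    have W0: "0 \<in> W" using sW by (rule polv.subspace_0)
    then obtain w where w: "w \<in> W" "w \<noteq> 0" using yW(3) by blast
    then have "w \<notin> ?C" using ip_self_eq_0[of w] by blast
    then have "?C \<subset> U" using w yW(2) by blast
    then have dim: "polv.dim ?C < polv.dim U"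
      using C less.prems by (intro dim_HN_degree_less[OF sub]) (auto simp: ystable_def)
    have "?C \<subseteq> HN_degree k d" using less.prems(2) by auto
    from less.hyps[OF dim C this] obtain S where
      S: "\<forall>W\<in>S. yirreducible W \<and> W \<subseteq> ?C" "orth S" "?C \<subseteq> polv.span (\<Union>S)"
      by (elim exE conjE) (rule that)
    have "orth (insert W S)"
      unfolding orth_def
    proof (intro ballI impI)
      fix V V' f g assume V: "V \<in> insert W S" "V' \<in> insert W S" "V \<noteq> V'" "f \<in> V" "g \<in> V'"
      have o: "ip h h' = 0" "ip h' h = 0" if "h \<in> V''" "V'' \<in> S" "h' \<in> W" for h h' V''
      proof -
        show "ip h h' = 0" using S(1) that by blast
        then show "ip h' h = 0" using ip_commute[of h' h] by simp
      qed
      show "ip f g = 0" using V o S(2) unfolding orth_def by (metis insertE)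
    qed
    moreover have "U \<subseteq> polv.span (\<Union>(insert W S))"
    proof
      fix f assume f: "f \<in> U"
      obtain u where u: "u \<in> W" "\<And>b. b \<in> W \<Longrightarrow> ip (f - u) b = 0"
        using projection_HN_degree[OF sW, of k d f] yW(2) less.prems(2) by blast
      have "f - u \<in> U" using f u(1) yW(2) by (intro polv.subspace_diff sub) auto
      then have "f - u \<in> polv.span (\<Union>S)" using S(3) u(2) by blast
      then have "f - u \<in> polv.span (\<Union>(insert W S))"
        using polv.span_mono[of "\<Union>S" "\<Union>(insert W S)"] by auto
      moreover have "u \<in> polv.span (\<Union>(insert W S))" using u(1) by (intro polv.span_base) auto
      ultimately have "f - u + u \<in> polv.span (\<Union>(insert W S))" by (rule polv.span_add)
      then show "f \<in> polv.span (\<Union>(insert W S))" by simp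
    qed
    ultimately show ?thesis using irr yW S(1) by (intro exI[of _ "insert W S"]) auto
  qed
qed

text \<open>The vectors that have a decomposition form a subspace containing every summand. For
  uniqueness, pair the difference of two decompositions with its own component in a summand: by
  orthogonality only the norm of that component survives.\<close>

lemma orth_direct_sum:
  fixes V :: "('n::finite, 'N::finite) pol set"
  assumes S: "orth S" "\<And>W. W \<in> S \<Longrightarrow> polv.subspace W \<and> W \<subseteq> V" and V: "V \<subseteq> polv.span (\<Union>S)"
  shows "direct_sum_of V S"
proof -
  let ?P = "\<lambda>v c. (\<forall>W\<in>S. c W \<in> W) \<and> (\<forall>W. W \<notin> S \<longrightarrow> c W = 0) \<and>
    finite {W. c W \<noteq> 0} \<and> v = (\<Sum>W\<in>{W. c W \<noteq> 0}. c W)"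
  have sum: "(\<Sum>W\<in>{W. c W \<noteq> 0}. c W) = (\<Sum>W\<in>F. c W)" if "finite F" "{W. c W \<noteq> 0} \<subseteq> F"
    for F and c :: "('n, 'N) pol set \<Rightarrow> ('n, 'N) pol"
    using that by (intro sum.mono_neutral_left) auto
  have sub: "polv.subspace W" if "W \<in> S" for W using S(2) that by blast
  have "polv.subspace {v. \<exists>c. ?P v c}"
  proof (rule polv.subspaceI)
    show "0 \<in> {v. \<exists>c. ?P v c}"
      using polv.subspace_0[OF sub] by (intro CollectI exI[of _ "\<lambda>_. 0"]) simp
  next
    fix v v' assume "v \<in> {v. \<exists>c. ?P v c}" "v' \<in> {v. \<exists>c. ?P v c}"
    then obtain c c' where c: "?P v c" "?P v' c'" by blast
    let ?F = "{W. c W \<noteq> 0} \<union> {W. c' W \<noteq> 0}"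
    have F: "finite ?F" using c by blast
    have "{W. c W + c' W \<noteq> 0} \<subseteq> ?F" by auto
    moreover from this have "finite {W. c W + c' W \<noteq> 0}" using F by (rule finite_subset)
    moreover have "v + v' = (\<Sum>W\<in>?F. c W) + (\<Sum>W\<in>?F. c' W)"
      using c sum[OF F, of c] sum[OF F, of c'] by auto
    ultimately have "?P (v + v') (\<lambda>W. c W + c' W)"
      using c polv.subspace_add[OF sub] sum[OF F, of "\<lambda>W. c W + c' W"] by (simp add: sum.distrib)
    then show "v + v' \<in> {v. \<exists>c. ?P v c}"
      by (intro CollectI exI[of "?P (v + v')" "\<lambda>W. c W + c' W"])
  next
    fix a v assume "v \<in> {v. \<exists>c. ?P v c}"
    then obtain c where c: "?P v c" by blast
    let ?F = "{W. c W \<noteq> 0}"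
    have F: "finite ?F" using c by blast
    have "{W. smul a (c W) \<noteq> 0} \<subseteq> ?F" by auto
    moreover from this have "finite {W. smul a (c W) \<noteq> 0}" using F by (rule finite_subset)
    ultimately have "?P (smul a v) (\<lambda>W. smul a (c W))"
      using c polv.subspace_scale[OF sub] sum[OF F, of "\<lambda>W. smul a (c W)"] by (simp add: smul_sum)
    then show "smul a v \<in> {v. \<exists>c. ?P v c}"
      by (intro CollectI exI[of "?P (smul a v)" "\<lambda>W. smul a (c W)"])
  qed
  moreover have "\<Union>S \<subseteq> {v. \<exists>c. ?P v c}"
  proof clarify
    fix v W assume vW: "W \<in> S" "v \<in> W"
    let ?c = "\<lambda>W'. if W' = W then v else 0"
    have "{W'. ?c W' \<noteq> 0} \<subseteq> {W}" by auto
    moreover from this have "finite {W'. ?c W' \<noteq> 0}" by (rule finite_subset) simp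
    ultimately have "?P v ?c"
      using vW polv.subspace_0[OF sub] sum[of "{W}" ?c] by simp
    then show "\<exists>c. ?P v c" by (rule exI[of "?P v" ?c])
  qed
  ultimately have "polv.span (\<Union>S) \<subseteq> {v. \<exists>c. ?P v c}" by (intro polv.span_minimal)
  note span = subset_trans[OF V this]
  have ex: "\<exists>c. ?P v c" if "v \<in> V" for v
    by (rule CollectD[OF subsetD[OF span that]])
  have unique: "c = c'" if c: "?P v c" "?P v c'" for v c c'
  proof
    fix W
    let ?F = "{W. c W \<noteq> 0} \<union> {W. c' W \<noteq> 0}"
    have F: "finite ?F" using c by blast
    have eq: "(\<Sum>W\<in>?F. c W - c' W) = 0"
      using c sum[OF F, of c] sum[OF F, of c'] by (simp add: sum_subtractf) 
    show "c W = c' W"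
    proof (cases "W \<in> ?F")
      case True
      let ?d = "c W - c' W"
      have WS: "W \<in> S" using True c by blast
      have "0 = ip (\<Sum>W\<in>?F. c W - c' W) ?d" unfolding eq by simp
      also have "\<dots> = (\<Sum>W'\<in>?F. if W' = W then ip ?d ?d else 0)"
        unfolding ip_sum_left
      proof (rule sum.cong[OF refl])
        fix W' assume "W' \<in> ?F"
        then have W'S: "W' \<in> S" using c by blast
        have "c W' - c' W' \<in> W'" "?d \<in> W"
          using c WS W'S by (auto intro: polv.subspace_diff[OF sub])
        then show "ip (c W' - c' W') ?d = (if W' = W then ip ?d ?d else 0)"
          using S(1) WS W'S unfolding orth_def by auto
      qed
      also have "\<dots> = ip ?d ?d" using True F by simp
      finally show ?thesis using ip_self_eq_0[of ?d] by simp
    qed auto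
  qed
  show ?thesis unfolding direct_sum_of_def
  proof (intro conjI ballI)
    show "\<exists>!c. ?P v c" if "v \<in> V" for v
      by (rule ex_ex1I[OF ex[OF that] unique])
  qed (use S(2) in blast)
qed

theorem semisimple_Yangian:
  fixes act :: "'n::finite yangian_free set \<Rightarrow> ('n, 'N::finite) oper"
  assumes act: "yangian_action k act"
  shows "semisimple_module Yangian (HN k) act"
proof -
  let ?V = "HN k :: ('n, 'N) pol set"
  have mod: "left_module (presented yangian_rel) ?V act"
    and const: "\<And>c f. f \<in> HN k \<Longrightarrow> act (cls yangian_rel (const c)) f = smul c f"
    and gen: "\<And>a s b f. f \<in> HN k \<Longrightarrow> act (cls yangian_rel (gen (GenY a b s))) f = yop a s b f"
    using act unfolding yangian_action_def Yangian_def AB_concat by blast+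
  have submod: "submodule_of (presented yangian_rel) ?V act W" if W: "ystable W" "W \<subseteq> ?V" for W
  proof (rule submodule_presentedI[OF mod W(2)])
    have sub: "polv.subspace W" using W(1) by (simp add: ystable_def)
    show "0 \<in> W" by (rule polv.subspace_0[OF sub])
    show "v - w \<in> W" if "v \<in> W" "w \<in> W" for v w using sub that by (rule polv.subspace_diff)
    show "act (cls yangian_rel (const c)) v \<in> W" if "v \<in> W" for c v
      using that W const polv.subspace_scale[OF sub that] by auto
    show "act (cls yangian_rel (gen g)) v \<in> W" if "v \<in> W" for g v
      using that W gen by (cases g) (auto simp: ystable_def)
  qed
  have ystable: "ystable W" if W: "submodule_of (presented yangian_rel) ?V act W" for W
  proof -
    have WV: "W \<subseteq> ?V" using W by (simp add: submodule_of_def)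
    have "polv.subspace W" using submodule_subspace[OF W] const by blast
    moreover have "yop a s b f \<in> W" if "f \<in> W" for a s b f
      using submodule_stepD[OF W that, of "gen (GenY a b s)"] gen that WV by auto
    ultimately show ?thesis by (simp add: ystable_def)
  qed
  have simple: "simple_module (presented yangian_rel) W act" if W: "yirreducible W" "W \<subseteq> ?V" for W
    unfolding simple_module_def
  proof (intro conjI allI impI)
    show "left_module (presented yangian_rel) W act"
      using submod[OF _ W(2)] W(1) by (simp add: submodule_of_def yirreducible_def)
    show "W \<noteq> {0}" using W(1) by (simp add: yirreducible_def)
    fix U assume U: "submodule_of (presented yangian_rel) W act U"
    then have "submodule_of (presented yangian_rel) ?V act U" "U \<subseteq> W"
      using W(2) by (auto simp: submodule_of_def)
    then show "U = {0} \<or> U = W" using ystable W(1) by (simp add: yirreducible_def)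
  qed
  \<comment> \<open>Invariance of \<open>HN k\<close> is part of the given module structure; the
    energy is preserved because each factor XY removes one X and restores one.\<close>
  have "ystable (HN_degree k d :: ('n, 'N) pol set)" for d
  proof -
    have "yop a s b f \<in> ?V" if "f \<in> ?V" for a s b f
      using submodule_stepD[of yangian_rel ?V act ?V f "gen (GenY a b s)"] gen that mod by (simp add: submodule_of_def)
    then show ?thesis by (auto simp: ystable_def subspace_HN_degree HN_degree_iff homog_yop)
  qed
  then have "\<exists>S. (\<forall>W\<in>S. yirreducible W \<and> W \<subseteq> HN_degree k d) \<and> orth S
      \<and> HN_degree k d \<subseteq> polv.span (\<Union>S :: ('n, 'N) pol set)" for d
    by (rule orthogonal_decomposition[OF _ order_refl])
  then obtain S where S: "\<And>d W. W \<in> S d \<Longrightarrow> yirreducible W \<and> W \<subseteq> HN_degree k d" "\<And>d. orth (S d)"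
    "\<And>d. HN_degree k d \<subseteq> polv.span (\<Union>(S d) :: ('n, 'N) pol set)" by metis
  let ?S = "\<Union>d. S d"
  have S': "yirreducible W \<and> W \<subseteq> ?V" if W: "W \<in> ?S" for W
  proof -
    obtain d where "W \<in> S d" using W by blast
    then have "yirreducible W" "W \<subseteq> HN_degree k d" using S(1) by blast+
    then show ?thesis by (auto simp: HN_degree_iff)
  qed
  have "orth ?S"
    unfolding orth_def
  proof (intro ballI impI)
    fix U W f g assume a: "U \<in> ?S" "W \<in> ?S" "U \<noteq> W" "f \<in> U" "g \<in> W"
    then obtain d e where de: "U \<in> S d" "W \<in> S e" by blast
    show "ip f g = 0"
    proof (cases "d = e")
      case True
      then show ?thesis using S(2)[of d] de a unfolding orth_def by blast
    next
      case False
      have "f \<in> HN_degree k d" "g \<in> HN_degree k e" using S(1) de a by blast+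
      then have "homog xw d f" "homog xw e g" by (simp_all add: HN_degree_iff)
      then show ?thesis using False by (rule ip_homog)
    qed
  qed
  moreover have "?V \<subseteq> polv.span (\<Union>?S)"
  proof
    fix f assume f: "f \<in> ?V"
    have "hcomp xw d f \<in> polv.span (\<Union>?S)" for d
      using hcomp_HN[OF f, of d] S(3)[of d] polv.span_mono[of "\<Union>(S d)" "\<Union>?S"] by blast
    then have "(\<Sum>d\<in>wdeg xw ` ks f. hcomp xw d f) \<in> polv.span (\<Union>?S)" by (intro polv.span_sum)
    then show "f \<in> polv.span (\<Union>?S)" by (subst (asm) sum_hcomp) simp_all
  qed
  ultimately have "direct_sum_of ?V ?S"
    using S' by (intro orth_direct_sum) (auto simp: yirreducible_def ystable_def)
  moreover have "submodule_of (presented yangian_rel) ?V act W \<and> simple_module (presented yangian_rel) W act"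
    if "W \<in> ?S" for W
    using S'[OF that] submod simple by (simp add: yirreducible_def)
  ultimately show ?thesis
    using mod unfolding semisimple_module_def Yangian_def by blast
qed

theorem theoremB:
  fixes k :: nat
  assumes "k > 0"
  shows
    "(\<forall>act :: 'n::finite ddca_free set \<Rightarrow> ('n, 'N::finite) oper.
        ddca_action k act \<longrightarrow>
          simple_module (DDCA :: 'n ddca_free set ring) (HN k) act) \<and>
     (\<exists>act :: ('n glz, complex) free_alg set \<Rightarrow> ('n, 'N) oper.
        Uglz_action k act \<and>
        (\<forall>v \<in> ground_states k. v \<noteq> 0 \<longrightarrow>
          generates_module (Uglz :: ('n glz, complex) free_alg set ring) (HN k) act v)) \<and>
     (\<forall>act :: 'n yangian_free set \<Rightarrow> ('n, 'N) oper.
        yangian_action k act \<longrightarrow>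
          semisimple_module (Yangian :: 'n yangian_free set ring) (HN k) act)"
  using simple_DDCA[OF assms] generates_ground_state[OF assms] Uglz_action_Uact[of k] semisimple_Yangian[of k]
  by blast

end
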